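(* Let $(\boldsymbol{\varepsilon},\boldsymbol{\mu})$ be a photonic crystal with spectral bands $\omega_m$, dispersion curves $\gamma_m$ ($m\ge1$), $\Gamma=\bigcup_m\gamma_m$ and $\Gamma^c=\mathbb{C}\setminus\Gamma$. Assume that $\gamma_n=\omega_n(\mathbb{T})$ is a closed dispersion curve that does not intersect the other dispersion curves $\gamma_m$, $m\neq n$, and that $\omega_n(\cdot)$ can be extended analytically near $\mathbb{T}$. Let $D_n^i$ be a Jordan domain partitioned by $\gamma_n$, with boundary given by the simple closed curve $\gamma_n^i$ (and with $D_n^i$ not meeting the other dispersion curves). Let $D\subset\Gamma^c$ be a connected component that is a principal gapped component, i.e. $\mathrm{Ind}(D)=0$. Assume that: (i) there exists $\xi_0\in\mathbb{T}$ such that $\zeta_0=\omega_n(\xi_0)\in\gamma_n^i$ is a smooth point of $\gamma_n$ with a well-defined outward unit normal vector $\nu$; additionally, $\zeta_0+t\nu\in D$ and $\zeta_0-t\nu\in D_n^i$ for sufficiently small $t>0$; (ii) the function $\omega_n(\xi)$ is analytic at $\xi_0$. If $\gamma_n^i$ is positively oriented, then $\mathrm{Ind}(D_n^i)=W(\gamma_n;\omega_B)=1$ for $\omega_B\in D_n^i$. Otherwise, $\mathrm{Ind}(D_n^i)=W(\gamma_n;\omega_B)=-1$.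
   Context: Medium and monodromy matrix. $\boldsymbol{\varepsilon},\boldsymbol{\mu}:\mathbb{R}\to\mathbb{C}^{2\times2}$ are bounded, piecewise continuous and $1$-periodic. Put $Q=\begin{pmatrix}0&-1\\1&0\end{pmatrix}$, $\mathcal{Q}=\begin{pmatrix}Q&0\\0&Q\end{pmatrix}$, $\mathcal{A}(z)=\mathrm{i}\begin{pmatrix}0&\boldsymbol{\mu}(z)\\-\boldsymbol{\varepsilon}(z)&0\end{pmatrix}$. For $\omega\in\mathbb{C}$ let $\mathcal{T}_\omega(z,0)\in\mathbb{C}^{4\times4}$ solve $\frac{d}{dz}\mathcal{T}_\omega(z,0)=\omega\mathcal{Q}^{-1}\mathcal{A}(z)\mathcal{T}_\omega(z,0)$, $\mathcal{T}_\omega(0,0)=I$. The monodromy matrix is $\mathcal{M}(\omega)=\mathcal{T}_\omega(1,0)$; it has determinant $1$, and its four eigenvalues are denoted $\lambda_1(\omega),\dots,\lambda_4(\omega)$. Bands. $\mathbb{T}=\{e^{\mathrm{i}k}:k\in(-\pi,\pi]\}$. For $k\in[-\pi,\pi]$ and $\xi=e^{\mathrm{i}k}$, the set $\Omega(k)$ of eigenfrequencies consists of those $\omega\in\mathbb{C}$ for which $\Phi'=\omega\mathcal{Q}^{-1}\mathcal{A}(z)\Phi$, $\Phi(z+1)=\xi\,\Phi(z)$ has a nonzero solution, equivalently for which $\lambda_j(\omega)=e^{\mathrm{i}k}$ for some $j$. From the family $\{\Omega(k)\}$ one defines the spectral bands $\{\omega_n(k)\}_{n\ge1}$ such that each $\omega_n(k)$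 is a continuous function of $k$, and $\min_k\mathrm{Re}\,\omega_n(k)\le\min_k\mathrm{Re}\,\omega_{n+1}(k)$, $\max_k\mathrm{Re}\,\omega_n(k)\le\max_k\mathrm{Re}\,\omega_{n+1}(k)$; the photonic crystal is assumed to be one for which these criteria define the bands without ambiguity. The dispersion curves are $\gamma_n=\{\omega_n(k):k\in[-\pi,\pi]\}$. When $\omega_n(-\pi)=\omega_n(\pi)$, $\gamma_n$ is a closed curve, and $\omega_n$ is viewed as a function of $\xi\in\mathbb{T}$, so $\gamma_n=\omega_n(\mathbb{T})$. Domains partitioned by $\gamma_n$. The closed curve $\gamma_n$ partitions the plane into one unbounded connected component $D_n^e$ and finitely many bounded components $D_n^1,\dots,D_n^{i_0}$. It is assumed throughout that each $D_n^i$ is a Jordan domain bounded by a Jordan curve $\gamma_n^i\subset\gamma_n$ that is smooth everywhere except at finitely many corners, and that $\gamma_m^i\neq\gamma_n^i$ as sets for $m\neq n$. At a smooth point $\zeta\in\gamma_n^i$, the outward unit normal $\nu(\zeta)$ is the unit normal pointing into $D_n^e$. Orientation. $\gamma_n^i$ is oriented counterclockwise (positively oriented) if $\omega_n$ preserves the counterclockwise orientation of $\mathbb{T}$ for $\omega_n(\xi)\in\gamma_n^i$. More precisely, let $\xi_0=(\cos k_0,\sin k_0)\in\mathbb{T}$ be such that $\zeta_0=\omega_n(\xi_0)$ is a smooth point of $\gamma_n^i$, let $\tau=(-\sin k_0,\cos k_0)$ be the unit tangent to $\mathbb{T}$ at $\xi_0$, and let $\omega_n'(\xi_0)\tau$ be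 the tangent vector to $\gamma_n^i$ at $\zeta_0$; then $\gamma_n^i$ is positively oriented if $\nu(\zeta_0)$ points in the direction obtained by rotating $\omega_n'(\xi_0)\tau$ clockwise by $\pi/2$. Otherwise it is oriented clockwise (negatively oriented). Index and winding number. $\mathrm{Ind}(\omega)=\frac12\big(\#\{j:|\lambda_j(\omega)|<1\}-\#\{j:|\lambda_j(\omega)|>1\}\big)$. It is constant on each connected component of $\Gamma^c$, and the index of a component is this constant; a component with index $0$ is called a principal gapped component. $W(\gamma_n;\omega_B)=\frac{1}{2\pi\mathrm{i}}\int_{\xi\in\mathbb{T}}\frac{d\omega_n(\xi)}{\omega_n(\xi)-\omega_B}$.
   Formalization: "Otherwise" is read as: the direction is clockwise at every smooth boundary point with nonzero tangent (positive likewise at every such point); curves traversing the boundary in both directions, where orientation is undefined and W can be 0, are excluded. *)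

theory Defs
  imports "HOL-Complex_Analysis.Complex_Analysis" "HOL-Computational_Algebra.Computational_Algebra"
begin

section \<open>Medium and monodromy matrix\<close>

definition piecewise_continuous :: "(real \<Rightarrow> 'a::topological_space) \<Rightarrow> bool" where
  "piecewise_continuous f \<longleftrightarrow>
     (\<forall>a b. finite {z \<in> {a..b}. \<not> isCont f z}) \<and>
     (\<forall>z. (\<exists>l. (f \<longlongrightarrow> l) (at_left z)) \<and> (\<exists>l. (f \<longlongrightarrow> l) (at_right z)))"

definition photonic_crystal ::
    "(real \<Rightarrow> complex^2^2) \<Rightarrow> (real \<Rightarrow> complex^2^2) \<Rightarrow> bool" where
  "photonic_crystal eps mu \<longleftrightarrow>
     (\<forall>f\<in>{eps, mu}. bounded (range f) \<and> piecewise_continuous f \<and> (\<forall>z. f (z + 1) = f z))"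

text \<open>The index type \<^typ>\<open>2 + 2\<close> (disjoint sum) has four elements and carries the
  \<open>2 \<times> 2\<close> block structure of the \<open>4 \<times> 4\<close> matrices.\<close>

definition block_matrix ::
    "'a^2^2 \<Rightarrow> 'a^2^2 \<Rightarrow> 'a^2^2 \<Rightarrow> 'a^2^2 \<Rightarrow> 'a^(2+2)^(2+2)" where
  "block_matrix A B C D =
     (\<chi> i j. case i of
        Inl a \<Rightarrow> (case j of Inl b \<Rightarrow> A $ a $ b | Inr b \<Rightarrow> B $ a $ b)
      | Inr a \<Rightarrow> (case j of Inl b \<Rightarrow> C $ a $ b | Inr b \<Rightarrow> D $ a $ b))"

definition Q2 :: "complex^2^2" where
  "Q2 = vector [vector [0, -1], vector [1, 0]]"

definition Q4 :: "complex^(2+2)^(2+2)" where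
  "Q4 = block_matrix Q2 0 0 Q2"

definition medium_matrix ::
    "(real \<Rightarrow> complex^2^2) \<Rightarrow> (real \<Rightarrow> complex^2^2) \<Rightarrow> real \<Rightarrow> complex^(2+2)^(2+2)" where
  "medium_matrix eps mu z = mat \<i> ** block_matrix 0 (mu z) (- eps z) 0"

definition system_matrix ::
    "(real \<Rightarrow> complex^2^2) \<Rightarrow> (real \<Rightarrow> complex^2^2) \<Rightarrow> complex \<Rightarrow> real
      \<Rightarrow> complex^(2+2)^(2+2)" where
  "system_matrix eps mu w z = mat w ** (matrix_inv Q4 ** medium_matrix eps mu z)"

text \<open>As the coefficients are only piecewise continuous, a solution is a continuous function
  that satisfies the differential equation wherever both coefficients are continuous.\<close>

definition transfer_matrix ::
    "(real \<Rightarrow> complex^2^2) \<Rightarrow> (real \<Rightarrow> complex^2^2) \<Rightarrow> complex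
      \<Rightarrow> (real \<Rightarrow> complex^(2+2)^(2+2)) \<Rightarrow> bool" where
  "transfer_matrix eps mu w T \<longleftrightarrow>
     continuous_on UNIV T \<and> T 0 = mat 1 \<and>
     (\<forall>z. isCont eps z \<and> isCont mu z \<longrightarrow>
        (T has_vector_derivative (system_matrix eps mu w z ** T z)) (at z))"

definition monodromy ::
    "(real \<Rightarrow> complex^2^2) \<Rightarrow> (real \<Rightarrow> complex^2^2) \<Rightarrow> complex \<Rightarrow> complex^(2+2)^(2+2)" where
  "monodromy eps mu w = (THE T. transfer_matrix eps mu w T) 1"

definition charpoly :: "'a::comm_ring_1^'n^'n \<Rightarrow> 'a poly" where
  "charpoly A = det (\<chi> i j. [:- (A $ i $ j), if i = j then 1 else 0:])"

text \<open>Eigenvalues are counted with algebraic multiplicity.\<close>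

definition eigenvalues :: "complex^'n^'n \<Rightarrow> complex multiset" where
  "eigenvalues A = proots (charpoly A)"

definition Ind ::
    "(real \<Rightarrow> complex^2^2) \<Rightarrow> (real \<Rightarrow> complex^2^2) \<Rightarrow> complex \<Rightarrow> real" where
  "Ind eps mu w =
     (real (size {#l \<in># eigenvalues (monodromy eps mu w). cmod l < 1#}) -
      real (size {#l \<in># eigenvalues (monodromy eps mu w). cmod l > 1#})) / 2"

definition has_index ::
    "(real \<Rightarrow> complex^2^2) \<Rightarrow> (real \<Rightarrow> complex^2^2) \<Rightarrow> complex set \<Rightarrow> real \<Rightarrow> bool" where
  "has_index eps mu D c \<longleftrightarrow> (\<forall>w\<in>D. Ind eps mu w = c)"

section \<open>Bands and dispersion curves\<close>

definition bloch_solution ::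
    "(real \<Rightarrow> complex^2^2) \<Rightarrow> (real \<Rightarrow> complex^2^2) \<Rightarrow> complex \<Rightarrow> complex
      \<Rightarrow> (real \<Rightarrow> complex^(2+2)) \<Rightarrow> bool" where
  "bloch_solution eps mu xi w \<Phi> \<longleftrightarrow>
     continuous_on UNIV \<Phi> \<and>
     (\<forall>z. isCont eps z \<and> isCont mu z \<longrightarrow>
        (\<Phi> has_vector_derivative (system_matrix eps mu w z *v \<Phi> z)) (at z)) \<and>
     (\<forall>z. \<Phi> (z + 1) = xi *s \<Phi> z)"

definition eigenfrequencies ::
    "(real \<Rightarrow> complex^2^2) \<Rightarrow> (real \<Rightarrow> complex^2^2) \<Rightarrow> real \<Rightarrow> complex set" where
  "eigenfrequencies eps mu k =
     {w. \<exists>\<Phi>. bloch_solution eps mu (cis k) w \<Phi> \<and> (\<exists>z. \<Phi> z \<noteq> 0)}"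

text \<open>The labels run through the integers from 1 on, or through all integers. The second choice
  is needed for most crystals: the set of eigenfrequencies is invariant under
  \<open>\<omega> \<mapsto> -\<omega>\<close>, so if their real parts are unbounded, a labelling with
  increasing real parts cannot have a first band.\<close>

definition spectral_bands ::
    "(real \<Rightarrow> complex^2^2) \<Rightarrow> (real \<Rightarrow> complex^2^2) \<Rightarrow> int set
      \<Rightarrow> (int \<Rightarrow> real \<Rightarrow> complex) \<Rightarrow> bool" where
  "spectral_bands eps mu N \<omega> \<longleftrightarrow>
     (N = {1..} \<or> N = UNIV) \<and>
     (\<forall>n\<in>N. continuous_on {-pi..pi} (\<omega> n)) \<and>
     (\<forall>k\<in>{-pi..pi}. (\<lambda>n. \<omega> n k) ` N = eigenfrequencies eps mu k) \<and>
     (\<forall>n\<in>N.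
        (INF k\<in>{-pi..pi}. Re (\<omega> n k)) \<le> (INF k\<in>{-pi..pi}. Re (\<omega> (n + 1) k)) \<and>
        (SUP k\<in>{-pi..pi}. Re (\<omega> n k)) \<le> (SUP k\<in>{-pi..pi}. Re (\<omega> (n + 1) k)))"

definition dispersion_curve :: "(int \<Rightarrow> real \<Rightarrow> complex) \<Rightarrow> int \<Rightarrow> complex set" where
  "dispersion_curve \<omega> n = \<omega> n ` {-pi..pi}"

definition closed_band :: "(int \<Rightarrow> real \<Rightarrow> complex) \<Rightarrow> int \<Rightarrow> bool" where
  "closed_band \<omega> n \<longleftrightarrow> \<omega> n (-pi) = \<omega> n pi"

definition all_curves :: "int set \<Rightarrow> (int \<Rightarrow> real \<Rightarrow> complex) \<Rightarrow> complex set" where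
  "all_curves N \<omega> = (\<Union>n\<in>N. dispersion_curve \<omega> n)"

definition principal_gapped_component ::
    "(real \<Rightarrow> complex^2^2) \<Rightarrow> (real \<Rightarrow> complex^2^2) \<Rightarrow> int set
      \<Rightarrow> (int \<Rightarrow> real \<Rightarrow> complex) \<Rightarrow> complex set \<Rightarrow> bool" where
  "principal_gapped_component eps mu N \<omega> D \<longleftrightarrow>
     D \<in> components (- all_curves N \<omega>) \<and> has_index eps mu D 0"

section \<open>Domains partitioned by a curve\<close>

definition bounded_component :: "complex set \<Rightarrow> complex set \<Rightarrow> bool" where
  "bounded_component C B \<longleftrightarrow> B \<in> components (- C) \<and> bounded B"

text \<open>Near a smooth point the set \<open>C\<close> is a regular embedded \<open>C\<^sup>1\<close> arc; the
  homeomorphism condition excludes that \<open>C\<close> returns to the point.\<close>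

definition unit_normal :: "complex set \<Rightarrow> complex \<Rightarrow> complex \<Rightarrow> bool" where
  "unit_normal C \<zeta> \<nu> \<longleftrightarrow> norm \<nu> = 1 \<and>
     (\<exists>U g h. open U \<and> \<zeta> \<in> U \<and>
        homeomorphism {-1<..<1::real} (C \<inter> U) g h \<and> g 0 = \<zeta> \<and>
        g C1_differentiable_on {-1<..<1} \<and>
        (\<forall>t\<in>{-1<..<1}. vector_derivative g (at t) \<noteq> 0) \<and>
        \<nu> \<bullet> vector_derivative g (at 0) = 0)"

definition smooth_point :: "complex set \<Rightarrow> complex \<Rightarrow> bool" where
  "smooth_point C \<zeta> \<longleftrightarrow> (\<exists>\<nu>. unit_normal C \<zeta> \<nu>)"

text \<open>For a compact connected \<open>C\<close> the library's \<^term>\<open>outside C\<close> is the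
  unbounded component of the complement.\<close>

definition outward_unit_normal :: "complex set \<Rightarrow> complex \<Rightarrow> complex \<Rightarrow> bool" where
  "outward_unit_normal C \<zeta> \<nu> \<longleftrightarrow> unit_normal C \<zeta> \<nu> \<and>
     (\<forall>\<^sub>F t in at_right 0. \<zeta> + of_real t * \<nu> \<in> outside C)"

definition jordan_partition :: "complex set \<Rightarrow> bool" where
  "jordan_partition C \<longleftrightarrow>
     finite {B. bounded_component C B} \<and>
     (\<forall>B. bounded_component C B \<longrightarrow>
        (\<exists>g. simple_path g \<and> pathfinish g = pathstart g \<and> path_image g \<subseteq> C \<and>
             B = inside (path_image g) \<and> frontier B = path_image g \<and>
             finite {\<zeta> \<in> path_image g. \<not> smooth_point (path_image g) \<zeta>}))"

definition regular_curves :: "int set \<Rightarrow> (int \<Rightarrow> real \<Rightarrow> complex) \<Rightarrow> bool" where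
  "regular_curves N \<omega> \<longleftrightarrow>
     (\<forall>n\<in>N. closed_band \<omega> n \<longrightarrow> jordan_partition (dispersion_curve \<omega> n)) \<and>
     (\<forall>m\<in>N. \<forall>n\<in>N. m \<noteq> n \<and> closed_band \<omega> m \<and> closed_band \<omega> n \<longrightarrow>
        (\<forall>B B'. bounded_component (dispersion_curve \<omega> m) B \<and>
                bounded_component (dispersion_curve \<omega> n) B' \<longrightarrow>
                frontier B \<noteq> frontier B'))"

section \<open>Orientation and winding number\<close>

text \<open>Here \<open>f\<close> is a band as an analytic function near the unit circle. At
  \<open>\<xi> = exp(i k)\<close> the unit tangent \<open>(- sin k, cos k)\<close> of the circle is the complex
  number \<open>i \<xi>\<close>, and \<open>f'(\<xi>)\<close> acts on it by complex multiplication. A rotation by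
  \<open>\<pi>/2\<close> is clockwise for the factor \<open>-i\<close> and counterclockwise for \<open>i\<close>.\<close>

definition curve_tangent :: "(complex \<Rightarrow> complex) \<Rightarrow> complex \<Rightarrow> complex" where
  "curve_tangent f \<xi> = deriv f \<xi> * (\<i> * \<xi>)"

text \<open>The direction must be the same at every parameter that yields a smooth point with a nonzero
  tangent vector: a curve that runs along the boundary of \<open>B\<close> in both directions (as bands
  that are even in \<open>k\<close> do) has neither orientation.\<close>

definition positively_oriented :: "(complex \<Rightarrow> complex) \<Rightarrow> complex set \<Rightarrow> bool" where
  "positively_oriented f B \<longleftrightarrow>
     (\<forall>\<xi>\<in>sphere 0 1. \<forall>\<nu>.
        f \<xi> \<in> frontier B \<and> curve_tangent f \<xi> \<noteq> 0 \<and>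
        outward_unit_normal (f ` sphere 0 1) (f \<xi>) \<nu> \<longrightarrow>
        \<nu> = sgn (- \<i> * curve_tangent f \<xi>))"

definition negatively_oriented :: "(complex \<Rightarrow> complex) \<Rightarrow> complex set \<Rightarrow> bool" where
  "negatively_oriented f B \<longleftrightarrow>
     (\<forall>\<xi>\<in>sphere 0 1. \<forall>\<nu>.
        f \<xi> \<in> frontier B \<and> curve_tangent f \<xi> \<noteq> 0 \<and>
        outward_unit_normal (f ` sphere 0 1) (f \<xi>) \<nu> \<longrightarrow>
        \<nu> = sgn (\<i> * curve_tangent f \<xi>))"

definition band_winding :: "(complex \<Rightarrow> complex) \<Rightarrow> complex \<Rightarrow> complex" where
  "band_winding f w =
     1 / (2 * of_real pi * \<i>) * contour_integral (circlepath 0 1) (\<lambda>\<xi>. deriv f \<xi> / (f \<xi> - w))"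

end

theory Submission
  imports Defs
begin

text \<open>Write \<open>p(\<xi>, \<omega>)\<close> for the characteristic polynomial of the monodromy matrix at
  \<open>\<xi>\<close>; it is entire in \<open>\<omega>\<close>. Let \<open>f\<close> be the
  band \<open>\<omega>\<^sub>n\<close> as an analytic function near the unit circle. Off the dispersion curves the index is the number of
  eigenvalues in the open unit disc minus 2, and since the monodromy matrix has determinant 1 this
  number lies between 1 and 3. At all but finitely many points of \<open>\<gamma>\<^sub>n\<close> the identity theorem shows
  that the roots \<open>\<xi>\<close> of \<open>p(\<xi>, \<omega>)\<close> near the unit circle satisfy \<open>f \<xi> = \<omega>\<close>. Moving
  \<open>\<omega>\<close> across such a point \<open>\<zeta>\<close> along \<open>sgn (f' \<xi> * \<xi>)\<close> therefore pushes all the roots that lie on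
  the circle for \<open>\<omega> = \<zeta>\<close> from the inside to the outside. As one side has exactly two eigenvalues
  in the disc and the other at most three and at least one, a single simple root crosses; then the
  winding number of \<open>\<gamma>\<^sub>n\<close>, which vanishes on the outer side, jumps by 1 as well.\<close>

section \<open>Linear differential equations with piecewise continuous coefficients\<close>

text \<open>Why \<open>deriv f \<xi> * \<xi>\<close>: it is the radial derivative of
  \<open>f\<close>, so shifting \<omega> along it moves the root \<xi> outwards to first order. It
  also equals \<open>- \<i> * curve_tangent f \<xi>\<close>, and this is how orientation enters.
  Orientation is imposed at every preimage of a boundary point, so all unit roots over \<zeta> cross
  in the same sense; otherwise opposite crossings could cancel in the count, and the bounds 1 and 3
  would say nothing about the number of crossing roots. The obstacle is that the given point may be
  bad: \<open>deriv f\<close> may vanish at a preimage, or further roots may branch off the graph of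
  \<open>f\<close>. The crossing is therefore studied at another point of the same arc, and
  connected sectors on the two sides of the arc carry the two components over to it. Neither
  simplicity of the root nor injectivity of the band is known beforehand, so no root is followed by
  an implicit function. Roots are counted by winding numbers on two circles enclosing the unit
  circle, and the same circles measure the jump of the winding number of
  \<open>f - \<omega>\<close>.\<close>

lemma integrable_on_finite_discontinuities:
  fixes g :: "real \<Rightarrow> 'b::euclidean_space"
  assumes fin: "finite (S \<inter> {a..b})" and cont: "\<And>z. z \<notin> S \<Longrightarrow> isCont g z"
    and bd: "\<And>z. z \<in> {a..b} \<Longrightarrow> norm (g z) \<le> c"
  shows "g integrable_on {a..b}"
proof -
  let ?T = "{a..b} - S"
  have eq: "?T = {a..b} - (S \<inter> {a..b})" by blast
  have meas: "?T \<in> sets lebesgue"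
    unfolding eq using fin by (intro sets.Diff) (auto intro: negligible_imp_sets simp: negligible_finite)
  have spike: "h integrable_on ?T \<longleftrightarrow> h integrable_on {a..b}" for h :: "real \<Rightarrow> 'c::euclidean_space"
    by (rule integrable_spike_set_eq, rule negligible_subset[OF negligible_finite[OF fin]]) auto
  have "continuous_on ?T g"
    using cont by (intro continuous_at_imp_continuous_on) auto
  then have "g \<in> borel_measurable (lebesgue_on ?T)"
    using meas by (rule continuous_imp_measurable_on_sets_lebesgue)
  moreover have "(\<lambda>_. c) integrable_on ?T"
  proof -
    have "(\<lambda>_. c) integrable_on {a..b}" by (rule integrable_const_ivl)
    then show ?thesis by (simp only: spike)
  qed
  ultimately have "g integrable_on ?T"
    using bd meas by (intro measurable_bounded_by_integrable_imp_integrable[of g ?T "\<lambda>_. c"]) auto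
  then show ?thesis by (simp only: spike)
qed

text \<open>The integral from 0 to \<open>z\<close> for both signs of \<open>z\<close>: at least one of the two intervals is
  degenerate.\<close>

definition prim :: "(real \<Rightarrow> 'b::euclidean_space) \<Rightarrow> real \<Rightarrow> 'b" where
  "prim g z = integral {0..z} g - integral {z..0} g"

lemma prim_0 [simp]: "prim g 0 = 0"
  by (simp add: prim_def)

lemma prim_diff:
  assumes int: "\<And>a b. g integrable_on {a..b}" and "a \<le> b"
  shows "prim g b = prim g a + integral {a..b} g"
proof -
  consider "0 \<le> a" | "a \<le> 0" "0 \<le> b" | "b \<le> 0" using assms(2) by linarith
  then show ?thesis
  proof cases
    case 1
    have "integral {0..a} g + integral {a..b} g = integral {0..b} g"
      using 1 assms by (intro Henstock_Kurzweil_Integration.integral_combine) auto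
    moreover have "integral {b..0} g = 0" "integral {a..0} g = 0"
      using 1 assms(2) by (cases "b = 0"; cases "a = 0"; simp)+
    ultimately show ?thesis by (simp add: prim_def)
  next
    case 2
    have "integral {a..0} g + integral {0..b} g = integral {a..b} g"
      using 2 assms by (intro Henstock_Kurzweil_Integration.integral_combine) auto
    moreover have "integral {b..0} g = 0" "integral {0..a} g = 0"
      using 2 by (cases "b = 0"; cases "a = 0"; simp)+
    ultimately show ?thesis by (simp add: prim_def algebra_simps)
  next
    case 3
    have "integral {a..b} g + integral {b..0} g = integral {a..0} g"
      using 3 assms by (intro Henstock_Kurzweil_Integration.integral_combine) auto
    moreover have "integral {0..b} g = 0" "integral {0..a} g = 0"
      using 3 assms(2) by (cases "b = 0"; cases "a = 0"; simp)+
    ultimately show ?thesis by (simp add: prim_def algebra_simps)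
  qed
qed

lemma prim_has_vector_derivative:
  assumes int: "\<And>a b. g integrable_on {a..b}" and "isCont g z"
  shows "(prim g has_vector_derivative g z) (at z)"
proof -
  \<comment> \<open>The base point \<open>z - 1\<close> puts \<open>z\<close> in the interior of the
    interval, so one computation covers both signs of \<open>z\<close>.\<close>
  have "((\<lambda>u. integral {z - 1..u} g) has_vector_derivative g z) (at z within {z - 1..z + 1})"
    using assms
    by (intro integral_has_vector_derivative_continuous_at[where S = "{}", simplified])
      (auto intro: continuous_within_subset)
  then have "((\<lambda>u. prim g (z - 1) + integral {z - 1..u} g) has_vector_derivative g z) (at z within {z - 1..z + 1})"
    by (auto intro!: derivative_eq_intros)
  then have "((\<lambda>u. prim g (z - 1) + integral {z - 1..u} g) has_vector_derivative g z) (at z within {z - 1<..<z + 1})"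
    by (rule has_vector_derivative_within_subset) auto
  then have "(prim g has_vector_derivative g z) (at z within {z - 1<..<z + 1})"
  proof (rule has_vector_derivative_transform[rotated 2])
    show "prim g u = prim g (z - 1) + integral {z - 1..u} g" if "u \<in> {z - 1<..<z + 1}" for u
      by (rule prim_diff[OF int]) (use that in simp)
  qed simp
  then show ?thesis
    by (subst (asm) has_vector_derivative_within_open) simp_all
qed

lemma isCont_prim:
  assumes int: "\<And>a b. g integrable_on {a..b}"
  shows "isCont (prim g) z"
proof -
  have "continuous_on {z - 1..z + 1} (\<lambda>u. prim g (z - 1) + integral {z - 1..u} g)"
    by (intro continuous_intros indefinite_integral_continuous_1 int)
  then have "continuous_on {z - 1..z + 1} (prim g)"
  proof (rule continuous_on_eq)
    show "prim g (z - 1) + integral {z - 1..u} g = prim g u" if "u \<in> {z - 1..z + 1}" for u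
      by (rule prim_diff[OF int, symmetric]) (use that in simp)
  qed
  then show ?thesis
    by (rule continuous_on_interior) auto
qed

text \<open>Integrating a multiple of \<open>\<bar>s\<bar> ^ n\<close> raises the exponent by one
  and divides by \<open>Suc n\<close>. Iterated, this produces the factorials in the Picard
  bounds.\<close>

lemma norm_prim_le:
  assumes int: "\<And>a b. g integrable_on {a..b}"
    and bd: "\<And>s. \<bar>s\<bar> \<le> \<bar>z\<bar> \<Longrightarrow> norm (g s) \<le> c * \<bar>s\<bar> ^ n"
  shows "norm (prim g z) \<le> c * \<bar>z\<bar> ^ Suc n / real (Suc n)"
proof (cases "z \<ge> 0")
  case True
  have "((\<lambda>s. c * s ^ n) has_integral c * z ^ Suc n / real (Suc n) - c * 0 ^ Suc n / real (Suc n)) {0..z}"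
    using True
    by (intro fundamental_theorem_of_calculus)
      (auto intro!: derivative_eq_intros simp: has_real_derivative_iff_has_vector_derivative[symmetric] simp del: power_Suc of_nat_Suc)
  then have I: "((\<lambda>s. c * s ^ n) has_integral c * z ^ Suc n / real (Suc n)) {0..z}" by simp
  have "norm (integral {0..z} g) \<le> integral {0..z} (\<lambda>s. c * s ^ n)"
  proof (intro integral_norm_bound_integral int)
    show "norm (g s) \<le> c * s ^ n" if "s \<in> {0..z}" for s
      using bd[of s] that True by auto
  qed (use I in \<open>auto simp: has_integral_integrable\<close>)
  moreover have "integral {z..0} g = 0" using True by (cases "z = 0") auto
  ultimately show ?thesis using integral_unique[OF I] True by (simp add: prim_def)
next
  case False
  have "((\<lambda>s. c * (-s) ^ n) has_integral - (c * (-0) ^ Suc n / real (Suc n)) - - (c * (-z) ^ Suc n / real (Suc n))) {z..0}"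
    using False
    by (intro fundamental_theorem_of_calculus)
      (auto intro!: derivative_eq_intros simp: has_real_derivative_iff_has_vector_derivative[symmetric] simp del: power_Suc of_nat_Suc)
  then have I: "((\<lambda>s. c * (-s) ^ n) has_integral c * (-z) ^ Suc n / real (Suc n)) {z..0}" by simp
  have "norm (integral {z..0} g) \<le> integral {z..0} (\<lambda>s. c * (-s) ^ n)"
  proof (intro integral_norm_bound_integral int)
    show "norm (g s) \<le> c * (- s) ^ n" if "s \<in> {z..0}" for s
      using bd[of s] that False by auto
  qed (use I in \<open>auto simp: has_integral_integrable\<close>)
  moreover have "integral {0..z} g = 0" using False by auto
  ultimately show ?thesis using integral_unique[OF I] False by (simp add: prim_def)
qed

text \<open>The fundamental theorem of calculus survives finitely many exceptional points per
  interval because \<open>X\<close> is continuous there. It turns differential equations into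
  integral equations; with \<open>g = 0\<close> it proves constancy.\<close>

lemma eq_prim:
  fixes X :: "real \<Rightarrow> 'b::euclidean_space"
  assumes fin: "\<And>a b. finite (S \<inter> {a..b})" and cont: "continuous_on UNIV X"
    and int: "\<And>a b. g integrable_on {a..b}"
    and deriv: "\<And>z. z \<notin> S \<Longrightarrow> (X has_vector_derivative g z) (at z)"
  shows "X z = X 0 + prim g z"
proof -
  have *: "integral {a..b} g = X b - X a" if "a \<le> b" for a b
  proof (rule integral_unique, rule fundamental_theorem_of_calculus_interior_strong[of "S \<inter> {a..b}"])
    show "continuous_on {a..b} X" using cont continuous_on_subset by blast
  qed (use fin deriv that in auto)
  show ?thesis
    using *[of 0 z] *[of z 0] by (cases "z \<ge> 0"; cases "z = 0"; simp add: prim_def)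
qed

lemma prim_add:
  "(\<And>a b. g integrable_on {a..b}) \<Longrightarrow> (\<And>a b. h integrable_on {a..b}) \<Longrightarrow> prim (\<lambda>s. g s + h s) z = prim g z + prim h z"
  by (simp add: prim_def integral_add)

lemma prim_bounded_linear:
  "(\<And>a b. g integrable_on {a..b}) \<Longrightarrow> bounded_linear h \<Longrightarrow> prim (\<lambda>s. h (g s)) z = h (prim g z)"
  using integral_linear[of g _ h]
  by (simp add: prim_def bounded_linear.linear linear_diff o_def)

lemma prim_const: "prim (\<lambda>s. 0) z = 0"
  by (simp add: prim_def)

text \<open>\<open>S\<close> holds the discontinuities of the coefficients. The state space is
  abstract so that matrix and vector solutions share one theory, and continuity of \<open>L\<close>
  is phrased through \<open>L s (X s)\<close>, the form in which it meets the integrals, without a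
  norm on operators.\<close>

locale linear_ode =
  fixes L :: "real \<Rightarrow> 'b::euclidean_space \<Rightarrow> 'b" and S :: "real set" and K :: real
  assumes lin: "linear (L s)"
    and bnd: "norm (L s x) \<le> K * norm x"
    and K_nonneg: "0 \<le> K"
    and fin: "finite (S \<inter> {a..b})"
    and cont: "z \<notin> S \<Longrightarrow> isCont X z \<Longrightarrow> isCont (\<lambda>s. L s (X s)) z"
begin

lemma integrable:
  assumes "\<And>z. isCont X z"
  shows "(\<lambda>s. L s (X s)) integrable_on {a..b}"
proof -
  have "compact (X ` {a..b})"
    using assms by (intro compact_continuous_image continuous_at_imp_continuous_on) auto
  then obtain c where c: "\<And>s. s \<in> {a..b} \<Longrightarrow> norm (X s) \<le> c"
    using compact_imp_bounded bounded_iff by (metis imageI)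
  show ?thesis
  proof (rule integrable_on_finite_discontinuities[OF fin])
    show "norm (L s (X s)) \<le> K * c" if "s \<in> {a..b}" for s
      using bnd[of s "X s"] mult_left_mono[OF c[OF that] K_nonneg] by linarith
  qed (use cont assms in auto)
qed

primrec picard :: "'b \<Rightarrow> nat \<Rightarrow> real \<Rightarrow> 'b" where
  "picard x 0 = (\<lambda>_. x)"
| "picard x (Suc n) = prim (\<lambda>s. L s (picard x n s))"

lemma isCont_picard: "isCont (picard x n) z"
proof (induction n arbitrary: z)
  case (Suc n)
  show ?case unfolding picard.simps by (rule isCont_prim[OF integrable[OF Suc]])
qed simp

text \<open>Serves the Picard iterates and, for uniqueness, an arbitrary solution starting at 0. The
  bound is assumed only up to radius \<open>R\<close>, because a solution is a priori bounded only
  on compact intervals.\<close>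

lemma iterate_bound:
  assumes "\<And>s. \<bar>s\<bar> \<le> R \<Longrightarrow> norm (X s) \<le> c * (K * \<bar>s\<bar>) ^ n / fact n"
    and "\<And>z. isCont X z" and "\<bar>z\<bar> \<le> R"
  shows "norm (prim (\<lambda>s. L s (X s)) z) \<le> c * (K * \<bar>z\<bar>) ^ Suc n / fact (Suc n)"
proof -
  have "norm (prim (\<lambda>s. L s (X s)) z) \<le> (c * K ^ Suc n / fact n) * \<bar>z\<bar> ^ Suc n / real (Suc n)"
  proof (rule norm_prim_le)
    fix s assume "\<bar>s\<bar> \<le> \<bar>z\<bar>"
    then have "norm (X s) \<le> c * (K * \<bar>s\<bar>) ^ n / fact n"
      using assms by auto
    then have "norm (L s (X s)) \<le> K * (c * (K * \<bar>s\<bar>) ^ n / fact n)"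
      using bnd[of s "X s"] K_nonneg by (meson mult_left_mono order_trans)
    then show "norm (L s (X s)) \<le> c * K ^ Suc n / fact n * \<bar>s\<bar> ^ n"
      by (simp add: power_mult_distrib mult_ac)
  qed (use integrable assms(2) in auto)
  then show ?thesis
    by (simp add: power_mult_distrib field_simps)
qed

lemma norm_picard_le: "norm (picard x n z) \<le> norm x * (K * \<bar>z\<bar>) ^ n / fact n"
proof (induction n arbitrary: z)
  case (Suc n)
  show ?case
    unfolding picard.simps
    by (rule iterate_bound[of "\<bar>z\<bar>"]) (use Suc isCont_picard in auto)
qed simp

text \<open>A solution that starts at 0 is a fixed point of the Picard map, so a bound
  \<open>c\<close> on a compact interval improves to
  \<open>c * (K * \<bar>z\<bar>) ^ n / fact n\<close> for every \<open>n\<close>, which tends to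
  0.\<close>

lemma solution_unique_0:
  assumes X: "continuous_on UNIV X" "X 0 = 0"
    and deriv: "\<And>z. z \<notin> S \<Longrightarrow> (X has_vector_derivative L z (X z)) (at z)"
  shows "X z = 0"
proof -
  have cX: "isCont X s" for s using X(1) continuous_on_eq_continuous_at by blast
  have eq: "X s = prim (\<lambda>s. L s (X s)) s" for s
    using eq_prim[OF fin X(1) integrable[OF cX] deriv, of s] X(2) by simp
  have "compact (X ` {-\<bar>z\<bar>..\<bar>z\<bar>})"
    using X(1) by (intro compact_continuous_image) (auto intro: continuous_on_subset)
  then obtain c where c: "\<And>s. s \<in> {-\<bar>z\<bar>..\<bar>z\<bar>} \<Longrightarrow> norm (X s) \<le> c"
    using compact_imp_bounded bounded_iff by (metis imageI)
  have bound: "norm (X s) \<le> c * (K * \<bar>s\<bar>) ^ n / fact n" if "\<bar>s\<bar> \<le> \<bar>z\<bar>" for s n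
    using that
  proof (induction n arbitrary: s)
    case 0
    then have "s \<in> {-\<bar>z\<bar>..\<bar>z\<bar>}" by auto
    then show ?case using c by simp
  next
    case (Suc n)
    show ?case
      unfolding eq[of s] by (rule iterate_bound[OF Suc.IH cX Suc.prems])
  qed
  have "(\<lambda>n. inverse (fact n) * (K * \<bar>z\<bar>) ^ n) \<longlonglongrightarrow> 0"
    using summable_exp[of "K * \<bar>z\<bar>"] summable_LIMSEQ_zero by blast
  then have "(\<lambda>n. c * (inverse (fact n) * (K * \<bar>z\<bar>) ^ n)) \<longlonglongrightarrow> c * 0"
    by (intro tendsto_mult tendsto_const)
  then have "(\<lambda>n. c * (K * \<bar>z\<bar>) ^ n / fact n) \<longlonglongrightarrow> 0"
    by (simp add: field_simps)
  then have "norm (X z) \<le> 0"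
    by (rule LIMSEQ_le_const) (intro exI[of _ 0] allI impI bound order.refl)
  then show ?thesis by simp
qed

lemma solution_unique:
  assumes X: "continuous_on UNIV X" "\<And>z. z \<notin> S \<Longrightarrow> (X has_vector_derivative L z (X z)) (at z)"
    and Y: "continuous_on UNIV Y" "\<And>z. z \<notin> S \<Longrightarrow> (Y has_vector_derivative L z (Y z)) (at z)"
    and "X 0 = Y 0"
  shows "X z = Y z"
proof -
  have "X z - Y z = 0"
  proof (rule solution_unique_0[of "\<lambda>z. X z - Y z"])
    show "((\<lambda>z. X z - Y z) has_vector_derivative L z (X z - Y z)) (at z)" if "z \<notin> S" for z
      using has_vector_derivative_diff[OF X(2)[OF that] Y(2)[OF that]]
      by (simp add: linear_diff[OF lin])
  qed (simp_all add: continuous_on_diff[OF X(1) Y(1)] \<open>X 0 = Y 0\<close>)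
  then show ?thesis by simp
qed

definition solution :: "'b \<Rightarrow> real \<Rightarrow> 'b" where
  "solution x z = (\<Sum>n. picard x n z)"

lemma picard_sums: "(\<lambda>n. picard x n z) sums solution x z"
proof -
  have "summable (\<lambda>n. norm x * (inverse (fact n) * (K * \<bar>z\<bar>) ^ n))"
    by (rule summable_mult[OF summable_exp])
  then have "summable (\<lambda>n. picard x n z)"
    by (rule summable_comparison_test') (use norm_picard_le[of x _ z] in \<open>simp add: divide_inverse mult_ac\<close>)
  then show ?thesis unfolding solution_def by (rule summable_sums)
qed

lemma picard_uniform_limit:
  "uniform_limit {-R..R} (\<lambda>n z. \<Sum>i<n. picard x i z) (solution x) sequentially"
  unfolding solution_def
proof (rule Weierstrass_m_test)
  show "summable (\<lambda>n. norm x * (inverse (fact n) * (K * R) ^ n))"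
    by (rule summable_mult[OF summable_exp])
  show "norm (picard x n z) \<le> norm x * (inverse (fact n) * (K * R) ^ n)" if "z \<in> {-R..R}" for n z
  proof -
    have "norm x * (K * \<bar>z\<bar>) ^ n / fact n \<le> norm x * (K * R) ^ n / fact n"
      using that K_nonneg by (intro divide_right_mono mult_left_mono power_mono mult_nonneg_nonneg) auto
    then show ?thesis using norm_picard_le[of x n z] by (simp add: divide_inverse mult_ac)
  qed
qed

lemma isCont_solution: "isCont (solution x) z"
proof -
  have "continuous_on {-(\<bar>z\<bar>+1)..\<bar>z\<bar>+1} (solution x)"
    by (rule uniform_limit_theorem[OF _ picard_uniform_limit])
      (auto intro!: always_eventually continuous_at_imp_continuous_on continuous_intros isCont_picard)
  then show ?thesis
    by (rule continuous_on_interior) auto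
qed

text \<open>The partial sums satisfy the integral equation with an index shift, and uniform
  convergence on a symmetric interval lets the limit pass under the integral.\<close>

lemma solution_eq: "solution x z = x + prim (\<lambda>s. L s (solution x s)) z"
proof -
  let ?P = "\<lambda>n z. \<Sum>i<n. picard x i z"
  have cP: "isCont (?P n) s" for n s by (intro continuous_intros isCont_picard)
  have cD: "isCont (\<lambda>s. ?P n s - solution x s) s" for n s
    by (intro continuous_diff cP isCont_solution)
  have P: "?P (Suc n) z = x + prim (\<lambda>s. L s (?P n s)) z" for n
  proof (induction n)
    case 0
    show ?case by (simp add: linear_0[OF lin] prim_const)
  next
    case (Suc n)
    have "(\<Sum>i<Suc (Suc n). picard x i z) = x + prim (\<lambda>s. L s (?P n s)) z + prim (\<lambda>s. L s (picard x n s)) z"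
      using Suc by simp
    also have "\<dots> = x + prim (\<lambda>s. L s (?P n s) + L s (picard x n s)) z"
      using prim_add[OF integrable[OF cP] integrable[OF isCont_picard], of n x n z] by simp
    also have "\<dots> = x + prim (\<lambda>s. L s (?P (Suc n) s)) z"
      by (simp add: linear_add[OF lin])
    finally show ?case .
  qed
  have "(\<lambda>n. prim (\<lambda>s. L s (?P n s)) z) \<longlonglongrightarrow> prim (\<lambda>s. L s (solution x s)) z"
  proof (rule tendstoI)
    fix e :: real assume "e > 0"
    \<comment> \<open>The summand 1 keeps the denominator positive when \<open>K\<close> or
      \<open>z\<close> is 0.\<close>
    define e' where "e' = e / (K * \<bar>z\<bar> + 1)"
    have pos: "K * \<bar>z\<bar> + 1 > 0" using K_nonneg by (smt (verit) mult_nonneg_nonneg abs_ge_zero)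
    then have "e' > 0" using \<open>e > 0\<close> by (simp add: e'_def)
    then have "\<forall>\<^sub>F n in sequentially. \<forall>s\<in>{-\<bar>z\<bar>..\<bar>z\<bar>}. dist (?P n s) (solution x s) < e'"
      using picard_uniform_limit by (auto simp: uniform_limit_iff)
    then show "\<forall>\<^sub>F n in sequentially. dist (prim (\<lambda>s. L s (?P n s)) z) (prim (\<lambda>s. L s (solution x s)) z) < e"
    proof eventually_elim
      case (elim n)
      have "prim (\<lambda>s. L s (?P n s)) z = prim (\<lambda>s. L s (solution x s) + L s (?P n s - solution x s)) z"
        by (simp add: linear_diff[OF lin])
      also have "\<dots> = prim (\<lambda>s. L s (solution x s)) z + prim (\<lambda>s. L s (?P n s - solution x s)) z"
        by (rule prim_add[OF integrable[OF isCont_solution] integrable[OF cD]])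
      finally have "dist (prim (\<lambda>s. L s (?P n s)) z) (prim (\<lambda>s. L s (solution x s)) z) = norm (prim (\<lambda>s. L s (?P n s - solution x s)) z)"
        by (simp add: dist_norm)
      also have "\<dots> \<le> (K * e') * \<bar>z\<bar> ^ Suc 0 / real (Suc 0)"
      proof (rule norm_prim_le)
        fix s assume "\<bar>s\<bar> \<le> \<bar>z\<bar>"
        then have "s \<in> {-\<bar>z\<bar>..\<bar>z\<bar>}" by auto
        with elim have "norm (?P n s - solution x s) \<le> e'"
          by (meson dist_norm less_imp_le order.trans[OF eq_refl[OF dist_norm[symmetric]]])
        then show "norm (L s (?P n s - solution x s)) \<le> K * e' * \<bar>s\<bar> ^ 0"
          using bnd[of s "?P n s - solution x s"] K_nonneg by (simp add: order_trans mult_left_mono)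
      qed (rule integrable[OF cD])
      also have "\<dots> < e' * (K * \<bar>z\<bar> + 1)" using \<open>e' > 0\<close> by (simp add: algebra_simps)
      also have "\<dots> = e" using pos by (simp add: e'_def)
      finally show ?case .
    qed
  qed
  then have "(\<lambda>n. ?P (Suc n) z) \<longlonglongrightarrow> x + prim (\<lambda>s. L s (solution x s)) z"
    unfolding P by (intro tendsto_intros)
  moreover have "(\<lambda>n. ?P (Suc n) z) \<longlonglongrightarrow> solution x z"
    using picard_sums[of x z] unfolding sums_def by (rule LIMSEQ_Suc)
  ultimately show ?thesis using LIMSEQ_unique by blast
qed

lemma solution_0: "solution x 0 = x"
  by (subst solution_eq) simp

lemma solution_has_vector_derivative:
  assumes "z \<notin> S"
  shows "(solution x has_vector_derivative L z (solution x z)) (at z)"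
proof -
  have "(prim (\<lambda>s. L s (solution x s)) has_vector_derivative L z (solution x z)) (at z)"
    by (rule prim_has_vector_derivative[OF integrable[OF isCont_solution] cont[OF assms isCont_solution]])
  then have "((\<lambda>z. x + prim (\<lambda>s. L s (solution x s)) z) has_vector_derivative L z (solution x z)) (at z)"
    by (auto intro!: derivative_eq_intros)
  then show ?thesis
    by (simp only: solution_eq[of x, symmetric])
qed

end

section \<open>Transfer and monodromy matrices\<close>

lemma bounded_bilinear_matrix_mult:
  "bounded_bilinear ((**) :: complex^'n^'m \<Rightarrow> complex^'p^'n \<Rightarrow> complex^'p^'m)"
proof -
  have "bilinear ((**) :: complex^'n^'m \<Rightarrow> complex^'p^'n \<Rightarrow> complex^'p^'m)"
    unfolding bilinear_def
    by (intro conjI allI linearI)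
      (simp_all add: matrix_matrix_mult_def vec_eq_iff sum.distrib distrib_left distrib_right scaleR_sum_right)
  then show ?thesis by (simp add: bilinear_conv_bounded_bilinear)
qed

lemma bounded_bilinear_matrix_vector_mult:
  "bounded_bilinear ((*v) :: complex^'n^'m \<Rightarrow> complex^'n \<Rightarrow> complex^'m)"
proof -
  have "bilinear ((*v) :: complex^'n^'m \<Rightarrow> complex^'n \<Rightarrow> complex^'m)"
    unfolding bilinear_def
    by (intro conjI allI linearI)
      (simp_all add: matrix_vector_mult_def vec_eq_iff sum.distrib distrib_left distrib_right scaleR_sum_right)
  then show ?thesis by (simp add: bilinear_conv_bounded_bilinear)
qed

lemma mat_mult_left_nth [simp]: "(mat c ** A) $ i $ j = c * A $ i $ j" for A :: "'a::semiring_1^'p^'n"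
  by (simp add: matrix_matrix_mult_def mat_def if_distrib[of "\<lambda>x. x * _"] cong: if_cong)

lemma mat_mult_right_nth [simp]: "(A ** mat c) $ i $ j = A $ i $ j * c" for A :: "'a::semiring_1^'n^'p"
  by (simp add: matrix_matrix_mult_def mat_def if_distrib[of "\<lambda>x. _ * x"] cong: if_cong)

lemma mat_mult_commute: "A ** mat c = mat c ** A" for A :: "'a::comm_semiring_1^'n^'n"
  by (simp add: vec_eq_iff mult.commute)

lemma mat_mult_mat: "mat c ** mat d = (mat (c * d) :: 'a::comm_semiring_1^'n^'n)"
  unfolding vec_eq_iff mat_mult_left_nth by (simp add: mat_def)

section \<open>The equation of the crystal as an instance of the linear theory\<close>

definition singular_points :: "(real \<Rightarrow> complex^2^2) \<Rightarrow> (real \<Rightarrow> complex^2^2) \<Rightarrow> real set" where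
  "singular_points eps mu = {z. \<not> (isCont eps z \<and> isCont mu z)}"

lemma finite_singular_points:
  assumes "photonic_crystal eps mu"
  shows "finite (singular_points eps mu \<inter> {a..b})"
proof -
  have "singular_points eps mu \<inter> {a..b} = {z \<in> {a..b}. \<not> isCont eps z} \<union> {z \<in> {a..b}. \<not> isCont mu z}"
    by (auto simp: singular_points_def)
  then show ?thesis
    using assms by (simp add: photonic_crystal_def piecewise_continuous_def)
qed

lemma linear_block: "linear (\<lambda>(e, m). block_matrix 0 m (- e) (0::complex^2^2))"
  by (rule linearI) (auto simp: block_matrix_def vec_eq_iff split: sum.splits)

text \<open>The system matrix is a fixed bounded linear image \<open>?h\<close> of the pair
  \<open>(eps s, mu s)\<close>, so it inherits boundedness and points of continuity from the
  coefficients. The product \<open>prd\<close> is a parameter so that the matrix and the vector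
  equation are covered at once.\<close>

lemma linear_ode_system:
  fixes prd :: "complex^(2+2)^(2+2) \<Rightarrow> 'b::euclidean_space \<Rightarrow> 'b"
  assumes crystal: "photonic_crystal eps mu" and bb: "bounded_bilinear prd"
  shows "\<exists>K. linear_ode (\<lambda>s. prd (system_matrix eps mu w s)) (singular_points eps mu) K"
proof -
  interpret P: bounded_bilinear prd by (rule bb)
  have "bounded_linear (\<lambda>p. mat w ** (matrix_inv Q4 ** (mat \<i> ** (\<lambda>(e, m). block_matrix 0 m (- e) (0::complex^2^2)) p)))"
    by (intro bounded_linear_intros bounded_bilinear.bounded_linear_right[OF bounded_bilinear_matrix_mult, THEN bounded_linear_compose]
        linear_conv_bounded_linear[THEN iffD1] linear_block)
  moreover have "(\<lambda>p. mat w ** (matrix_inv Q4 ** (mat \<i> ** (\<lambda>(e, m). block_matrix 0 m (- e) (0::complex^2^2)) p))) =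
     (\<lambda>p. mat w ** (matrix_inv Q4 ** (mat \<i> ** block_matrix 0 (snd p) (- fst p) (0::complex^2^2))))" (is "_ = ?h")
    by (simp add: case_prod_beta)
  ultimately interpret h: bounded_linear ?h by simp
  have sys: "system_matrix eps mu w s = ?h (eps s, mu s)" for s
    by (simp add: system_matrix_def medium_matrix_def)
  obtain a b where "\<And>s. norm (eps s) \<le> a" "\<And>s. norm (mu s) \<le> b"
    using crystal unfolding photonic_crystal_def bounded_iff by (metis insertCI rangeI)
  then have ab: "norm (eps s, mu s) \<le> a + b" for s
    by (smt (verit) norm_Pair_le)
  obtain k where k: "\<And>x. norm (?h x) \<le> norm x * k" "0 < k" using h.pos_bounded by blast
  obtain l where l: "\<And>x y. norm (prd x y) \<le> norm x * norm y * l" "0 < l" using P.pos_bounded by blast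
  have ab0: "0 \<le> a + b" using ab[of 0] norm_ge_zero order_trans by blast
  have sysb: "norm (system_matrix eps mu w s) \<le> (a + b) * k" for s
    unfolding sys using k(1)[of "(eps s, mu s)"] mult_right_mono[OF ab[of s], of k] k(2) by linarith
  have "linear_ode (\<lambda>s. prd (system_matrix eps mu w s)) (singular_points eps mu) ((a + b) * k * l)"
  proof (rule linear_ode.intro)
    show "norm (prd (system_matrix eps mu w s) x) \<le> (a + b) * k * l * norm x" for s x
    proof -
      have "norm (prd (system_matrix eps mu w s) x) \<le> norm (system_matrix eps mu w s) * norm x * l"
        by (rule l)
      also have "\<dots> \<le> (a + b) * k * norm x * l"
        using sysb l(2) by (intro mult_right_mono) auto
      finally show ?thesis by (simp add: mult_ac)
    qed
    show "linear (prd (system_matrix eps mu w s))" for s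
      by (rule bounded_linear.linear[OF P.bounded_linear_right])
    show "0 \<le> (a + b) * k * l" using ab0 k(2) l(2) by simp
    show "finite (singular_points eps mu \<inter> {c..d})" for c d
      by (rule finite_singular_points[OF crystal])
    show "isCont (\<lambda>s. prd (system_matrix eps mu w s) (X s)) z"
      if "z \<notin> singular_points eps mu" "isCont X z" for X z
    proof (rule P.isCont)
      have "isCont (\<lambda>s. (eps s, mu s)) z"
        using that(1) by (intro continuous_intros) (auto simp: singular_points_def)
      then show "isCont (system_matrix eps mu w) z"
        unfolding sys[abs_def] by (rule h.isCont)
    qed (rule that(2))
  qed
  then show ?thesis by blast
qed

text \<open>The explicit Picard series is chosen instead of a description by uniqueness, since the
  dependence on \<open>w\<close> can be read off term by term.\<close>

definition transfer :: "(real \<Rightarrow> complex^2^2) \<Rightarrow> (real \<Rightarrow> complex^2^2) \<Rightarrow> complex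
    \<Rightarrow> real \<Rightarrow> complex^(2+2)^(2+2)" where
  "transfer eps mu w = linear_ode.solution (\<lambda>s. (**) (system_matrix eps mu w s)) (mat 1)"

context
  fixes eps mu assumes crystal: "photonic_crystal eps mu"
begin

lemma transfer_matrix_transfer: "transfer_matrix eps mu w (transfer eps mu w)"
proof -
  obtain K where "linear_ode (\<lambda>s. (**) (system_matrix eps mu w s) :: _ \<Rightarrow> complex^(2+2)^(2+2)) (singular_points eps mu) K"
    using linear_ode_system[OF crystal bounded_bilinear_matrix_mult] by blast
  then interpret linear_ode "\<lambda>s. (**) (system_matrix eps mu w s) :: _ \<Rightarrow> complex^(2+2)^(2+2)" "singular_points eps mu" K .
  show ?thesis
    unfolding transfer_matrix_def transfer_def
    using isCont_solution solution_0 solution_has_vector_derivative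
    by (auto simp: singular_points_def intro: continuous_at_imp_continuous_on)
qed

lemma continuous_on_transfer: "continuous_on UNIV (transfer eps mu w)"
  and transfer_0: "transfer eps mu w 0 = mat 1"
  and transfer_has_vector_derivative: "isCont eps z \<Longrightarrow> isCont mu z \<Longrightarrow>
    (transfer eps mu w has_vector_derivative (system_matrix eps mu w z ** transfer eps mu w z)) (at z)"
  using transfer_matrix_transfer[of w] unfolding transfer_matrix_def by simp_all

lemma transfer_unique:
  fixes X :: "real \<Rightarrow> complex^(2+2)^(2+2)"
  assumes X: "continuous_on UNIV X"
    "\<And>z. isCont eps z \<Longrightarrow> isCont mu z \<Longrightarrow> (X has_vector_derivative (system_matrix eps mu w z ** X z)) (at z)"
  shows "X z = transfer eps mu w z ** X 0"
proof -
  obtain K where "linear_ode (\<lambda>s. (**) (system_matrix eps mu w s) :: _ \<Rightarrow> complex^(2+2)^(2+2)) (singular_points eps mu) K"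
    using linear_ode_system[OF crystal bounded_bilinear_matrix_mult] by blast
  then interpret linear_ode "\<lambda>s. (**) (system_matrix eps mu w s) :: _ \<Rightarrow> complex^(2+2)^(2+2)" "singular_points eps mu" K .
  interpret M: bounded_bilinear "(**) :: complex^(2+2)^(2+2) \<Rightarrow> complex^(2+2)^(2+2) \<Rightarrow> complex^(2+2)^(2+2)"
    by (rule bounded_bilinear_matrix_mult)
  show ?thesis
  proof (rule solution_unique[of X "\<lambda>z. transfer eps mu w z ** X 0"])
    show "continuous_on UNIV (\<lambda>z. transfer eps mu w z ** X 0)"
      by (rule M.continuous_on[OF _ continuous_on_const]) (rule continuous_on_transfer)
    show "((\<lambda>z. transfer eps mu w z ** X 0) has_vector_derivative system_matrix eps mu w z ** (transfer eps mu w z ** X 0)) (at z)"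
      if "z \<notin> singular_points eps mu" for z
      using bounded_linear.has_vector_derivative[OF M.bounded_linear_left, of "transfer eps mu w" _ _ "X 0", OF transfer_has_vector_derivative] that
      by (simp add: matrix_mul_assoc singular_points_def)
    show "X 0 = transfer eps mu w 0 ** X 0" by (simp add: transfer_0)
  qed (use X in \<open>simp_all add: singular_points_def\<close>)
qed

lemma transfer_unique_vec:
  fixes X :: "real \<Rightarrow> complex^(2+2)"
  assumes X: "continuous_on UNIV X"
    "\<And>z. isCont eps z \<Longrightarrow> isCont mu z \<Longrightarrow> (X has_vector_derivative (system_matrix eps mu w z *v X z)) (at z)"
  shows "X z = transfer eps mu w z *v X 0"
proof -
  obtain K where "linear_ode (\<lambda>s. (*v) (system_matrix eps mu w s) :: _ \<Rightarrow> complex^(2+2)) (singular_points eps mu) K"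
    using linear_ode_system[OF crystal bounded_bilinear_matrix_vector_mult] by blast
  then interpret linear_ode "\<lambda>s. (*v) (system_matrix eps mu w s) :: _ \<Rightarrow> complex^(2+2)" "singular_points eps mu" K .
  interpret M: bounded_bilinear "(*v) :: complex^(2+2)^(2+2) \<Rightarrow> complex^(2+2) \<Rightarrow> complex^(2+2)"
    by (rule bounded_bilinear_matrix_vector_mult)
  show ?thesis
  proof (rule solution_unique[of X "\<lambda>z. transfer eps mu w z *v X 0"])
    show "continuous_on UNIV (\<lambda>z. transfer eps mu w z *v X 0)"
      by (rule M.continuous_on[OF _ continuous_on_const]) (rule continuous_on_transfer)
    show "((\<lambda>z. transfer eps mu w z *v X 0) has_vector_derivative system_matrix eps mu w z *v (transfer eps mu w z *v X 0)) (at z)"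
      if "z \<notin> singular_points eps mu" for z
      using bounded_linear.has_vector_derivative[OF M.bounded_linear_left, of "transfer eps mu w" _ _ "X 0", OF transfer_has_vector_derivative] that
      by (simp add: matrix_vector_mul_assoc singular_points_def)
    show "X 0 = transfer eps mu w 0 *v X 0" by (simp add: transfer_0)
  qed (use X in \<open>simp_all add: singular_points_def\<close>)
qed

lemma monodromy_eq: "monodromy eps mu w = transfer eps mu w 1"
proof -
  have "(THE T. transfer_matrix eps mu w T) = transfer eps mu w"
  proof (rule the_equality)
    fix T assume "transfer_matrix eps mu w T"
    then show "T = transfer eps mu w"
      using transfer_unique[of T w] by (intro ext) (simp add: transfer_matrix_def)
  qed (rule transfer_matrix_transfer)
  then show ?thesis by (simp add: monodromy_def)
qed

lemma system_matrix_periodic: "system_matrix eps mu w (z + 1) = system_matrix eps mu w z"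
  using crystal by (simp add: photonic_crystal_def system_matrix_def medium_matrix_def)

lemma isCont_periodic:
  assumes "f \<in> {eps, mu}" "isCont f z"
  shows "isCont f (z + 1)"
proof -
  have "f (x - 1 + 1) = f (x - 1)" for x
    using assms(1) crystal unfolding photonic_crystal_def by blast
  then have f: "(\<lambda>x. f (x - 1)) = f" by (simp add: fun_eq_iff)
  have "isCont (\<lambda>x. f (x - 1)) (z + 1)"
    by (rule isCont_o2[of _ "\<lambda>x. x - 1" f]) (use assms(2) in simp_all)
  then show ?thesis unfolding f .
qed

text \<open>By periodicity the shifted transfer matrix solves the same equation, now starting at the
  monodromy matrix.\<close>

lemma transfer_add_1: "transfer eps mu w (z + 1) = transfer eps mu w z ** monodromy eps mu w"
proof -
  have "transfer eps mu w (z + 1) = transfer eps mu w z ** transfer eps mu w (0 + 1)"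
  proof (rule transfer_unique[of "\<lambda>z. transfer eps mu w (z + 1)"])
    show "continuous_on UNIV (\<lambda>z. transfer eps mu w (z + 1))"
      by (rule continuous_on_compose2[OF continuous_on_transfer]) (intro continuous_intros, simp)
    fix z assume "isCont eps z" "isCont mu z"
    then have "(transfer eps mu w has_vector_derivative (system_matrix eps mu w (z + 1) ** transfer eps mu w (z + 1))) (at (z + 1))"
      using isCont_periodic[of eps] isCont_periodic[of mu] by (intro transfer_has_vector_derivative) simp_all
    then have "(transfer eps mu w has_vector_derivative (system_matrix eps mu w z ** transfer eps mu w (z + 1))) (at (z + 1))"
      by (simp only: system_matrix_periodic)
    moreover have "((\<lambda>z. z + 1) has_vector_derivative (1::real)) (at z)"
      by (auto intro!: derivative_eq_intros)
    ultimately show "((\<lambda>z. transfer eps mu w (z + 1)) has_vector_derivative system_matrix eps mu w z ** transfer eps mu w (z + 1)) (at z)"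
      using vector_diff_chain_at[of "\<lambda>z. z + 1" 1 z "transfer eps mu w"] by (simp add: o_def)
  qed
  then show ?thesis by (simp add: monodromy_eq)
qed

text \<open>A Bloch solution is fixed by its value at 0, and at \<open>z = 0\<close>
  quasi-periodicity is the eigenvector equation. Conversely \<open>transfer_add_1\<close> carries
  that equation to every \<open>z\<close>.\<close>

lemma eigenfrequencies_iff_eigenvector:
  "w \<in> eigenfrequencies eps mu k \<longleftrightarrow> (\<exists>v. v \<noteq> 0 \<and> monodromy eps mu w *v v = cis k *s v)"
proof
  interpret M: bounded_bilinear "(*v) :: complex^(2+2)^(2+2) \<Rightarrow> complex^(2+2) \<Rightarrow> complex^(2+2)"
    by (rule bounded_bilinear_matrix_vector_mult)
  {
    assume "w \<in> eigenfrequencies eps mu k"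
    then obtain \<Phi> z where \<Phi>: "bloch_solution eps mu (cis k) w \<Phi>" "\<Phi> z \<noteq> 0"
      by (auto simp: eigenfrequencies_def)
    have eq: "\<Phi> z = transfer eps mu w z *v \<Phi> 0" for z
      using \<Phi>(1) by (intro transfer_unique_vec[of \<Phi>]) (simp_all add: bloch_solution_def)
    have "\<Phi> 0 \<noteq> 0" using eq[of z] \<Phi>(2) by auto
    moreover have "monodromy eps mu w *v \<Phi> 0 = cis k *s \<Phi> 0"
      using eq[of 1] \<Phi>(1) unfolding bloch_solution_def monodromy_eq by (metis add_0)
    ultimately show "\<exists>v. v \<noteq> 0 \<and> monodromy eps mu w *v v = cis k *s v" by blast
  next
    assume "\<exists>v. v \<noteq> 0 \<and> monodromy eps mu w *v v = cis k *s v"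
    then obtain v where v: "v \<noteq> 0" "monodromy eps mu w *v v = cis k *s v" by blast
    have "bloch_solution eps mu (cis k) w (\<lambda>z. transfer eps mu w z *v v)"
      unfolding bloch_solution_def
    proof (intro conjI allI impI)
      show "continuous_on UNIV (\<lambda>z. transfer eps mu w z *v v)"
        by (rule M.continuous_on[OF _ continuous_on_const]) (rule continuous_on_transfer)
      show "((\<lambda>z. transfer eps mu w z *v v) has_vector_derivative system_matrix eps mu w z *v (transfer eps mu w z *v v)) (at z)"
        if "isCont eps z \<and> isCont mu z" for z
        using bounded_linear.has_vector_derivative[OF M.bounded_linear_left, of "transfer eps mu w" _ _ v, OF transfer_has_vector_derivative] that
        by (simp add: matrix_vector_mul_assoc)
      show "transfer eps mu w (z + 1) *v v = cis k *s (transfer eps mu w z *v v)" for z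
        by (simp add: transfer_add_1 v(2) matrix_vector_mul_assoc[symmetric] vector_scalar_commute)
    qed
    moreover have "transfer eps mu w 0 *v v \<noteq> 0" by (simp add: transfer_0 v)
    ultimately show "w \<in> eigenfrequencies eps mu k" by (auto simp: eigenfrequencies_def)
  }
qed

lemma monodromy_entry_holomorphic: "(\<lambda>w. monodromy eps mu w $ i $ j) holomorphic_on UNIV"
proof -
  interpret M: bounded_bilinear "(**) :: complex^(2+2)^(2+2) \<Rightarrow> complex^(2+2)^(2+2) \<Rightarrow> complex^(2+2)^(2+2)"
    by (rule bounded_bilinear_matrix_mult)
  let ?L = "\<lambda>w s. (**) (system_matrix eps mu w s) :: _ \<Rightarrow> complex^(2+2)^(2+2)"
  let ?P = "\<lambda>w. linear_ode.picard (?L w) (mat 1)"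
  have ode: "\<exists>K. linear_ode (?L w) (singular_points eps mu) K" for w
    using linear_ode_system[OF crystal bounded_bilinear_matrix_mult] .
  obtain K1 where 1: "linear_ode (?L 1) (singular_points eps mu) K1" using ode by blast
  have sys: "system_matrix eps mu w s = mat w ** system_matrix eps mu 1 s" for w s
    by (simp add: system_matrix_def)
  \<comment> \<open>The Picard iterates are homogeneous in \<open>w\<close>, so the Picard series is a power series in \<open>w\<close>.\<close>
  have scale: "?P w n z = mat (w ^ n) ** ?P 1 n z" for w n z
  proof (induction n arbitrary: z)
    obtain K where w: "linear_ode (?L w) (singular_points eps mu) K" using ode by blast
    {
      case 0
      show ?case by (simp add: linear_ode.picard.simps[OF w] linear_ode.picard.simps[OF 1])
    next
      case (Suc n)
      have "?P w (Suc n) z = prim (\<lambda>s. mat (w ^ Suc n) ** (system_matrix eps mu 1 s ** ?P 1 n s)) z"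
      proof -
        have "system_matrix eps mu w s ** ?P w n s = mat (w ^ Suc n) ** (system_matrix eps mu 1 s ** ?P 1 n s)" for s
        proof -
          have "system_matrix eps mu w s ** ?P w n s = system_matrix eps mu w s ** (mat (w ^ n) ** ?P 1 n s)"
            by (simp only: Suc)
          also have "\<dots> = mat w ** (system_matrix eps mu 1 s ** mat (w ^ n)) ** ?P 1 n s"
            by (simp only: sys[of w] matrix_mul_assoc)
          also have "\<dots> = (mat w ** mat (w ^ n)) ** (system_matrix eps mu 1 s ** ?P 1 n s)"
            by (simp add: mat_mult_commute[of "system_matrix eps mu 1 s"] matrix_mul_assoc)
          finally show ?thesis by (simp add: mat_mult_mat)
        qed
        then show ?thesis by (simp add: linear_ode.picard.simps[OF w])
      qed
      also have "\<dots> = mat (w ^ Suc n) ** ?P 1 (Suc n) z"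
        unfolding linear_ode.picard.simps[OF 1]
        by (rule prim_bounded_linear[OF linear_ode.integrable[OF 1 linear_ode.isCont_picard[OF 1]] M.bounded_linear_right])
      finally show ?case .
    }
  qed
  have sums: "(\<lambda>n. ?P 1 n 1 $ i $ j * w ^ n) sums (monodromy eps mu w $ i $ j)" for w
  proof -
    obtain K where w: "linear_ode (?L w) (singular_points eps mu) K" using ode by blast
    have "(\<lambda>n. ?P w n 1) sums transfer eps mu w 1"
      unfolding transfer_def by (rule linear_ode.picard_sums[OF w])
    then have "(\<lambda>n. ?P w n 1 $ i) sums (transfer eps mu w 1 $ i)"
      by (rule bounded_linear.sums[OF bounded_linear_vec_nth])
    then have "(\<lambda>n. ?P w n 1 $ i $ j) sums (transfer eps mu w 1 $ i $ j)"
      by (rule bounded_linear.sums[OF bounded_linear_vec_nth])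
    then show ?thesis by (simp only: scale[of w] mat_mult_left_nth monodromy_eq mult.commute)
  qed
  have "(\<lambda>w. monodromy eps mu w $ i $ j) holomorphic_on ball 0 r" for r
    by (rule power_series_holomorphic[of 0 r "\<lambda>n. ?P 1 n 1 $ i $ j"]) (use sums in simp)
  then have "(\<lambda>w. monodromy eps mu w $ i $ j) analytic_on {w}" for w
    unfolding analytic_at by (intro exI[of _ "ball 0 (norm w + 1)"]) auto
  then have "(\<lambda>w. monodromy eps mu w $ i $ j) analytic_on UNIV"
    by (metis analytic_on_analytic_at)
  then show ?thesis by (simp add: analytic_on_open)
qed

end

section \<open>Determinant and characteristic polynomial\<close>

lemma det_replace_row:
  fixes X :: "'a::comm_ring_1^'n^'n"
  shows "det (\<chi> r. if r = i then X $ k else X $ r) = (if k = i then det X else 0)"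
proof (cases "k = i")
  case True
  then have "(\<chi> r. if r = i then X $ k else X $ r) = X" by (simp add: vec_eq_iff)
  then show ?thesis using True by simp
next
  case False
  then show ?thesis
    by (simp add: det_identical_rows[of k i] row_def)
qed

text \<open>Liouville's formula. The Leibniz expansion is differentiated one factor at a time. The
  derivative of row \<open>i\<close> is the combination of the rows \<open>k\<close> with weights
  \<open>A $ i $ k\<close>; putting a different row in place of row \<open>i\<close> creates two
  equal rows, so only the diagonal of \<open>A\<close> survives.\<close>

lemma det_has_vector_derivative:
  fixes X :: "real \<Rightarrow> complex^'n^'n"
  assumes "(X has_vector_derivative (A ** X z)) (at z)"
  shows "((\<lambda>t. det (X t)) has_vector_derivative (trace A * det (X z))) (at z)"
proof -
  let ?D = "A ** X z"
  have entry: "((\<lambda>t. X t $ i $ j) has_vector_derivative (?D $ i $ j)) (at z)" for i j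
    by (intro bounded_linear.has_vector_derivative[OF bounded_linear_vec_nth] assms)
  have "((\<lambda>t. \<Prod>i\<in>UNIV. X t $ i $ p i) has_vector_derivative
      (\<Sum>i\<in>UNIV. ?D $ i $ p i * (\<Prod>j\<in>UNIV - {i}. X z $ j $ p j))) (at z)" for p
    using has_derivative_prod[of UNIV "\<lambda>i t. X t $ i $ p i" "\<lambda>i h. h *\<^sub>R (?D $ i $ p i)" z UNIV] entry
    by (simp add: has_vector_derivative_def scaleR_sum_right)
  then have "((\<lambda>t. det (X t)) has_vector_derivative
      (\<Sum>p | p permutes UNIV. of_int (sign p) * (\<Sum>i\<in>UNIV. ?D $ i $ p i * (\<Prod>j\<in>UNIV - {i}. X z $ j $ p j)))) (at z)"
    unfolding det_def by (intro has_vector_derivative_sum has_vector_derivative_mult_right)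
  moreover have "(\<Sum>p | p permutes UNIV. of_int (sign p) * (\<Sum>i\<in>UNIV. ?D $ i $ p i * (\<Prod>j\<in>UNIV - {i}. X z $ j $ p j)))
      = trace A * det (X z)"
  proof -
    have row: "(\<Sum>p | p permutes UNIV. of_int (sign p) * (X z $ k $ p i * (\<Prod>j\<in>UNIV - {i}. X z $ j $ p j)))
        = (if k = i then det (X z) else 0)" for i k
    proof -
      have *: "(\<Prod>r\<in>UNIV. (\<chi> r. if r = i then X z $ k else X z $ r) $ r $ p r) = X z $ k $ p i * (\<Prod>j\<in>UNIV - {i}. X z $ j $ p j)" for p
        by (subst prod.remove[of UNIV i]) (auto intro!: prod.cong)
      have "(\<Sum>p | p permutes UNIV. of_int (sign p) * (X z $ k $ p i * (\<Prod>j\<in>UNIV - {i}. X z $ j $ p j)))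
          = det (\<chi> r. if r = i then X z $ k else X z $ r)"
        unfolding det_def by (simp only: *)
      then show ?thesis by (simp only: det_replace_row)
    qed
    have "(\<Sum>p | p permutes UNIV. of_int (sign p) * (\<Sum>i\<in>UNIV. ?D $ i $ p i * (\<Prod>j\<in>UNIV - {i}. X z $ j $ p j)))
      = (\<Sum>p | p permutes UNIV. \<Sum>i\<in>UNIV. \<Sum>k\<in>UNIV. A $ i $ k * (of_int (sign p) * (X z $ k $ p i * (\<Prod>j\<in>UNIV - {i}. X z $ j $ p j))))"
      by (simp add: matrix_matrix_mult_def sum_distrib_left sum_distrib_right mult_ac)
    also have "\<dots> = (\<Sum>i\<in>UNIV. \<Sum>p | p permutes UNIV. \<Sum>k\<in>UNIV. A $ i $ k * (of_int (sign p) * (X z $ k $ p i * (\<Prod>j\<in>UNIV - {i}. X z $ j $ p j))))"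
      by (rule sum.swap)
    also have "\<dots> = (\<Sum>i\<in>UNIV. \<Sum>k\<in>UNIV. \<Sum>p | p permutes UNIV. A $ i $ k * (of_int (sign p) * (X z $ k $ p i * (\<Prod>j\<in>UNIV - {i}. X z $ j $ p j))))"
      by (intro sum.cong refl sum.swap)
    also have "\<dots> = (\<Sum>i\<in>UNIV. \<Sum>k\<in>UNIV. A $ i $ k * (if k = i then det (X z) else 0))"
      unfolding sum_distrib_left[symmetric] row ..
    also have "\<dots> = (\<Sum>i\<in>UNIV. A $ i $ i * det (X z))"
      by (simp add: if_distrib[of "\<lambda>x. _ * x"] cong: if_cong)
    also have "\<dots> = trace A * det (X z)"
      by (simp add: trace_def sum_distrib_right)
    finally show ?thesis .
  qed
  ultimately show ?thesis by simp
qed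

section \<open>Block structure of the system and unimodularity of the monodromy matrix\<close>

lemma sum_UNIV_Plus:
  "(\<Sum>x\<in>(UNIV :: ('a::finite + 'b::finite) set). f x) = (\<Sum>a\<in>UNIV. f (Inl a)) + (\<Sum>b\<in>UNIV. f (Inr b))"
  by (subst UNIV_sum, subst sum.union_disjoint) (auto simp: sum.reindex)

lemma block_matrix_mult:
  "block_matrix A B C D ** block_matrix A' B' C' D' =
    block_matrix (A ** A' + B ** C') (A ** B' + B ** D') (C ** A' + D ** C') (C ** B' + D ** D')"
  by (auto simp: vec_eq_iff matrix_matrix_mult_def block_matrix_def sum_UNIV_Plus split: sum.splits)

lemma mat_block: "mat c = block_matrix (mat c) 0 0 (mat c)"
  by (auto simp: vec_eq_iff mat_def block_matrix_def split: sum.splits)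

lemma matrix_inv_Q4: "matrix_inv Q4 = block_matrix (- Q2) 0 0 (- Q2)"
proof -
  have Q2: "Q2 ** Q2 = - mat 1"
    by (simp add: Q2_def vec_eq_iff matrix_matrix_mult_def mat_def sum_2 forall_2)
  have "Q2 ** (- Q2) = mat 1" "(- Q2) ** Q2 = mat 1"
    using Q2 by (simp_all add: vec_eq_iff matrix_matrix_mult_def sum_negf)
  then have I: "Q4 ** block_matrix (- Q2) 0 0 (- Q2) = mat 1" "block_matrix (- Q2) 0 0 (- Q2) ** Q4 = mat 1"
    by (simp_all add: Q4_def block_matrix_mult mat_block[of 1])
  \<comment> \<open>\<open>matrix_inv\<close> chooses some two-sided inverse; exhibiting one shows
    that the choice succeeds, and uniqueness of inverses identifies it.\<close>
  then have "Q4 ** matrix_inv Q4 = mat 1 \<and> matrix_inv Q4 ** Q4 = mat 1"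
    unfolding matrix_inv_def by (intro someI_ex[of "\<lambda>B. Q4 ** B = mat 1 \<and> B ** Q4 = mat 1"]) blast
  then have "matrix_inv Q4 ** Q4 ** block_matrix (- Q2) 0 0 (- Q2) = block_matrix (- Q2) 0 0 (- Q2)" by simp
  then show ?thesis by (simp only: matrix_mul_assoc[symmetric] I matrix_mul_rid)
qed

text \<open>The inverse of \<open>Q4\<close> is block diagonal and the medium matrix is block
  off-diagonal, so the product has zero diagonal blocks.\<close>

lemma trace_system_matrix: "trace (system_matrix eps mu w z) = 0"
proof -
  have "trace (block_matrix 0 B C 0) = 0" for B C :: "complex^2^2"
    by (simp add: trace_def sum_UNIV_Plus block_matrix_def)
  then show ?thesis
    unfolding system_matrix_def medium_matrix_def matrix_inv_Q4
    by (subst (1 2) mat_block) (simp add: block_matrix_mult)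
qed

text \<open>By Liouville's formula and the vanishing trace the determinant has derivative 0 off the
  singular points, and it is continuous across them.\<close>

lemma det_monodromy:
  assumes crystal: "photonic_crystal eps mu"
  shows "det (monodromy eps mu w) = 1"
proof -
  note T = transfer_has_vector_derivative[OF crystal]
  have "det (transfer eps mu w 1) = det (transfer eps mu w 0) + prim (\<lambda>s. 0) 1"
  proof (rule eq_prim)
    show "finite (singular_points eps mu \<inter> {a..b})" for a b
      by (rule finite_singular_points[OF crystal])
    show "continuous_on UNIV (\<lambda>t. det (transfer eps mu w t))"
      unfolding det_def
      by (intro continuous_intros continuous_on_transfer[OF crystal])
    show "((\<lambda>t. det (transfer eps mu w t)) has_vector_derivative 0) (at z)"
      if "z \<notin> singular_points eps mu" for z
      using det_has_vector_derivative[OF T, of z w] that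
      by (simp add: singular_points_def trace_system_matrix)
  qed (rule integrable_0)
  then show ?thesis
    by (simp add: monodromy_eq[OF crystal] transfer_0[OF crystal] prim_const)
qed

section \<open>Characteristic polynomial and the multiset of its roots\<close>

lemma poly_det: "poly (det P) x = det (\<chi> i j. poly (P $ i $ j) x)"
  by (simp add: det_def poly_sum poly_prod)

lemma poly_charpoly: "poly (charpoly A) x = det (mat x - A)"
proof -
  have "(\<chi> i j. poly ((\<chi> i j. [:- (A $ i $ j), if i = j then 1 else 0:]) $ i $ j) x) = mat x - A"
    by (simp add: vec_eq_iff mat_def)
  then show ?thesis unfolding charpoly_def poly_det by simp
qed

text \<open>In the Leibniz expansion only the identity permutation uses every diagonal entry, and
  these are the entries of degree 1. Any other permutation loses degree, so the leading term is that
  of the monic diagonal product.\<close>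

lemma
  fixes A :: "'a::idom^'n^'n"
  shows degree_charpoly: "degree (charpoly A) = CARD('n)"
    and lead_coeff_charpoly: "lead_coeff (charpoly A) = 1"
proof -
  let ?c = "\<lambda>p i. [:- (A $ i $ p i), if i = p i then 1 else 0:]"
  let ?t = "\<lambda>p. of_int (sign p) * (\<Prod>i\<in>UNIV. ?c p i)"
  define R where "R = (\<Sum>p\<in>{p. p permutes UNIV} - {id}. ?t p)"
  have eq: "charpoly A = (\<Prod>i\<in>UNIV. ?c id i) + R"
    unfolding charpoly_def det_def R_def
    by (subst sum.remove[of _ id]) (simp_all add: permutes_id sign_id)
  have "degree (?t p) < CARD('n)" if p: "p \<noteq> id" for p
  proof -
    obtain i where i: "i \<noteq> p i" using p by (fastforce simp: fun_eq_iff)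
    have "degree (\<Prod>i\<in>UNIV. ?c p i) \<le> (\<Sum>i\<in>UNIV. degree (?c p i))"
      by (rule degree_prod_sum_le[unfolded o_def]) simp
    also have "\<dots> < (\<Sum>i\<in>(UNIV::'n set). 1)"
      by (rule sum_strict_mono_ex1) (use i in \<open>auto intro!: exI[of _ i]\<close>)
    finally have "degree (\<Prod>i\<in>UNIV. ?c p i) < CARD('n)" by simp
    moreover have "degree (?t p) \<le> degree (\<Prod>i\<in>UNIV. ?c p i)"
      by (metis (no_types, lifting) add.left_neutral degree_mult_le degree_of_int)
    ultimately show ?thesis by linarith
  qed
  then have R: "degree R < CARD('n)"
    unfolding R_def by (intro degree_sum_less) auto
  have monic: "degree (\<Prod>i\<in>UNIV. ?c id i) = CARD('n)" "lead_coeff (\<Prod>i\<in>UNIV. ?c id i) = 1"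
    by (subst degree_prod_sum_eq) (auto simp: lead_coeff_prod)
  then show "degree (charpoly A) = CARD('n)"
    unfolding eq using R by (subst degree_add_eq_left) simp_all
  show "lead_coeff (charpoly A) = 1"
    unfolding eq using R monic lead_coeff_add_le[of R "\<Prod>i\<in>UNIV. ?c id i"] by (simp only: add.commute)
qed

lemma size_eigenvalues: "size (eigenvalues (A :: complex^'n^'n)) = CARD('n)"
  by (simp add: eigenvalues_def size_proots_complex degree_charpoly)

lemma charpoly_ne_0: "charpoly (A :: 'a::idom^'n^'n) \<noteq> 0"
  using lead_coeff_charpoly[of A] by auto

lemma in_eigenvalues_iff: "l \<in># eigenvalues A \<longleftrightarrow> poly (charpoly A) l = 0"
  by (simp add: eigenvalues_def set_count_proots charpoly_ne_0)

lemma poly_charpoly_eq_prod: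
  fixes A :: "complex^'n^'n"
  shows "poly (charpoly A) x = (\<Prod>l\<in>#eigenvalues A. x - l)"
proof -
  have "charpoly A = (\<Prod>l\<in>#eigenvalues A. [:- l, 1:])"
    using complex_poly_decompose_multiset[of "charpoly A"]
    by (simp add: eigenvalues_def lead_coeff_charpoly)
  then have "poly (charpoly A) x = poly (\<Prod>l\<in>#eigenvalues A. [:- l, 1:]) x" by simp
  also have "\<dots> = (\<Prod>l\<in>#eigenvalues A. x - l)"
    by (simp add: poly_prod_mset image_mset.compositionality o_def)
  finally show ?thesis .
qed

lemma det_eq_prod_eigenvalues:
  fixes A :: "complex^'n^'n"
  shows "det A = \<Prod>\<^sub># (eigenvalues A)"
proof -
  have "det (mat 0 - A) = (-1) ^ CARD('n) * det A"
    by (simp add: det_def mat_def prod_uminus sum_distrib_left mult_ac)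
  moreover have "det (mat 0 - A) = (\<Prod>l\<in>#eigenvalues A. 0 - l)"
    by (simp only: poly_charpoly[symmetric] poly_charpoly_eq_prod)
  moreover have "(\<Prod>l\<in>#E. 0 - l) = (-1) ^ size E * \<Prod>\<^sub># E" for E :: "complex multiset"
    by (induction E) simp_all
  ultimately show ?thesis by (simp add: size_eigenvalues)
qed

lemma eigenvector_iff_charpoly:
  fixes A :: "complex^'n^'n"
  shows "(\<exists>v. v \<noteq> 0 \<and> A *v v = x *s v) \<longleftrightarrow> poly (charpoly A) x = 0"
proof -
  have "(A *v v = x *s v) \<longleftrightarrow> (mat x - A) *v v = 0" for v
  proof -
    have "mat x *v v = x *s v"
      by (simp add: vec_eq_iff matrix_vector_mult_def mat_def if_distrib[of "\<lambda>x. x * _"] cong: if_cong)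
    then show ?thesis by (auto simp: matrix_vector_mult_diff_rdistrib)
  qed
  then have "(\<exists>v. v \<noteq> 0 \<and> A *v v = x *s v) \<longleftrightarrow> \<not> (\<exists>B. B ** (mat x - A) = mat 1)"
    by (auto simp: matrix_left_invertible_ker)
  also have "\<dots> \<longleftrightarrow> \<not> invertible (mat x - A)"
    by (simp add: invertible_left_inverse)
  finally show ?thesis by (simp add: invertible_det_nz poly_charpoly)
qed

lemma coeff_prod_holomorphic:
  assumes "\<And>i k. i \<in> I \<Longrightarrow> (\<lambda>w. coeff (P w i) k) holomorphic_on S"
  shows "(\<lambda>w. coeff (\<Prod>i\<in>I. P w i) k) holomorphic_on S"
  using assms
proof (induction I arbitrary: k rule: infinite_finite_induct)
  case (insert i I)
  have "(\<lambda>w. \<Sum>j\<le>k. coeff (P w i) j * coeff (\<Prod>i\<in>I. P w i) (k - j)) holomorphic_on S"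
    using insert by (intro holomorphic_intros) auto
  then show ?case using insert.hyps by (simp add: coeff_mult)
qed simp_all

lemma coeff_charpoly_holomorphic:
  fixes A :: "complex \<Rightarrow> complex^'n^'n"
  assumes "\<And>i j. (\<lambda>w. A w $ i $ j) holomorphic_on S"
  shows "(\<lambda>w. coeff (charpoly (A w)) k) holomorphic_on S"
proof -
  have c: "coeff (of_int m * q) k = of_int m * coeff q k" for m and q :: "complex poly"
    by (simp add: of_int_poly)
  have "(\<lambda>w. coeff (\<Prod>i\<in>UNIV. [:- (A w $ i $ p i), if i = p i then 1 else 0:]) k) holomorphic_on S" for p
  proof (rule coeff_prod_holomorphic)
    show "(\<lambda>w. coeff [:- (A w $ i $ p i), if i = p i then 1 else 0:] k) holomorphic_on S" for i k
      using assms by (cases k) (auto intro!: holomorphic_intros simp: coeff_pCons)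
  qed
  then show ?thesis
    unfolding charpoly_def det_def coeff_sum c
    by (simp add: c) (intro holomorphic_intros)
qed

section \<open>Winding numbers along circles\<close>

text \<open>Continuous logarithms of \<open>p\<close> and \<open>q\<close> add up to one of the
  product.\<close>

lemma winding_number_mult:
  assumes "path p" "path q" "0 \<notin> path_image p" "0 \<notin> path_image q"
  shows "winding_number (\<lambda>t. p t * q t) 0 = winding_number p 0 + winding_number q 0"
proof -
  obtain a where a: "path a" "pathfinish a - pathstart a = 2 * of_real pi * \<i> * winding_number p 0"
    "\<And>t. t \<in> {0..1} \<Longrightarrow> p t = 0 + exp (a t)"
    using winding_number_as_continuous_log[OF assms(1,3)] by metis
  obtain b where b: "path b" "pathfinish b - pathstart b = 2 * of_real pi * \<i> * winding_number q 0"
    "\<And>t. t \<in> {0..1} \<Longrightarrow> q t = 0 + exp (b t)"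
    using winding_number_as_continuous_log[OF assms(2,4)] by metis
  have "winding_number (\<lambda>t. p t * q t) 0 = winding_number (exp \<circ> (\<lambda>t. a t + b t)) 0"
    by (rule winding_number_cong) (simp add: a(3) b(3) exp_add)
  also have "\<dots> = ((pathfinish a - pathstart a) + (pathfinish b - pathstart b)) / (2 * of_real pi * \<i>)"
    using a(1) b(1) unfolding path_def
    by (subst winding_number_compose_exp) (auto simp: path_def pathfinish_def pathstart_def intro!: continuous_intros)
  also have "\<dots> = winding_number p 0 + winding_number q 0"
    unfolding a(2) b(2) by (simp add: field_simps)
  finally show ?thesis .
qed

text \<open>The winding number of the image curve rather than a contour integral, so that continuity
  of \<open>G\<close> is enough and homotopies apply directly.\<close>

definition circle_winding :: "(complex \<Rightarrow> complex) \<Rightarrow> real \<Rightarrow> complex" where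
  "circle_winding G r = winding_number (\<lambda>t. G (circlepath 0 r t)) 0"

lemma norm_circlepath_0 [simp]: "norm (circlepath 0 r t) = \<bar>r\<bar>"
  by (simp add: circlepath norm_mult)

lemma continuous_on_circlepath_0 [continuous_intros]:
  "continuous_on S f \<Longrightarrow> continuous_on S g \<Longrightarrow> continuous_on S (\<lambda>x. circlepath 0 (f x) (g x))"
  unfolding circlepath by (intro continuous_intros)

lemma path_circle:
  assumes "continuous_on (sphere 0 r) G" "0 \<le> r"
  shows "path (\<lambda>t. G (circlepath 0 r t))"
  unfolding path_def
  by (rule continuous_on_compose2[OF assms(1)])
    (use assms(2) in \<open>auto intro!: continuous_intros\<close>)

lemma circle_winding_mult:
  assumes "continuous_on (sphere 0 r) G" "continuous_on (sphere 0 r) H" "0 \<le> r"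
    and "\<And>z. norm z = r \<Longrightarrow> G z \<noteq> 0" "\<And>z. norm z = r \<Longrightarrow> H z \<noteq> 0"
  shows "circle_winding (\<lambda>z. G z * H z) r = circle_winding G r + circle_winding H r"
proof -
  have "0 \<notin> path_image (\<lambda>t. G (circlepath 0 r t))" "0 \<notin> path_image (\<lambda>t. H (circlepath 0 r t))"
    using assms(3-5) by (auto simp: path_image_def dest!: sym[of 0])
  then show ?thesis
    unfolding circle_winding_def using assms by (intro winding_number_mult path_circle)
qed

text \<open>Function and radius may vary together: a constant function gives invariance under a
  change of radius, a constant radius gives the comparison of two functions.\<close>

lemma circle_winding_homotopy:
  fixes K :: "real \<Rightarrow> complex \<Rightarrow> complex" and \<rho> :: "real \<Rightarrow> real"
  assumes "continuous_on ({0..1} \<times> {0..1}) (\<lambda>(s, t). K s (circlepath 0 (\<rho> s) t))"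
    and "\<And>s z. s \<in> {0..1} \<Longrightarrow> norm z = \<bar>\<rho> s\<bar> \<Longrightarrow> K s z \<noteq> 0"
  shows "circle_winding (K 0) (\<rho> 0) = circle_winding (K 1) (\<rho> 1)"
  unfolding circle_winding_def
proof (rule winding_number_homotopic_loops)
  show "homotopic_loops (- {0}) (\<lambda>t. K 0 (circlepath 0 (\<rho> 0) t)) (\<lambda>t. K 1 (circlepath 0 (\<rho> 1) t))"
  proof -
    have "circlepath 0 r 0 = circlepath 0 r 1" for r
      by (simp add: circlepath)
    then show ?thesis
      unfolding homotopic_loops
      by (intro exI[of _ "\<lambda>(s, t). K s (circlepath 0 (\<rho> s) t)"] conjI)
        (use assms in \<open>auto simp: pathfinish_def pathstart_def\<close>)
  qed
qed

lemma circle_winding_radius: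
  assumes "continuous_on {z. r1 \<le> norm z \<and> norm z \<le> r2} G" "0 \<le> r1" "r1 \<le> r2"
    and "\<And>z. r1 \<le> norm z \<Longrightarrow> norm z \<le> r2 \<Longrightarrow> G z \<noteq> 0"
  shows "circle_winding G r1 = circle_winding G r2"
proof -
  define \<rho> where "\<rho> s = r1 + s * (r2 - r1)" for s
  have \<rho>: "r1 \<le> \<rho> s" "\<rho> s \<le> r2" "0 \<le> \<rho> s" if "s \<in> {0..1}" for s
    using that assms(2,3) mult_left_le_one_le[of "r2 - r1" s]
    by (auto simp: \<rho>_def)
  have "circle_winding ((\<lambda>_. G) (0::real)) (\<rho> 0) = circle_winding ((\<lambda>_. G) (1::real)) (\<rho> 1)"
  proof (rule circle_winding_homotopy)
    have "continuous_on ({0..1} \<times> {0..1}) (\<lambda>p. G (circlepath 0 (\<rho> (fst p)) (snd p)))"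
    proof (rule continuous_on_compose2[OF assms(1)])
      show "continuous_on ({0..1} \<times> {0..1}) (\<lambda>p. circlepath 0 (\<rho> (fst p)) (snd p))"
        unfolding \<rho>_def by (intro continuous_intros)
      show "(\<lambda>p. circlepath 0 (\<rho> (fst p)) (snd p)) ` ({0..1} \<times> {0..1}) \<subseteq> {z. r1 \<le> norm z \<and> norm z \<le> r2}"
        using \<rho> by fastforce
    qed
    then show "continuous_on ({0..1} \<times> {0..1}) (\<lambda>(s, t). G (circlepath 0 (\<rho> s) t))"
      by (simp add: case_prod_beta)
    show "G z \<noteq> 0" if "s \<in> {0..1}" "norm z = \<bar>\<rho> s\<bar>" for s z
      using \<rho>[OF that(1)] that(2) by (intro assms(4)) simp_all
  qed
  then show ?thesis by (simp add: \<rho>_def)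
qed

text \<open>Rouche's principle: the straight-line homotopy from \<open>G\<close> to \<open>H\<close>
  cannot reach 0.\<close>

lemma circle_winding_nearby:
  assumes "continuous_on (sphere 0 r) G" "continuous_on (sphere 0 r) H" "0 \<le> r"
    and "\<And>z. norm z = r \<Longrightarrow> norm (H z - G z) < norm (G z)"
  shows "circle_winding G r = circle_winding H r"
proof -
  define K where "K s z = G z + of_real s * (H z - G z)" for s z
  have "circle_winding (K 0) ((\<lambda>_. r) 0) = circle_winding (K 1) ((\<lambda>_. r) 1)"
  proof (rule circle_winding_homotopy)
    have "continuous_on ({0..1} \<times> {0..1}) (\<lambda>p. K (fst p) (circlepath 0 r (snd p)))"
      unfolding K_def
      by (intro continuous_intros continuous_on_compose2[OF assms(1)] continuous_on_compose2[OF assms(2)])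
        (use assms(3) in \<open>auto intro!: continuous_intros\<close>)
    then show "continuous_on ({0..1} \<times> {0..1}) (\<lambda>(s, t). K s (circlepath 0 r t))"
      by (simp add: case_prod_beta)
    show "K s z \<noteq> 0" if "s \<in> {0..1}" "norm z = \<bar>r\<bar>" for s :: real and z
    proof
      assume "K s z = 0"
      then have "norm (G z) = norm (of_real s * (H z - G z))"
        unfolding K_def by (simp add: add_eq_0_iff norm_minus_cancel del: norm_mult norm_of_real)
      also have "\<dots> \<le> norm (H z - G z)"
        using that(1) by (simp add: norm_mult mult_left_le_one_le)
      finally show False using assms(3) assms(4)[of z] that(2) by simp
    qed
  qed
  then show ?thesis by (simp add: K_def[abs_def])
qed

lemma circle_winding_linear:
  assumes "norm l \<noteq> r" "0 < r"
  shows "circle_winding (\<lambda>z. z - l) r = (if norm l < r then 1 else 0)"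
proof -
  have "circle_winding (\<lambda>z. z - l) r = winding_number (circlepath 0 r) l"
    unfolding circle_winding_def by (rule winding_number_offset[symmetric])
  also have "\<dots> = (if norm l < r then 1 else 0)"
  proof (cases "norm l < r")
    case False
    then have "winding_number (circlepath 0 r) l = 0"
      by (intro winding_number_zero_outside[of _ "cball 0 r"]) (use assms in auto)
    then show ?thesis using False by simp
  qed (simp add: winding_number_circlepath)
  finally show ?thesis .
qed

text \<open>The argument principle for a product of linear factors. Each factor contributes 1 or 0,
  and multiplicities count because \<open>E\<close> is a multiset.\<close>

lemma circle_winding_roots:
  assumes "0 < r" "\<And>l. l \<in># E \<Longrightarrow> norm l \<noteq> r"
  shows "circle_winding (\<lambda>z. \<Prod>l\<in>#E. z - l) r = of_nat (size {#l \<in># E. norm l < r#})"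
  using assms(2)
proof (induction E)
  case empty
  show ?case by (simp add: circle_winding_def winding_number_zero_const)
next
  case (add a E)
  have "circle_winding (\<lambda>z. \<Prod>l\<in>#add_mset a E. z - l) r = circle_winding (\<lambda>z. (z - a) * (\<Prod>l\<in>#E. z - l)) r"
    by simp
  also have "\<dots> = circle_winding (\<lambda>z. z - a) r + circle_winding (\<lambda>z. \<Prod>l\<in>#E. z - l) r"
  proof (rule circle_winding_mult)
    show "continuous_on (sphere 0 r) (\<lambda>z. \<Prod>l\<in>#E. z - l)"
      by (induction E) (auto intro!: continuous_intros)
    show "(\<Prod>l\<in>#E. z - l) \<noteq> 0" if "norm z = r" for z
    proof
      assume "(\<Prod>l\<in>#E. z - l) = 0"
      then have "z \<in># E" by (auto simp: prod_mset_zero_iff)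
      then show False using add.prems[of z] that by simp
    qed
  qed (use assms(1) add.prems in \<open>auto intro!: continuous_intros\<close>)
  also have "circle_winding (\<lambda>z. \<Prod>l\<in>#E. z - l) r = of_nat (size {#l \<in># E. norm l < r#})"
    by (rule add.IH) (use add.prems in auto)
  finally show ?case
    using add.prems assms(1) by (simp add: circle_winding_linear)
qed

section \<open>The two sides of a smooth arc\<close>

text \<open>Chords of the arc near \<open>\<zeta>\<close> are almost parallel to \<open>D 0\<close>, whereas \<open>v\<close> is almost
  perpendicular to it.\<close>

lemma arc_sector_disjoint:
  fixes g :: "real \<Rightarrow> complex"
  assumes U: "open U" "\<zeta> \<in> U" and hom: "homeomorphism {-1<..<1} (C \<inter> U) g h" and g0: "g 0 = \<zeta>"
    and D: "\<And>s. s \<in> {-1<..<1} \<Longrightarrow> (g has_vector_derivative D s) (at s)" "continuous_on {-1<..<1} D"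
    and D0: "D 0 \<noteq> 0" and \<nu>: "norm \<nu> = 1" "\<nu> \<bullet> D 0 = 0"
  shows "\<exists>\<delta>>0. \<forall>s t v. \<bar>s\<bar> < \<delta> \<and> 0 < t \<and> t < \<delta> \<and> norm (v - \<nu>) < 1/4 \<longrightarrow> g s + of_real t * v \<notin> C"
proof -
  let ?\<tau> = "D 0"
  have "isCont D 0" using D(2) by (rule continuous_on_interior) simp
  then obtain \<delta>1 where \<delta>1: "\<delta>1 > 0" "\<And>s. \<bar>s\<bar> < \<delta>1 \<Longrightarrow> dist (D s) ?\<tau> < norm ?\<tau> / 4"
    using D0 unfolding continuous_at_eps_delta
    by (metis diff_zero dist_norm divide_pos_pos real_norm_def zero_less_norm_iff zero_less_numeral)
  define d where "d = min \<delta>1 1"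
  have d: "d > 0" "d \<le> 1" "d \<le> \<delta>1" using \<delta>1(1) by (auto simp: d_def)
  \<comment> \<open>Mean value inequality for \<open>g s - s *\<^sub>R ?\<tau>\<close>, whose
    derivative has norm at most \<open>norm ?\<tau> / 4\<close> on the interval.\<close>
  have lin: "norm (g s - g s' - of_real (s - s') * ?\<tau>) \<le> norm ?\<tau> / 4 * \<bar>s - s'\<bar>"
    if "s \<in> {-d<..<d}" "s' \<in> {-d<..<d}" for s s'
  proof -
    have "norm ((g s - s *\<^sub>R ?\<tau>) - (g s' - s' *\<^sub>R ?\<tau>)) \<le> norm ?\<tau> / 4 * norm (s - s')"
    proof (rule differentiable_bound[of "{-d<..<d}" _ "\<lambda>s h. h *\<^sub>R (D s - ?\<tau>)"])
      fix x assume x: "x \<in> {-d<..<d}"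
      have "((\<lambda>s. g s - s *\<^sub>R ?\<tau>) has_vector_derivative (D x - ?\<tau>)) (at x)"
        using x d(2) by (auto intro!: derivative_eq_intros D(1))
      then show "((\<lambda>s. g s - s *\<^sub>R ?\<tau>) has_derivative (\<lambda>h. h *\<^sub>R (D x - ?\<tau>))) (at x within {-d<..<d})"
        unfolding has_vector_derivative_def by (rule has_derivative_at_withinI)
      have "norm (D x - ?\<tau>) \<le> norm ?\<tau> / 4"
        using \<delta>1(2)[of x] x d(3) by (simp add: dist_norm abs_less_iff)
      then have "norm (D x - ?\<tau>) * \<bar>y\<bar> \<le> norm ?\<tau> / 4 * \<bar>y\<bar>" for y :: real
        by (rule mult_right_mono) simp
      then show "onorm (\<lambda>h. h *\<^sub>R (D x - ?\<tau>)) \<le> norm ?\<tau> / 4"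
        by (intro onorm_le) (simp add: mult.commute)
    qed (use that in simp_all)
    then show ?thesis by (simp add: algebra_simps scaleR_conv_of_real)
  qed
  have \<zeta>C: "\<zeta> \<in> C \<inter> U" and h\<zeta>: "h \<zeta> = 0"
    using hom g0 by (auto simp: homeomorphism_def)
  have "continuous_on (C \<inter> U) h" using hom by (simp add: homeomorphism_def)
  \<comment> \<open>Continuity of the inverse \<open>h\<close> gives every point of \<open>C\<close>
    near \<zeta> a small parameter, so no far part of the curve comes back to \<zeta>.\<close>
  then obtain \<rho>1 where \<rho>1: "\<rho>1 > 0" "\<And>z. z \<in> C \<inter> U \<Longrightarrow> dist z \<zeta> < \<rho>1 \<Longrightarrow> dist (h z) (h \<zeta>) < d"
    using \<zeta>C d(1) unfolding continuous_on_iff by metis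
  obtain \<rho>2 where \<rho>2: "\<rho>2 > 0" "ball \<zeta> \<rho>2 \<subseteq> U" using U open_contains_ball by metis
  define \<rho> where "\<rho> = min \<rho>1 \<rho>2"
  have \<rho>: "\<rho> > 0" "\<rho> \<le> \<rho>1" "\<rho> \<le> \<rho>2" using \<rho>1 \<rho>2 by (auto simp: \<rho>_def)
  have "isCont g 0" using D(1)[of 0] has_vector_derivative_continuous by force
  then obtain \<delta>2 where \<delta>2: "\<delta>2 > 0" "\<And>s. \<bar>s\<bar> < \<delta>2 \<Longrightarrow> dist (g s) \<zeta> < \<rho> / 2"
    using \<rho>(1) g0 unfolding continuous_at_eps_delta
    by (metis diff_zero dist_norm half_gt_zero_iff real_norm_def)
  define \<delta> where "\<delta> = min d (min \<delta>2 (\<rho> / 4))"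
  have \<delta>: "\<delta> > 0" "\<delta> \<le> d" "\<delta> \<le> \<delta>2" "\<delta> \<le> \<rho> / 4" using d(1) \<delta>2(1) \<rho>(1) by (auto simp: \<delta>_def)
  have "g s + of_real t * v \<notin> C" if st: "\<bar>s\<bar> < \<delta>" "0 < t" "t < \<delta>" and v: "norm (v - \<nu>) < 1/4" for s t v
  proof
    let ?z = "g s + of_real t * v"
    assume C: "?z \<in> C"
    have "norm v \<le> 2" using v \<nu>(1) norm_triangle_sub[of v \<nu>] by simp
    then have "norm (of_real t * v) \<le> t * 2" using st(2) by (simp add: norm_mult)
    then have "norm (of_real t * v) < \<rho> / 2" using st(3) \<delta>(4) by linarith
    moreover have "dist (g s) \<zeta> < \<rho> / 2" using \<delta>2(2) st(1) \<delta>(3) by auto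
    ultimately have "dist ?z \<zeta> < \<rho>"
      using norm_triangle_ineq[of "g s - \<zeta>" "of_real t * v"] by (simp add: dist_norm algebra_simps)
    then have zU: "?z \<in> C \<inter> U" and "dist ?z \<zeta> < \<rho>1"
      using C \<rho> \<rho>2(2) by (auto simp: mem_ball dist_commute)
    define s' where "s' = h ?z"
    have s': "\<bar>s'\<bar> < d" using \<rho>1(2)[OF zU \<open>dist ?z \<zeta> < \<rho>1\<close>] h\<zeta> by (simp add: s'_def dist_norm)
    have gs': "g s' = ?z" using hom zU by (simp add: homeomorphism_def s'_def)
    define e where "e = g s - g s' - of_real (s - s') * ?\<tau>"
    have e: "norm e \<le> norm ?\<tau> / 4 * \<bar>s - s'\<bar>"
      unfolding e_def using s' st(1) \<delta>(2) by (intro lin) auto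
    \<comment> \<open>This vanishing sum is tested against \<nu> and against \<open>?\<tau>\<close>:
      the first gives \<open>3 * t \<le> x\<close>, the second \<open>x \<le> t / 3\<close>,
      impossible for \<open>t > 0\<close>.\<close>
    have eq: "t *\<^sub>R v + (s - s') *\<^sub>R ?\<tau> + e = 0"
      unfolding e_def gs' by (simp add: scaleR_conv_of_real)
    define x where "x = \<bar>s - s'\<bar> * norm ?\<tau>"
    have ex: "norm e \<le> x / 4" using e by (simp add: x_def mult.commute)
    have \<nu>v: "\<nu> \<bullet> v \<ge> 3/4"
    proof -
      have "\<nu> \<bullet> v = 1 + \<nu> \<bullet> (v - \<nu>)" using \<nu>(1) by (simp add: inner_diff_right norm_eq_1)
      moreover have "\<bar>\<nu> \<bullet> (v - \<nu>)\<bar> \<le> norm (v - \<nu>)" using Cauchy_Schwarz_ineq2[of \<nu> "v - \<nu>"] \<nu>(1) by simp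
      ultimately show ?thesis using v by linarith
    qed
    have "\<nu> \<bullet> (t *\<^sub>R v + (s - s') *\<^sub>R ?\<tau> + e) = t * (\<nu> \<bullet> v) + \<nu> \<bullet> e"
      using \<nu>(2) by (simp add: inner_add_right)
    then have "t * (\<nu> \<bullet> v) = - (\<nu> \<bullet> e)" unfolding eq by simp
    also have "\<dots> \<le> norm e" using Cauchy_Schwarz_ineq2[of \<nu> e] \<nu>(1) by simp
    finally have "t * (\<nu> \<bullet> v) \<le> norm e" .
    moreover have "t * (3/4) \<le> t * (\<nu> \<bullet> v)" using \<nu>v st(2) by (intro mult_left_mono) auto
    ultimately have 1: "3 * t \<le> x" using ex by linarith
    have "\<bar>v \<bullet> ?\<tau>\<bar> = \<bar>(v - \<nu>) \<bullet> ?\<tau>\<bar>" using \<nu>(2) by (simp add: inner_diff_left)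
    also have "\<dots> \<le> norm (v - \<nu>) * norm ?\<tau>" by (rule Cauchy_Schwarz_ineq2)
    also have "\<dots> \<le> 1/4 * norm ?\<tau>" using v by (intro mult_right_mono) auto
    finally have v\<tau>: "\<bar>v \<bullet> ?\<tau>\<bar> \<le> norm ?\<tau> / 4" by simp
    have "(t *\<^sub>R v + (s - s') *\<^sub>R ?\<tau> + e) \<bullet> ?\<tau> = t * (v \<bullet> ?\<tau>) + (s - s') * (norm ?\<tau>)\<^sup>2 + e \<bullet> ?\<tau>"
      by (simp add: inner_add_left power2_norm_eq_inner)
    then have "(s - s') * (norm ?\<tau>)\<^sup>2 = - (t * (v \<bullet> ?\<tau>)) - e \<bullet> ?\<tau>" unfolding eq by simp
    then have "\<bar>(s - s') * (norm ?\<tau>)\<^sup>2\<bar> \<le> \<bar>t * (v \<bullet> ?\<tau>)\<bar> + \<bar>e \<bullet> ?\<tau>\<bar>" by linarith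
    also have "\<bar>t * (v \<bullet> ?\<tau>)\<bar> \<le> t * (norm ?\<tau> / 4)" using v\<tau> st(2) by (simp add: abs_mult)
    also have "\<bar>e \<bullet> ?\<tau>\<bar> \<le> norm e * norm ?\<tau>" by (rule Cauchy_Schwarz_ineq2)
    also have "\<dots> \<le> x / 4 * norm ?\<tau>" using ex by (intro mult_right_mono) auto
    also have "\<bar>(s - s') * (norm ?\<tau>)\<^sup>2\<bar> = x * norm ?\<tau>" by (simp add: x_def abs_mult power2_eq_square)
    finally have "x * norm ?\<tau> \<le> (t / 4 + x / 4) * norm ?\<tau>" by (simp add: algebra_simps)
    then have "x \<le> t / 4 + x / 4" using D0 by (simp add: mult_le_cancel_right)
    then show False using 1 st(2) by linarith
  qed
  then show ?thesis using \<delta>(1) by blast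
qed

text \<open>\<open>unit_normal\<close> fixes the parameter interval and puts the base point at 0, so
  an arc has to be re-centred at \<open>s\<close> without changing its domain. The automorphism of
  the interval that moves 0 to \<open>s\<close> does this.\<close>

lemma homeomorphism_moebius:
  assumes "s \<in> {-1<..<1::real}"
  shows "homeomorphism {-1<..<1} {-1<..<1} (\<lambda>u. (u + s) / (1 + s * u)) (\<lambda>u. (u - s) / (1 - s * u))"
proof -
  have pos: "1 + a * u > 0" if "\<bar>a\<bar> < 1" "\<bar>u\<bar> < 1" for a u :: real
  proof -
    have "\<bar>a * u\<bar> < 1" using that by (metis abs_mult abs_mult_less mult_1)
    then show ?thesis by linarith
  qed
  \<comment> \<open>Stated for a general \<open>a\<close>, because the inverse map is the same map
    with \<open>- s\<close>.\<close>
  have range: "(u + a) / (1 + a * u) \<in> {-1<..<1}" and inv: "((u + a) / (1 + a * u) - a) / (1 - a * ((u + a) / (1 + a * u))) = u"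
    if "\<bar>a\<bar> < 1" "\<bar>u\<bar> < 1" for a u :: real
  proof -
    have p: "1 + a * u > 0" using pos that .
    have "(1 - a) * (1 - u) > 0" "(1 + a) * (1 + u) > 0" using that by simp_all
    then have "u + a < 1 + a * u" "- (1 + a * u) < u + a" by (simp_all add: algebra_simps)
    then show "(u + a) / (1 + a * u) \<in> {-1<..<1}"
      using p by (simp add: pos_less_divide_eq pos_divide_less_eq)
    have a: "1 - a * a > 0" using pos[of a "-a"] that by simp
    have "(u + a) / (1 + a * u) - a = u * (1 - a * a) / (1 + a * u)"
      using p by (simp add: field_simps)
    moreover have "1 - a * ((u + a) / (1 + a * u)) = (1 - a * a) / (1 + a * u)"
      using p by (simp add: field_simps)
    ultimately show "((u + a) / (1 + a * u) - a) / (1 - a * ((u + a) / (1 + a * u))) = u"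
      using p a by simp
  qed
  have s: "\<bar>s\<bar> < 1" "\<bar>- s\<bar> < 1" using assms by auto
  show ?thesis
  proof (rule homeomorphismI)
    show "continuous_on {-1<..<1} (\<lambda>u. (u + s) / (1 + s * u))"
      using pos[OF s(1)] by (intro continuous_intros) (force simp: abs_less_iff)
    show "continuous_on {-1<..<1} (\<lambda>u. (u - s) / (1 - s * u))"
      using pos[OF s(2)] by (intro continuous_intros) (force simp: abs_less_iff)
    show "(\<lambda>u. (u + s) / (1 + s * u)) ` {-1<..<1} \<subseteq> {-1<..<1}"
      using range[OF s(1)] by (intro image_subsetI) (auto simp: abs_less_iff)
    show "(\<lambda>u. (u - s) / (1 - s * u)) ` {-1<..<1} \<subseteq> {-1<..<1}"
      using range[OF s(2)] by (intro image_subsetI) (auto simp: abs_less_iff)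
    show "((u + s) / (1 + s * u) - s) / (1 - s * ((u + s) / (1 + s * u))) = u" if "u \<in> {-1<..<1}" for u
      using inv[OF s(1), of u] that by (simp add: abs_less_iff)
    show "((u - s) / (1 - s * u) + s) / (1 + s * ((u - s) / (1 - s * u))) = u" if "u \<in> {-1<..<1}" for u
      using inv[OF s(2), of u] that by (simp add: abs_less_iff)
  qed
qed

lemma unit_normal_reparametrize:
  fixes g :: "real \<Rightarrow> complex"
  assumes U: "open U" and hom: "homeomorphism {-1<..<1} (C \<inter> U) g h"
    and D: "\<And>s. s \<in> {-1<..<1} \<Longrightarrow> (g has_vector_derivative D s) (at s)" "continuous_on {-1<..<1} D"
      "\<And>s. s \<in> {-1<..<1} \<Longrightarrow> D s \<noteq> 0"
    and s: "s \<in> {-1<..<1}" and \<nu>: "norm \<nu> = 1" "\<nu> \<bullet> D s = 0"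
  shows "unit_normal C (g s) \<nu>"
proof -
  let ?\<phi> = "\<lambda>u. (u + s) / (1 + s * u)"
  let ?d = "\<lambda>u. (1 - s\<^sup>2) / (1 + s * u)\<^sup>2"
  note mob = homeomorphism_moebius[OF s]
  have pos: "1 + s * u \<noteq> 0" if "u \<in> {-1<..<1}" for u
  proof -
    have "\<bar>s * u\<bar> < 1" using that s by (metis abs_less_iff abs_mult abs_mult_less greaterThanLessThan_iff minus_less_iff mult_1)
    then show ?thesis by linarith
  qed
  have s2: "1 - s\<^sup>2 \<noteq> 0" using s by (auto simp: power2_eq_1_iff)
  have range: "?\<phi> u \<in> {-1<..<1}" if "u \<in> {-1<..<1}" for u
    using mob that unfolding homeomorphism_def by blast
  have d: "(?\<phi> has_vector_derivative ?d u) (at u)" if "u \<in> {-1<..<1}" for u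
  proof -
    have "(?\<phi> has_real_derivative ?d u) (at u)"
      using pos[OF that] by (auto intro!: derivative_eq_intros simp: power2_eq_square algebra_simps)
    then show ?thesis by (simp add: has_real_derivative_iff_has_vector_derivative)
  qed
  have deriv: "((g \<circ> ?\<phi>) has_vector_derivative (?d u *\<^sub>R D (?\<phi> u))) (at u)" if "u \<in> {-1<..<1}" for u
    using that by (intro vector_diff_chain_at d D(1) range)
  have vd: "vector_derivative (g \<circ> ?\<phi>) (at u) = ?d u *\<^sub>R D (?\<phi> u)" if "u \<in> {-1<..<1}" for u
    using deriv[OF that] by (rule vector_derivative_at)
  have "continuous_on {-1<..<1} (\<lambda>u. ?d u *\<^sub>R D (?\<phi> u))"
  proof (rule continuous_on_scaleR)
    show "continuous_on {-1<..<1} ?d" using pos by (intro continuous_intros) auto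
    have "continuous_on {-1<..<1} ?\<phi>" using mob by (simp add: homeomorphism_def)
    then show "continuous_on {-1<..<1} (\<lambda>u. D (?\<phi> u))"
      by (rule continuous_on_compose2[OF D(2)]) (use range in blast)
  qed
  then have "(g \<circ> ?\<phi>) C1_differentiable_on {-1<..<1}"
    unfolding C1_differentiable_on_def using deriv by (intro exI[of _ "\<lambda>u. ?d u *\<^sub>R D (?\<phi> u)"]) blast
  moreover have "homeomorphism {-1<..<1} (C \<inter> U) (g \<circ> ?\<phi>) ((\<lambda>u. (u - s) / (1 - s * u)) \<circ> h)"
    by (rule homeomorphism_compose[OF mob hom])
  moreover have "vector_derivative (g \<circ> ?\<phi>) (at u) \<noteq> 0" if "u \<in> {-1<..<1}" for u
    using vd[OF that] pos[OF that] s2 D(3)[OF range[OF that]] by simp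
  moreover have "\<nu> \<bullet> vector_derivative (g \<circ> ?\<phi>) (at 0) = 0"
    using vd[of 0] \<nu>(2) by simp
  moreover have "g s \<in> U" using hom s by (auto simp: homeomorphism_def)
  ultimately show ?thesis
    unfolding unit_normal_def using U \<nu>(1)
    by (intro conjI exI[of _ U] exI[of _ "g \<circ> ?\<phi>"] exI[of _ "(\<lambda>u. (u - s) / (1 - s * u)) \<circ> h"]) auto
qed

text \<open>\<open>P\<close> and \<open>M\<close> are unions of short segments that leave the arc in
  directions close to \<nu> and \<open>- \<nu>\<close>. Each is the image of a connected box, and
  \<open>arc_sector_disjoint\<close> keeps it off \<open>C\<close>. One such pair borders all nearby
  points of the arc at once, so what lies on the two sides of \<zeta> also lies on the two sides of
  infinitely many other points.\<close>

lemma unit_normal_sides: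
  assumes normal: "unit_normal C \<zeta> \<nu>" and \<epsilon>: "\<epsilon> > 0"
  obtains \<delta> Z P M where "\<delta> > 0" "infinite Z" "Z \<subseteq> C" "connected P" "connected M"
    "P \<subseteq> ball \<zeta> \<epsilon> - C" "M \<subseteq> ball \<zeta> \<epsilon> - C"
    "\<And>t. t \<in> {0<..<\<delta>} \<Longrightarrow> \<zeta> + of_real t * \<nu> \<in> P \<and> \<zeta> - of_real t * \<nu> \<in> M"
    "\<And>z. z \<in> Z \<Longrightarrow> \<exists>\<nu>'. unit_normal C z \<nu>' \<and>
        (\<forall>t\<in>{0<..<\<delta>}. z + of_real t * \<nu>' \<in> P \<and> z - of_real t * \<nu>' \<in> M)"
proof -
  obtain U g h where U: "open U" "\<zeta> \<in> U" and hom: "homeomorphism {-1<..<1::real} (C \<inter> U) g h" and g0: "g 0 = \<zeta>"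
    and C1: "g C1_differentiable_on {-1<..<1}"
    and nz: "\<And>t. t \<in> {-1<..<1} \<Longrightarrow> vector_derivative g (at t) \<noteq> 0"
    and orth: "\<nu> \<bullet> vector_derivative g (at 0) = 0" and \<nu>1: "norm \<nu> = 1"
    using normal unfolding unit_normal_def by blast
  obtain D where D: "\<And>s. s \<in> {-1<..<1} \<Longrightarrow> (g has_vector_derivative D s) (at s)" "continuous_on {-1<..<1} D"
    using C1 unfolding C1_differentiable_on_def by blast
  have vd: "vector_derivative g (at s) = D s" if "s \<in> {-1<..<1}" for s
    using D(1)[OF that] by (rule vector_derivative_at)
  have D3: "D s \<noteq> 0" if "s \<in> {-1<..<1}" for s using nz[OF that] vd[OF that] by simp
  have D0: "D 0 \<noteq> 0" "\<nu> \<bullet> D 0 = 0" using D3[of 0] orth vd[of 0] by simp_all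
  obtain \<delta>1 where \<delta>1: "\<delta>1 > 0" "\<And>s t v. \<bar>s\<bar> < \<delta>1 \<Longrightarrow> 0 < t \<Longrightarrow> t < \<delta>1 \<Longrightarrow> norm (v - \<nu>) < 1/4 \<Longrightarrow> g s + of_real t * v \<notin> C"
    using arc_sector_disjoint[OF U hom g0 D D0(1) \<nu>1 D0(2)] by blast
  obtain \<delta>2 where \<delta>2: "\<delta>2 > 0" "\<And>s t v. \<bar>s\<bar> < \<delta>2 \<Longrightarrow> 0 < t \<Longrightarrow> t < \<delta>2 \<Longrightarrow> norm (v - - \<nu>) < 1/4 \<Longrightarrow> g s + of_real t * v \<notin> C"
    using arc_sector_disjoint[OF U hom g0 D D0(1), of "- \<nu>"] \<nu>1 D0(2) by auto
  have "isCont g 0" using D(1)[of 0] has_vector_derivative_continuous by force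
  then obtain \<delta>3 where \<delta>3: "\<delta>3 > 0" "\<And>s. \<bar>s\<bar> < \<delta>3 \<Longrightarrow> dist (g s) \<zeta> < \<epsilon> / 2"
    using \<epsilon> g0 unfolding continuous_at_eps_delta
    by (metis diff_zero dist_norm half_gt_zero_iff real_norm_def)
  \<comment> \<open>\<nu> turned by the angle through which the tangent has turned since parameter
    0: a unit normal at \<open>g s\<close> that depends continuously on \<open>s\<close>.\<close>
  define N where "N s = \<nu> * (sgn (D s) / sgn (D 0))" for s
  have "isCont D 0" using D(2) by (rule continuous_on_interior) simp
  then have "isCont N 0"
    unfolding N_def using D0(1) by (intro continuous_intros) (simp_all add: sgn_zero_iff)
  moreover have N0: "N 0 = \<nu>" using D0(1) by (simp add: N_def sgn_zero_iff)
  ultimately obtain \<delta>4 where \<delta>4: "\<delta>4 > 0" "\<And>s. \<bar>s\<bar> < \<delta>4 \<Longrightarrow> dist (N s) \<nu> < 1/4"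
    unfolding continuous_at_eps_delta
    by (metis diff_zero dist_norm divide_pos_pos real_norm_def zero_less_numeral zero_less_one)
  \<comment> \<open>The bound \<open>\<epsilon> / 4\<close> matches \<open>norm v \<le> 2\<close>:
    the offset stays below \<open>\<epsilon> / 2\<close>, and \<open>\<delta>3\<close> keeps the
    foot point within the other half. The bound 1 keeps \<open>s\<close> in the parameter
    interval.\<close>
  define \<delta> where "\<delta> = Min {\<delta>1, \<delta>2, \<delta>3, \<delta>4, \<epsilon> / 4, 1}"
  have \<delta>: "\<delta> > 0" "\<delta> \<le> \<delta>1" "\<delta> \<le> \<delta>2" "\<delta> \<le> \<delta>3" "\<delta> \<le> \<delta>4" "\<delta> \<le> \<epsilon> / 4" "\<delta> \<le> 1"
    using \<delta>1(1) \<delta>2(1) \<delta>3(1) \<delta>4(1) \<epsilon> by (simp_all add: \<delta>_def)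
  let ?S = "\<lambda>\<nu>::complex. {-\<delta><..<\<delta>} \<times> {0<..<\<delta>} \<times> ball \<nu> (1/4)"
  let ?F = "\<lambda>(s, t, v). g s + of_real t * v"
  have sub: "?F ` ?S \<nu>' \<subseteq> ball \<zeta> \<epsilon>" if "norm \<nu>' = 1" for \<nu>'
  proof (clarsimp simp del: mem_ball)
    fix s t v assume st: "- \<delta> < s" "s < \<delta>" "0 < t" "t < \<delta>" and "v \<in> ball \<nu>' (1/4)"
    then have "norm (v - \<nu>') < 1/4" by (simp add: dist_norm norm_minus_commute)
    then have "norm v \<le> 2" using that norm_triangle_sub[of v \<nu>'] by simp
    then have "norm (of_real t * v) \<le> t * 2" using st by (simp add: norm_mult)
    then have "norm (of_real t * v) < \<epsilon> / 2" using st \<delta>(6) by linarith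
    moreover have "dist (g s) \<zeta> < \<epsilon> / 2" using \<delta>3(2)[of s] st \<delta>(4) by auto
    ultimately have "dist (g s + of_real t * v) \<zeta> < \<epsilon>"
      using norm_triangle_ineq[of "g s - \<zeta>" "of_real t * v"] by (simp add: dist_norm algebra_simps)
    then show "g s + of_real t * v \<in> ball \<zeta> \<epsilon>" by (simp add: dist_commute)
  qed
  have conn: "connected (?F ` ?S \<nu>')" for \<nu>'
  proof (rule connected_continuous_image)
    have g: "continuous_on {-\<delta><..<\<delta>} g"
      by (rule continuous_on_subset[of "{-1<..<1}" g]) (use hom \<delta>(7) in \<open>auto simp: homeomorphism_def\<close>)
    have "continuous_on (?S \<nu>') (\<lambda>p. g (fst p))"
      by (rule continuous_on_compose2[OF g continuous_on_fst[OF continuous_on_id]]) fastforce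
    then have "continuous_on (?S \<nu>') (\<lambda>p. g (fst p) + of_real (fst (snd p)) * snd (snd p))"
      by (rule continuous_on_add) (intro continuous_intros)
    moreover have "(\<lambda>p. g (fst p) + of_real (fst (snd p)) * snd (snd p)) = ?F"
      by (rule ext) (simp only: case_prod_beta)
    ultimately show "continuous_on (?S \<nu>') ?F" by (simp only:)
    show "connected (?S \<nu>')"
      by (intro connected_Times convex_connected convex_ball convex_real_interval)
  qed
  have inj: "inj_on g {-\<delta><..<\<delta>}"
    using hom \<delta>(7) by (intro inj_on_inverseI[of _ h]) (auto simp: homeomorphism_def)
  have N: "norm (N s) = 1" "N s \<bullet> D s = 0" if "s \<in> {-1<..<1}" for s
  proof -
    show "norm (N s) = 1" using D3[OF that] D0(1) \<nu>1 by (simp add: N_def norm_mult norm_divide norm_sgn)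
    define r where "r = sgn (D s) / sgn (D 0)"
    \<comment> \<open>Multiplication by a complex number is a similarity, so it preserves the
      orthogonality of \<nu> and \<open>D 0\<close>.\<close>
    have rr: "(a * r) \<bullet> (b * r) = (norm r)\<^sup>2 * (a \<bullet> b)" for a b
      unfolding cmod_power2 by (simp add: inner_complex_def algebra_simps power2_eq_square)
    have "D s = norm (D s) *\<^sub>R sgn (D s)" by (simp add: sgn_div_norm D3[OF that])
    also have "sgn (D s) = sgn (D 0) * r" using D0(1) by (simp add: r_def sgn_zero_iff)
    finally have Ds: "D s = (of_real (norm (D s) / norm (D 0)) * D 0) * r"
      by (simp add: sgn_div_norm scaleR_conv_of_real divide_inverse mult_ac)
    have "\<nu> \<bullet> (of_real (norm (D s) / norm (D 0)) * D 0) = 0"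
      unfolding scaleR_conv_of_real[symmetric] inner_scaleR_right D0(2) by simp
    then have "(\<nu> * r) \<bullet> ((of_real (norm (D s) / norm (D 0)) * D 0) * r) = 0"
      by (simp only: rr mult_zero_right)
    then have "(\<nu> * r) \<bullet> D s = 0" by (simp only: Ds[symmetric])
    then show "N s \<bullet> D s = 0" unfolding N_def r_def .
  qed
  show ?thesis
  proof (rule that[of \<delta> "g ` {-\<delta><..<\<delta>}" "?F ` ?S \<nu>" "?F ` ?S (- \<nu>)"])
    show "infinite (g ` {-\<delta><..<\<delta>})"
      using inj \<delta>(1) by (simp add: finite_image_iff infinite_Ioo)
    show "g ` {-\<delta><..<\<delta>} \<subseteq> C" using hom \<delta>(7) by (force simp: homeomorphism_def)
    have "?F ` ?S \<nu> \<inter> C = {}" using \<delta>1(2) \<delta>(2) by (force simp: dist_norm norm_minus_commute)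
    then show "?F ` ?S \<nu> \<subseteq> ball \<zeta> \<epsilon> - C" using sub[OF \<nu>1] by blast
    have "?F ` ?S (- \<nu>) \<inter> C = {}" using \<delta>2(2) \<delta>(3) by (force simp: dist_norm norm_minus_commute)
    moreover have "norm (- \<nu>) = 1" using \<nu>1 by simp
    ultimately show "?F ` ?S (- \<nu>) \<subseteq> ball \<zeta> \<epsilon> - C" using sub by blast
    have mem: "g s + of_real t * v \<in> ?F ` ?S \<nu> \<and> g s - of_real t * v \<in> ?F ` ?S (- \<nu>)"
      if "s \<in> {-\<delta><..<\<delta>}" "t \<in> {0<..<\<delta>}" "dist v \<nu> < 1/4" for s t v
    proof
      show "g s + of_real t * v \<in> ?F ` ?S \<nu>"
        using that by (intro image_eqI[of _ _ "(s, t, v)"]) (auto simp: dist_commute)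
      show "g s - of_real t * v \<in> ?F ` ?S (- \<nu>)"
        using that by (intro image_eqI[of _ _ "(s, t, - v)"]) (auto simp: dist_commute dist_minus)
    qed
    show "\<zeta> + of_real t * \<nu> \<in> ?F ` ?S \<nu> \<and> \<zeta> - of_real t * \<nu> \<in> ?F ` ?S (- \<nu>)" if "t \<in> {0<..<\<delta>}" for t
      using mem[of 0 t \<nu>] that \<delta>(1) g0 by simp
    show "\<exists>\<nu>'. unit_normal C z \<nu>' \<and>
        (\<forall>t\<in>{0<..<\<delta>}. z + of_real t * \<nu>' \<in> ?F ` ?S \<nu> \<and> z - of_real t * \<nu>' \<in> ?F ` ?S (- \<nu>))"
      if z: "z \<in> g ` {-\<delta><..<\<delta>}" for z
    proof -
      obtain s where s: "s \<in> {-\<delta><..<\<delta>}" "z = g s" using z by blast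
      then have s1: "s \<in> {-1<..<1}" using \<delta>(7) by auto
      have "dist (N s) \<nu> < 1/4" using \<delta>4(2)[of s] s \<delta>(5) by auto
      then show ?thesis
        using unit_normal_reparametrize[OF U(1) hom D D3 s1 N[OF s1]] mem[OF s(1)] s(2) by blast
    qed
  qed (use \<delta>(1) conn in simp_all)
qed

section \<open>Eigenvalues near the unit circle\<close>

lemma isCont_tendsto_nhds: "isCont g x \<Longrightarrow> (g \<longlongrightarrow> g x) (nhds x)"
  by (simp only: continuous_at tendsto_at_iff_tendsto_nhds)

text \<open>The tube lemma for filters. The predicate takes a pair, to fit the product filter in its
  hypothesis.\<close>

lemma eventually_compact_uniform:
  assumes "compact K" "\<And>x. x \<in> K \<Longrightarrow> eventually P (F \<times>\<^sub>F nhds x)"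
  shows "\<forall>\<^sub>F t in F. \<forall>x\<in>K. P (t, x)"
proof -
  have "\<exists>U Q. open U \<and> x \<in> U \<and> eventually Q F \<and> (\<forall>t y. Q t \<longrightarrow> y \<in> U \<longrightarrow> P (t, y))" if x: "x \<in> K" for x
  proof -
    obtain Q R where Q: "eventually Q F" "eventually R (nhds x)" "\<And>t y. Q t \<Longrightarrow> R y \<Longrightarrow> P (t, y)"
      using assms(2)[OF x] unfolding eventually_prod_filter by blast
    then show ?thesis unfolding eventually_nhds by blast
  qed
  then obtain U Q where UQ: "\<And>x. x \<in> K \<Longrightarrow> open (U x) \<and> x \<in> U x \<and> eventually (Q x) F"
    "\<And>x t y. x \<in> K \<Longrightarrow> Q x t \<Longrightarrow> y \<in> U x \<Longrightarrow> P (t, y)" by metis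
  have "\<And>x. x \<in> K \<Longrightarrow> open (U x)" "K \<subseteq> (\<Union>x\<in>K. U x)" using UQ(1) by blast+
  then obtain J where J: "J \<subseteq> K" "finite J" "K \<subseteq> (\<Union>x\<in>J. U x)"
    using compactE_image[OF assms(1), of K U] by metis
  have "\<forall>\<^sub>F t in F. \<forall>x\<in>J. Q x t" using J UQ(1) by (intro eventually_ball_finite) auto
  then show ?thesis
  proof eventually_elim
    case (elim t)
    then show ?case using J(1,3) UQ(2) by blast
  qed
qed

text \<open>The characteristic polynomial with the matrix forgotten: a polynomial of degree at most
  \<open>d\<close> in \<xi> whose coefficients are entire in the frequency.
  \<open>nontrivial\<close> guarantees that at fixed unimodular \<xi> the roots in the frequency are
  isolated.\<close>

locale char_family =
  fixes d :: nat and c :: "nat \<Rightarrow> complex \<Rightarrow> complex" and f :: "complex \<Rightarrow> complex" and r :: real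
  assumes c_holo: "c k holomorphic_on UNIV"
    and r: "0 < r" "r \<le> 1"
    and f_holo: "f holomorphic_on {l. 1 - r < norm l \<and> norm l < 1 + r}"
    and on_circle: "norm \<xi> = 1 \<Longrightarrow> (\<Sum>k\<le>d. c k (f \<xi>) * \<xi> ^ k) = 0"
    and nontrivial: "norm \<xi> = 1 \<Longrightarrow> \<exists>w. (\<Sum>k\<le>d. c k w * \<xi> ^ k) \<noteq> 0"
begin

definition ring :: "complex set" where
  "ring = {l. 1 - r < norm l \<and> norm l < 1 + r}"

definition p :: "complex \<Rightarrow> complex \<Rightarrow> complex" where
  "p l w = (\<Sum>k\<le>d. c k w * l ^ k)"

text \<open>The \<open>i\<close>-th derivative of \<open>p l\<close> in the frequency, at fixed
  \<open>l\<close>.\<close>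

definition pd :: "nat \<Rightarrow> complex \<Rightarrow> complex \<Rightarrow> complex" where
  "pd i l w = (\<Sum>k\<le>d. (deriv ^^ i) (c k) w * l ^ k)"

lemma pd_0: "pd 0 = p"
  by (simp add: fun_eq_iff pd_def p_def)

lemma open_ring: "open ring"
proof -
  have "ring = {l. 1 - r < norm l} \<inter> {l. norm l < 1 + r}" by (auto simp: ring_def)
  then show ?thesis by (simp add: open_Int open_Collect_less continuous_on_norm_id)
qed

lemma connected_ring: "connected ring"
  using connected_annulus(1)[of "1 - r" "0 :: complex" "1 + r"] by (simp add: ring_def)

lemma sphere_ring: "sphere 0 1 \<subseteq> ring"
  using r by (auto simp: ring_def)

lemma f_holomorphic: "f holomorphic_on ring"
  using f_holo by (simp add: ring_def)

lemma deriv_c_holomorphic: "(deriv ^^ i) (c k) holomorphic_on UNIV"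
  by (rule holomorphic_higher_deriv[OF c_holo open_UNIV])

lemma pd_has_field_derivative: "(pd i l has_field_derivative pd (Suc i) l w) (at w within S)"
proof -
  have "((deriv ^^ i) (c k) has_field_derivative (deriv ^^ Suc i) (c k) w) (at w)" for k
    using holomorphic_derivI[OF deriv_c_holomorphic open_UNIV, of w i k] by simp
  then have "((\<lambda>w. \<Sum>k\<le>d. (deriv ^^ i) (c k) w * l ^ k) has_field_derivative (\<Sum>k\<le>d. (deriv ^^ Suc i) (c k) w * l ^ k)) (at w)"
    by (intro DERIV_sum DERIV_cmult_right)
  then show ?thesis
    by (simp add: pd_def[abs_def] has_field_derivative_at_within)
qed

lemma pd_higher_deriv: "(deriv ^^ i) (p l) = pd i l"
proof (induction i)
  case (Suc i)
  have "deriv (pd i l) = pd (Suc i) l"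
    using DERIV_imp_deriv[OF pd_has_field_derivative[of i l]] by (simp add: fun_eq_iff)
  then show ?case using Suc by simp
qed (simp add: pd_0)

lemma continuous_pd: "isCont (\<lambda>x. pd i (fst x) (snd x)) y"
proof -
  have "isCont ((deriv ^^ i) (c k)) w" for k w
    using holomorphic_on_imp_continuous_on[OF deriv_c_holomorphic] continuous_on_eq_continuous_at by blast
  then have "isCont (\<lambda>x. (deriv ^^ i) (c k) (snd x)) y" for k
    by (rule isCont_o2[rotated]) (intro continuous_intros)
  then show ?thesis
    unfolding pd_def by (intro continuous_intros)
qed

lemma isCont_p: "isCont g y \<Longrightarrow> isCont h y \<Longrightarrow> isCont (\<lambda>x. p (g x) (h x)) y"
  using isCont_o2[of y "\<lambda>x. (g x, h x)" "\<lambda>x. pd 0 (fst x) (snd x)", OF isCont_Pair continuous_pd] by (simp add: pd_0)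

lemma continuous_on_p: "continuous_on S (\<lambda>l. p l w)"
  by (intro continuous_at_imp_continuous_on ballI isCont_p continuous_intros)

text \<open>Up to factorials the Taylor coefficients of \<open>p l\<close> about \<open>f l\<close>,
  seen as functions of \<open>l\<close> alone; this makes the identity theorem applicable to
  them.\<close>

definition F :: "nat \<Rightarrow> complex \<Rightarrow> complex" where
  "F i l = pd i l (f l)"

lemma F_holomorphic: "F i holomorphic_on ring"
proof -
  have "(\<lambda>l. (deriv ^^ i) (c k) (f l)) holomorphic_on ring" for k
    using holomorphic_on_compose[OF f_holomorphic holomorphic_on_subset[OF deriv_c_holomorphic]] by (simp add: o_def)
  then show ?thesis unfolding F_def pd_def by (intro holomorphic_intros)
qed

lemma identity_ring:
  assumes "g holomorphic_on ring" "\<And>\<xi>. norm \<xi> = 1 \<Longrightarrow> g \<xi> = 0" "l \<in> ring"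
  shows "g l = 0"
proof (rule analytic_continuation[OF assms(1) open_ring connected_ring, of "sphere 0 1" 1])
  have "sphere 0 1 \<noteq> {x}" for x :: complex
    by (metis dist_0_norm insertE mem_sphere norm_minus_cancel norm_one one_neq_neg_one singletonD singletonI)
  then show "(1::complex) islimpt sphere 0 1"
    by (intro connected_imp_perfect connected_sphere) auto
qed (use assms sphere_ring in auto)

lemma p_f_eq_0: "l \<in> ring \<Longrightarrow> p l (f l) = 0"
  using identity_ring[OF F_holomorphic[of 0]] on_circle by (simp add: F_def pd_0 p_def)

text \<open>Near \<xi> a root can leave the graph of \<open>f\<close> only if the multiplicity of
  \<open>f \<xi>\<close> as a root of \<open>p \<xi>\<close> exceeds its generic value
  \<open>m\<close>. That happens at zeros of \<open>F m\<close>, and the identity theorem leaves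
  finitely many of them on the circle.\<close>

lemma local_roots:
  obtains E where "finite E" "\<And>\<xi>. norm \<xi> = 1 \<Longrightarrow> \<xi> \<notin> E \<Longrightarrow>
    eventually (\<lambda>(l, w). p l w = 0 \<longrightarrow> f l = w) (nhds (\<xi>, f \<xi>))"
proof -
  \<comment> \<open>Otherwise all derivatives of the entire function \<open>p 1\<close> vanish at
    \<open>f 1\<close>, so \<open>p 1\<close> is identically 0, against
    \<open>nontrivial\<close>.\<close>
  have ex: "\<exists>i. \<exists>\<xi>. norm \<xi> = 1 \<and> F i \<xi> \<noteq> 0"
  proof (rule ccontr)
    assume "\<not> ?thesis"
    then have "F i 1 = 0" for i by auto
    then have "(deriv ^^ i) (p 1) (f 1) = 0" for i by (simp add: pd_higher_deriv F_def)
    moreover have "p 1 holomorphic_on UNIV"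
      using pd_has_field_derivative[of 0 1] unfolding pd_0 holomorphic_on_def field_differentiable_def by blast
    ultimately have "p 1 w = 0" for w
      using holomorphic_fun_eq_0_on_connected[of "p 1" UNIV "f 1" w] by (simp add: connected_UNIV)
    then show False using nontrivial[of 1] by (simp add: p_def)
  qed
  \<comment> \<open>For all but finitely many \<open>\<xi>\<close>, \<open>m\<close> is the multiplicity of the root \<open>f \<xi>\<close> of \<open>p \<xi>\<close>, so by
    Taylor \<open>p l w = (w - f l) ^ m * (F m l / fact m + O(w - f l))\<close>.\<close>
  define m where "m = (LEAST i. \<exists>\<xi>. norm \<xi> = 1 \<and> F i \<xi> \<noteq> 0)"
  obtain \<xi>1 where \<xi>1: "norm \<xi>1 = 1" "F m \<xi>1 \<noteq> 0" using LeastI_ex[OF ex] unfolding m_def by blast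
  have low: "F i l = 0" if "i < m" "l \<in> ring" for i l
  proof (rule identity_ring[OF F_holomorphic _ that(2)])
    show "F i \<xi> = 0" if "norm \<xi> = 1" for \<xi>
      using not_less_Least[OF \<open>i < m\<close>[unfolded m_def]] that by blast
  qed
  define E where "E = {\<xi> \<in> sphere 0 1. F m \<xi> = 0}"
  have "finite E"
  proof (cases "F m constant_on ring")
    case True
    then have "E = {}" using \<xi>1 sphere_ring unfolding constant_on_def E_def
      by (metis (mono_tags, lifting) Collect_empty_eq dist_0_norm mem_sphere subsetD)
    then show ?thesis by simp
  next
    case False
    then show ?thesis unfolding E_def
      by (intro holomorphic_compact_finite_zeros[OF F_holomorphic open_ring connected_ring _ sphere_ring]) simp_all
  qed
  moreover have "eventually (\<lambda>(l, w). p l w = 0 \<longrightarrow> f l = w) (nhds (\<xi>, f \<xi>))" if \<xi>: "norm \<xi> = 1" "\<xi> \<notin> E" for \<xi>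
  proof -
    have \<xi>r: "\<xi> \<in> ring" using \<xi>(1) sphere_ring by auto
    define e where "e = norm (F m \<xi>) / 2"
    have e: "e > 0" "e < norm (F m \<xi>)" using \<xi> by (simp_all add: e_def E_def)
    define B where "B = norm (pd (Suc m) \<xi> (f \<xi>)) + 1"
    have B: "B > 0" by (simp add: B_def add_nonneg_pos)
    have fc: "isCont f \<xi>"
      using holomorphic_on_imp_continuous_on[OF f_holomorphic] open_ring \<xi>r continuous_on_eq_continuous_at by blast
    have Fc: "isCont (F m) \<xi>"
      using holomorphic_on_imp_continuous_on[OF F_holomorphic] open_ring \<xi>r continuous_on_eq_continuous_at by blast
    have "isCont (\<lambda>x. norm (pd (Suc m) (fst x) (snd x))) (\<xi>, f \<xi>)"
      by (rule isCont_norm[OF continuous_pd])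
    then have "\<forall>\<^sub>F x in nhds (\<xi>, f \<xi>). norm (pd (Suc m) (fst x) (snd x)) < B"
      by (rule order_tendstoD(2)[OF isCont_tendsto_nhds]) (simp add: B_def)
    then obtain Q R where Q: "eventually Q (nhds \<xi>)" and R: "eventually R (nhds (f \<xi>))"
      and QR: "\<And>l w. Q l \<Longrightarrow> R w \<Longrightarrow> norm (pd (Suc m) l w) < B"
      unfolding nhds_prod eventually_prod_filter by auto
    obtain \<rho> where \<rho>: "\<rho> > 0" "\<And>w. dist w (f \<xi>) < \<rho> \<Longrightarrow> R w" using R unfolding eventually_nhds_metric by blast
    \<comment> \<open>Both \<open>f l\<close> and \<open>w\<close> will lie within \<sigma> of
      \<open>f \<xi>\<close>, hence within \<open>2 * \<sigma>\<close> of each other, and then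
      \<open>B * norm (w - f l) \<le> e < norm (F m l)\<close> contradicts Taylor's
      estimate.\<close>
    define \<sigma> where "\<sigma> = min \<rho> (e / (2 * B))"
    have \<sigma>: "\<sigma> > 0" "\<sigma> \<le> \<rho>" "2 * B * \<sigma> \<le> e"
    proof -
      show "\<sigma> > 0" "\<sigma> \<le> \<rho>" using \<rho>(1) e(1) B by (simp_all add: \<sigma>_def)
      have "\<sigma> \<le> e / (2 * B)" by (simp add: \<sigma>_def)
      then show "2 * B * \<sigma> \<le> e" using B by (simp add: field_simps)
    qed
    have "\<forall>\<^sub>F l in nhds \<xi>. dist (f l) (f \<xi>) < \<sigma>"
      by (rule tendstoD[OF isCont_tendsto_nhds[OF fc] \<sigma>(1)])
    moreover have "\<forall>\<^sub>F l in nhds \<xi>. e < norm (F m l)"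
      by (rule order_tendstoD(1)[OF isCont_tendsto_nhds[OF isCont_norm[OF Fc]] e(2)])
    moreover have "\<forall>\<^sub>F l in nhds \<xi>. l \<in> ring"
      using open_ring \<xi>r by (rule eventually_nhds_in_open)
    ultimately have L: "\<forall>\<^sub>F l in nhds \<xi>. dist (f l) (f \<xi>) < \<sigma> \<and> e < norm (F m l) \<and> l \<in> ring \<and> Q l"
      using Q by eventually_elim auto
    have W: "\<forall>\<^sub>F w in nhds (f \<xi>). dist w (f \<xi>) < \<sigma>"
      using \<sigma>(1) by (auto simp: eventually_nhds_metric)
    show ?thesis
      unfolding nhds_prod eventually_prod_filter
    proof (intro exI conjI, rule L, rule W, intro allI impI, clarify)
      fix l w assume l: "dist (f l) (f \<xi>) < \<sigma>" "e < norm (F m l)" "l \<in> ring" "Q l"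
        and w: "dist w (f \<xi>) < \<sigma>" and "p l w = 0"
      show "f l = w"
      proof (rule ccontr)
        assume ne: "f l \<noteq> w"
        have "norm (pd 0 l w - (\<Sum>i\<le>m. pd i l (f l) * (w - f l) ^ i / fact i)) \<le> B * norm (w - f l) ^ Suc m / fact m"
        proof (rule complex_Taylor[of "ball (f \<xi>) \<sigma>"])
          show "norm (pd (Suc m) l x) \<le> B" if "x \<in> ball (f \<xi>) \<sigma>" for x
            using QR[OF l(4) \<rho>(2), of x] that \<sigma>(2) by (simp add: dist_commute less_imp_le)
        qed (use l w pd_has_field_derivative in \<open>auto simp: dist_commute\<close>)
        moreover have "(\<Sum>i\<le>m. pd i l (f l) * (w - f l) ^ i / fact i) = F m l * (w - f l) ^ m / fact m"
        proof -
          have "(\<Sum>i<m. pd i l (f l) * (w - f l) ^ i / fact i) = 0"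
            using low[OF _ l(3)] by (intro sum.neutral) (simp add: F_def)
          then show ?thesis by (simp add: lessThan_Suc_atMost[symmetric] F_def)
        qed
        ultimately have "norm (F m l) * norm (w - f l) ^ m / fact m \<le> B * norm (w - f l) ^ Suc m / fact m"
          using \<open>p l w = 0\<close> by (simp add: pd_0 norm_mult norm_power norm_divide)
        then have "norm (F m l) * norm (w - f l) ^ m \<le> (B * norm (w - f l)) * norm (w - f l) ^ m"
          by (simp add: divide_le_cancel mult_ac)
        then have "norm (F m l) \<le> B * norm (w - f l)"
          using ne by (simp add: mult_le_cancel_right)
        also have "\<dots> \<le> B * (2 * \<sigma>)"
          using l(1) w B by (intro mult_left_mono) (smt (verit) dist_norm dist_triangle2, simp)
        also have "\<dots> \<le> e" using \<sigma>(3) by (simp add: mult_ac)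
        finally show False using l(2) by simp
      qed
    qed
  qed
  ultimately show ?thesis by (rule that)
qed

end

section \<open>Crossing a dispersion curve\<close>

text \<open>If \<open>u\<close> is within half its own length of a positive real, then
  \<open>Re u > 0\<close>.\<close>

lemma norm_gt_1_of_near_pos:
  fixes u :: complex
  assumes "0 < \<tau>" "norm (of_real \<tau> - u) \<le> norm u / 2"
  shows "1 < norm (1 + u)"
proof -
  have "(norm (of_real \<tau> - u))\<^sup>2 \<le> (norm u / 2)\<^sup>2" using assms(2) by (rule power_mono) simp
  then have "(\<tau> - Re u)\<^sup>2 + (Im u)\<^sup>2 \<le> ((Re u)\<^sup>2 + (Im u)\<^sup>2) / 4"
    unfolding power_divide cmod_power2 by simp
  then have "\<tau>\<^sup>2 + 3/4 * ((Re u)\<^sup>2 + (Im u)\<^sup>2) \<le> 2 * \<tau> * Re u"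
    by (simp add: power2_diff field_simps)
  moreover have "0 < \<tau>\<^sup>2 + 3/4 * ((Re u)\<^sup>2 + (Im u)\<^sup>2)"
    using assms(1) by (intro add_pos_nonneg mult_nonneg_nonneg sum_power2_ge_zero) simp_all
  ultimately have "0 < 2 * \<tau> * Re u" by (rule order.strict_trans2[rotated])
  then have "0 < Re u" using assms(1) by (simp add: zero_less_mult_iff)
  then have "1 < Re (1 + u)" by simp
  also have "\<dots> \<le> norm (1 + u)" by (rule complex_Re_le_cmod)
  finally show ?thesis .
qed

text \<open>Here a negative real part is not enough: the squared modulus is
  \<open>1 + 2 * Re u + q\<close>, so \<open>Re u\<close> has to outweigh the quadratic term, which
  is why \<open>u\<close> must also be small.\<close>

lemma norm_less_1_of_near_neg:
  fixes u :: complex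
  assumes "0 < \<tau>" "norm (- of_real \<tau> - u) \<le> norm u / 2" "norm u < 1"
  shows "norm (1 + u) < 1"
proof -
  define q where "q = (Re u)\<^sup>2 + (Im u)\<^sup>2"
  have q: "0 \<le> q" "q < 1"
  proof -
    show "0 \<le> q" by (simp add: q_def)
    have "(norm u)\<^sup>2 < 1" using assms(3) by (simp add: abs_square_less_1)
    then show "q < 1" unfolding cmod_power2 q_def .
  qed
  have "(norm (- of_real \<tau> - u))\<^sup>2 \<le> (norm u / 2)\<^sup>2" using assms(2) by (rule power_mono) simp
  then have "(- \<tau> - Re u)\<^sup>2 + (Im u)\<^sup>2 \<le> ((Re u)\<^sup>2 + (Im u)\<^sup>2) / 4"
    unfolding power_divide cmod_power2 by simp
  then have 1: "\<tau>\<^sup>2 + 3/4 * q \<le> \<tau> * (- 2 * Re u)"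
    unfolding q_def by (simp add: power2_eq_square algebra_simps)
  have "2 * Re u + q < 0"
  proof (rule ccontr)
    assume "\<not> ?thesis"
    then have "\<tau> * (- 2 * Re u) \<le> \<tau> * q" using assms(1) by (intro mult_left_mono) auto
    then have "\<tau>\<^sup>2 + 3/4 * q \<le> \<tau> * q" using 1 by linarith
    \<comment> \<open>Completing the square; since \<open>q * q \<le> q\<close>, the second bracket
      is at least \<open>q / 2\<close>, which forces \<open>q = 0\<close>.\<close>
    then have "(\<tau> - q / 2)\<^sup>2 + (3/4 * q - q * q / 4) \<le> 0"
      by (simp add: power2_eq_square algebra_simps)
    moreover have "q * q \<le> q" using q by (simp add: mult_left_le)
    moreover have "(\<tau> - q / 2)\<^sup>2 \<ge> 0" by simp
    ultimately have "q = 0" using q(1) by linarith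
    then show False using \<open>\<tau>\<^sup>2 + 3/4 * q \<le> \<tau> * q\<close> assms(1) by simp
  qed
  then have "(norm (1 + u))\<^sup>2 < 1"
    unfolding cmod_power2 q_def by (simp add: power2_eq_square algebra_simps)
  then show ?thesis by (simp add: abs_square_less_1)
qed

text \<open>In the relative coordinate \<open>u = (l - \<xi>) / \<xi>\<close> the function is
  \<open>f \<xi> + a * u\<close> to first order with \<open>a = D * \<xi>\<close>. A shift of the
  value along \<open>sgn a\<close> therefore moves \<open>u\<close> along the positive real axis,
  that is, \<open>l\<close> radially outwards.\<close>

lemma crossing_direction:
  fixes f :: "complex \<Rightarrow> complex"
  assumes "(f has_field_derivative D) (at \<xi>)" "norm \<xi> = 1" "D \<noteq> 0" and v: "v = sgn (D * \<xi>)"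
  shows "\<forall>\<^sub>F l in nhds \<xi>. \<forall>t>0. (f l = f \<xi> + of_real t * v \<longrightarrow> 1 < norm l) \<and>
    (f l = f \<xi> - of_real t * v \<longrightarrow> norm l < 1)"
proof -
  have "\<xi> \<noteq> 0" using assms(2) by auto
  obtain \<delta> where \<delta>: "\<delta> > 0" "\<And>l. norm (l - \<xi>) < \<delta> \<Longrightarrow> norm (f l - f \<xi> - D * (l - \<xi>)) \<le> norm D / 2 * norm (l - \<xi>)"
    using assms(1,3) unfolding has_field_derivative_def has_derivative_at_alt
    by (metis half_gt_zero zero_less_norm_iff)
  define a where "a = D * \<xi>"
  have a: "a \<noteq> 0" "norm a = norm D" using assms(2,3) \<open>\<xi> \<noteq> 0\<close> by (auto simp: a_def norm_mult)
  have av: "a = of_real (norm a) * v" using a(1) by (simp add: v a_def[symmetric] sgn_div_norm scaleR_conv_of_real)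
  have v1: "norm v = 1" using a(1) by (simp add: v a_def[symmetric] norm_sgn)
  show ?thesis
    unfolding eventually_nhds_metric
  proof (intro exI[of _ "min \<delta> 1"] conjI allI impI)
    fix l and t :: real assume "dist l \<xi> < min \<delta> 1" "0 < t"
    then have l: "norm (l - \<xi>) < \<delta>" "norm (l - \<xi>) < 1" by (simp_all add: dist_norm)
    define u where "u = (l - \<xi>) / \<xi>"
    have u: "D * (l - \<xi>) = a * u" "norm u = norm (l - \<xi>)" "l = \<xi> * (1 + u)"
      using \<open>\<xi> \<noteq> 0\<close> assms(2) by (simp_all add: u_def a_def norm_divide field_simps)
    have nl: "norm l = norm (1 + u)" by (subst u(3)) (simp add: norm_mult assms(2))
    define \<tau> where "\<tau> = t / norm a"
    have \<tau>: "\<tau> > 0" using \<open>0 < t\<close> a(1) by (simp add: \<tau>_def)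
    have key: "norm (of_real s * of_real \<tau> - u) \<le> norm u / 2" if "f l = f \<xi> + of_real s * (of_real t * v)" for s :: real
    proof -
      have "f l - f \<xi> - D * (l - \<xi>) = of_real (norm a) * v * (of_real s * of_real \<tau> - u)"
        using that a(1) by (subst u(1), subst av) (simp add: \<tau>_def field_simps)
      then have "norm (f l - f \<xi> - D * (l - \<xi>)) = norm a * norm (of_real s * of_real \<tau> - u)"
        by (simp add: norm_mult v1)
      then have "norm a * norm (of_real s * of_real \<tau> - u) \<le> norm a * (norm u / 2)"
        using \<delta>(2)[OF l(1)] a(2) u(2) by simp
      then show ?thesis using a(1) by (simp add: mult_le_cancel_left)
    qed
    show "1 < norm l" if "f l = f \<xi> + of_real t * v"
      unfolding nl using key[of 1] that \<tau> by (intro norm_gt_1_of_near_pos[of \<tau>]) simp_all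
    show "norm l < 1" if "f l = f \<xi> - of_real t * v"
      unfolding nl using key[of "-1"] that \<tau> l(2) u(2) by (intro norm_less_1_of_near_neg[of \<tau>]) simp_all
  qed (use \<delta>(1) in simp)
qed

section \<open>Eigenvalue count and winding number across one point of the curve\<close>

context char_family
begin

lemma winding_p_nearby:
  assumes "\<And>l. norm l = \<rho> \<Longrightarrow> p l \<zeta> \<noteq> 0" "0 \<le> \<rho>"
  shows "\<forall>\<^sub>F w in nhds \<zeta>. circle_winding (\<lambda>l. p l w) \<rho> = circle_winding (\<lambda>l. p l \<zeta>) \<rho>"
proof -
  have "\<forall>\<^sub>F w in nhds \<zeta>. \<forall>l\<in>sphere 0 \<rho>. (\<lambda>(w, l). norm (p l w - p l \<zeta>) < norm (p l \<zeta>)) (w, l)"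
  proof (rule eventually_compact_uniform)
    fix l0 :: complex assume "l0 \<in> sphere 0 \<rho>"
    then have "norm (p l0 \<zeta>) > 0" using assms(1)[of l0] by simp
    moreover have "isCont (\<lambda>x. norm (p (snd x) \<zeta>) - norm (p (snd x) (fst x) - p (snd x) \<zeta>)) (\<zeta>, l0)"
      by (intro continuous_intros isCont_p)
    then have "((\<lambda>x. norm (p (snd x) \<zeta>) - norm (p (snd x) (fst x) - p (snd x) \<zeta>)) \<longlongrightarrow> norm (p l0 \<zeta>)) (nhds (\<zeta>, l0))"
      using isCont_tendsto_nhds by fastforce
    ultimately have "\<forall>\<^sub>F x in nhds (\<zeta>, l0). 0 < norm (p (snd x) \<zeta>) - norm (p (snd x) (fst x) - p (snd x) \<zeta>)"
      by (intro order_tendstoD(1))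
    then show "eventually (\<lambda>(w, l). norm (p l w - p l \<zeta>) < norm (p l \<zeta>)) (nhds \<zeta> \<times>\<^sub>F nhds l0)"
      unfolding nhds_prod by (rule eventually_mono) auto
  qed simp
  then show ?thesis
  proof eventually_elim
    case (elim w)
    have "circle_winding (\<lambda>l. p l \<zeta>) \<rho> = circle_winding (\<lambda>l. p l w) \<rho>"
      using elim assms(2) by (intro circle_winding_nearby continuous_on_p) auto
    then show ?case by simp
  qed
qed

end

text \<open>The closed annulus of half-width \<eta> isolates the unit roots over \<zeta>, so neither
  boundary circle carries a root. One direction \<open>v\<close> serves all these roots: this
  encodes that they cross in the same sense.\<close>

locale crossing = char_family +
  fixes \<zeta> v :: complex and \<eta> :: real
  assumes \<eta>: "0 < \<eta>" "\<eta> < r"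
    and roots: "\<And>l. 1 - \<eta> \<le> norm l \<Longrightarrow> norm l \<le> 1 + \<eta> \<Longrightarrow> p l \<zeta> = 0 \<Longrightarrow>
      norm l = 1 \<and> f l = \<zeta> \<and> deriv f l \<noteq> 0 \<and> v = sgn (deriv f l * l) \<and>
      eventually (\<lambda>(l, w). p l w = 0 \<longrightarrow> f l = w) (nhds (l, f l))"
begin

lemma isCont_line: "isCont (\<lambda>x. \<zeta> + of_real s * of_real (fst x) * v) y"
  by (intro continuous_intros)

lemma line_tendsto: "((\<lambda>t. \<zeta> + of_real s * of_real t * v) \<longlongrightarrow> \<zeta>) (at_right 0)"
  by (auto intro!: tendsto_eq_intros)

lemma eventually_line:
  assumes "eventually P (nhds \<zeta>)"
  shows "\<forall>\<^sub>F t in at_right 0. P (\<zeta> + of_real t * v) \<and> P (\<zeta> - of_real t * v)"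
  using eventually_compose_filterlim[OF assms line_tendsto[of 1]]
    eventually_compose_filterlim[OF assms line_tendsto[of "-1"]]
  by eventually_elim simp

text \<open>Compactness of the annulus reduces the claim to a neighbourhood of one point
  \<open>l0\<close>. If \<open>p l0 \<zeta> \<noteq> 0\<close>, no root appears there for small
  \<open>t\<close>; at a root, all nearby roots lie on the graph of \<open>f\<close>, and
  \<open>crossing_direction\<close> decides their side.\<close>

lemma roots_move:
  "\<forall>\<^sub>F t in at_right 0. \<forall>l\<in>{l. 1 - \<eta> \<le> norm l \<and> norm l \<le> 1 + \<eta>}.
    (p l (\<zeta> + of_real t * v) = 0 \<longrightarrow> 1 < norm l) \<and> (p l (\<zeta> - of_real t * v) = 0 \<longrightarrow> norm l < 1)"
proof -
  let ?K = "{l::complex. 1 - \<eta> \<le> norm l \<and> norm l \<le> 1 + \<eta>}"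
  let ?w = "\<lambda>s x. \<zeta> + of_real s * of_real (fst x) * v"
  have K: "compact ?K"
  proof -
    have "?K = cball 0 (1 + \<eta>) \<inter> {l. 1 - \<eta> \<le> norm l}" by auto
    then show ?thesis by (simp add: compact_Int_closed closed_Collect_le continuous_on_norm_id)
  qed
  have le: "at_right (0::real) \<times>\<^sub>F nhds l0 \<le> nhds (0, l0)" for l0 :: complex
    unfolding nhds_prod by (intro prod_filter_mono) (simp_all add: at_within_le_nhds)
  have "\<forall>\<^sub>F t in at_right 0. \<forall>l\<in>?K. (\<lambda>x. (p (snd x) (?w 1 x) = 0 \<longrightarrow> 1 < norm (snd x)) \<and>
      (p (snd x) (?w (-1) x) = 0 \<longrightarrow> norm (snd x) < 1)) (t, l)"
  proof (rule eventually_compact_uniform[OF K])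
    fix l0 assume l0: "l0 \<in> ?K"
    show "\<forall>\<^sub>F x in at_right 0 \<times>\<^sub>F nhds l0. (p (snd x) (?w 1 x) = 0 \<longrightarrow> 1 < norm (snd x)) \<and>
      (p (snd x) (?w (-1) x) = 0 \<longrightarrow> norm (snd x) < 1)"
    proof (cases "p l0 \<zeta> = 0")
      case False
      have "\<forall>\<^sub>F x in nhds (0, l0). p (snd x) (?w s x) \<noteq> 0" for s
      proof -
        have "isCont (\<lambda>x. p (snd x) (?w s x)) (0, l0)" by (intro isCont_p isCont_line continuous_intros)
        then have "((\<lambda>x. p (snd x) (?w s x)) \<longlongrightarrow> p l0 \<zeta>) (nhds (0, l0))"
          using isCont_tendsto_nhds by fastforce
        then show ?thesis using False by (rule tendsto_imp_eventually_ne)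
      qed
      then have "\<forall>\<^sub>F x in nhds (0, l0). p (snd x) (?w 1 x) \<noteq> 0 \<and> p (snd x) (?w (-1) x) \<noteq> 0"
        by (intro eventually_conj)
      then have "\<forall>\<^sub>F x in at_right 0 \<times>\<^sub>F nhds l0. p (snd x) (?w 1 x) \<noteq> 0 \<and> p (snd x) (?w (-1) x) \<noteq> 0"
        by (rule filter_leD[OF le])
      then show ?thesis by eventually_elim blast
    next
      case True
      have r0: "norm l0 = 1" "f l0 = \<zeta>" "deriv f l0 \<noteq> 0" "v = sgn (deriv f l0 * l0)"
        "eventually (\<lambda>(l, w). p l w = 0 \<longrightarrow> f l = w) (nhds (l0, f l0))"
        using roots[of l0] l0 True by auto
      have "\<forall>\<^sub>F x in nhds (0, l0). p (snd x) (?w s x) = 0 \<longrightarrow> f (snd x) = ?w s x" for s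
      proof -
        have "isCont (\<lambda>x. (snd x, ?w s x)) (0, l0)" by (intro isCont_line continuous_intros)
        then have "((\<lambda>x. (snd x, ?w s x)) \<longlongrightarrow> (l0, f l0)) (nhds (0, l0))"
          using isCont_tendsto_nhds r0(2) by fastforce
        then show ?thesis using eventually_compose_filterlim[OF r0(5)] by fastforce
      qed
      then have "\<forall>\<^sub>F x in nhds (0, l0). (p (snd x) (?w 1 x) = 0 \<longrightarrow> f (snd x) = ?w 1 x) \<and>
          (p (snd x) (?w (-1) x) = 0 \<longrightarrow> f (snd x) = ?w (-1) x)"
        by (intro eventually_conj)
      then have 1: "\<forall>\<^sub>F x in at_right 0 \<times>\<^sub>F nhds l0. (p (snd x) (?w 1 x) = 0 \<longrightarrow> f (snd x) = ?w 1 x) \<and>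
          (p (snd x) (?w (-1) x) = 0 \<longrightarrow> f (snd x) = ?w (-1) x)"
        by (rule filter_leD[OF le])
      have "(f has_field_derivative deriv f l0) (at l0)"
        using holomorphic_derivI[OF f_holomorphic open_ring, of l0] r0(1) sphere_ring by auto
      from crossing_direction[OF this r0(1,3,4)]
      have 2: "\<forall>\<^sub>F x in at_right (0::real) \<times>\<^sub>F nhds l0. \<forall>t>0. (f (snd x) = f l0 + of_real t * v \<longrightarrow> 1 < norm (snd x)) \<and>
         (f (snd x) = f l0 - of_real t * v \<longrightarrow> norm (snd x) < 1)"
        by (rule eventually_compose_filterlim[OF _ filterlim_snd])
      have "eventually (\<lambda>t::real. 0 < t) (at_right 0)" by (rule eventually_at_right_less)
      then have 3: "\<forall>\<^sub>F x in at_right (0::real) \<times>\<^sub>F nhds l0. 0 < fst x"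
        by (rule eventually_compose_filterlim[OF _ filterlim_fst])
      from 1 2 3 show ?thesis
      proof eventually_elim
        case (elim x)
        have "1 < norm (snd x)" if "p (snd x) (?w 1 x) = 0"
          using elim(1) elim(2)[rule_format, OF elim(3)] that r0(2) by simp
        moreover have "norm (snd x) < 1" if "p (snd x) (?w (-1) x) = 0"
          using elim(1) elim(2)[rule_format, OF elim(3)] that r0(2) by simp
        ultimately show ?case by blast
      qed
    qed
  qed
  then show ?thesis by simp
qed

lemma p_circle_ne_0: "\<rho> \<in> {1 - \<eta>, 1 + \<eta>} \<Longrightarrow> norm l = \<rho> \<Longrightarrow> p l \<zeta> \<noteq> 0"
  using roots[of l] \<eta> by auto

text \<open>The counts inside radius \<open>1 - \<eta>\<close> and inside radius
  \<open>1 + \<eta>\<close> are stable under small shifts. After a forward shift the annulus has no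
  root of modulus at most 1, so the disc keeps only the inner roots; after a backward shift it has
  none of modulus at least 1, so the disc also holds the former unit roots.\<close>

lemma root_count_jump:
  assumes E: "\<And>l w. p l w = (\<Prod>a\<in>#E w. l - a)"
  shows "\<forall>\<^sub>F t in at_right 0.
    size {#a \<in># E (\<zeta> + of_real t * v). norm a < 1#} = size {#a \<in># E \<zeta>. norm a < 1#} \<and>
    size {#a \<in># E (\<zeta> - of_real t * v). norm a < 1#} = size {#a \<in># E \<zeta>. norm a \<le> 1#}"
proof -
  have root: "p a w = 0" if "a \<in># E w" for a w
    using that unfolding E by (auto simp: prod_mset_zero_iff)
  have count: "size {#a \<in># E w. norm a < \<rho>#} = size {#a \<in># E \<zeta>. norm a < \<rho>#}"
    if w: "circle_winding (\<lambda>l. p l w) \<rho> = circle_winding (\<lambda>l. p l \<zeta>) \<rho>" and \<rho>: "\<rho> \<in> {1 - \<eta>, 1 + \<eta>}"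
      and ne: "\<And>a. a \<in># E w \<Longrightarrow> norm a \<noteq> \<rho>" for w \<rho>
  proof -
    have "0 < \<rho>" using \<rho> \<eta> r by auto
    have "norm a \<noteq> \<rho>" if "a \<in># E \<zeta>" for a using root[OF that] p_circle_ne_0[OF \<rho>] by blast
    then have "(of_nat (size {#a \<in># E w. norm a < \<rho>#}) :: complex) = of_nat (size {#a \<in># E \<zeta>. norm a < \<rho>#})"
      using circle_winding_roots[OF \<open>0 < \<rho>\<close>, of "E w"] circle_winding_roots[OF \<open>0 < \<rho>\<close>, of "E \<zeta>"] w ne
      by (simp add: E)
    then show ?thesis by (simp only: of_nat_eq_iff)
  qed
  have "\<forall>\<^sub>F w in nhds \<zeta>. circle_winding (\<lambda>l. p l w) (1 - \<eta>) = circle_winding (\<lambda>l. p l \<zeta>) (1 - \<eta>)"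
    using \<eta> r by (intro winding_p_nearby p_circle_ne_0) auto
  moreover have "\<forall>\<^sub>F w in nhds \<zeta>. circle_winding (\<lambda>l. p l w) (1 + \<eta>) = circle_winding (\<lambda>l. p l \<zeta>) (1 + \<eta>)"
    using \<eta> by (intro winding_p_nearby p_circle_ne_0) auto
  ultimately have "\<forall>\<^sub>F w in nhds \<zeta>. circle_winding (\<lambda>l. p l w) (1 - \<eta>) = circle_winding (\<lambda>l. p l \<zeta>) (1 - \<eta>) \<and>
      circle_winding (\<lambda>l. p l w) (1 + \<eta>) = circle_winding (\<lambda>l. p l \<zeta>) (1 + \<eta>)"
    by (rule eventually_conj)
  from eventually_line[OF this] roots_move show ?thesis
  proof eventually_elim
    case (elim t)
    let ?a = "\<zeta> + of_real t * v" and ?b = "\<zeta> - of_real t * v"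
    have a: "norm l < 1 - \<eta> \<or> 1 + \<eta> < norm l \<or> 1 < norm l" if "l \<in># E ?a" for l
      using elim(2) root[OF that] by force
    have b: "norm l < 1 - \<eta> \<or> 1 + \<eta> < norm l \<or> norm l < 1" if "l \<in># E ?b" for l
      using elim(2) root[OF that] by force
    have z: "norm l < 1 - \<eta> \<or> 1 + \<eta> < norm l \<or> norm l = 1" if "l \<in># E \<zeta>" for l
      using roots[of l] root[OF that] by force
    have "size {#a \<in># E ?a. norm a < 1#} = size {#a \<in># E ?a. norm a < 1 - \<eta>#}"
      using a \<eta>(1) by (intro arg_cong[of _ _ size] filter_mset_cong refl) force
    also have "\<dots> = size {#a \<in># E \<zeta>. norm a < 1 - \<eta>#}"
      using a elim(1) \<eta>(1) by (intro count) force+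
    also have "\<dots> = size {#a \<in># E \<zeta>. norm a < 1#}"
      using z \<eta>(1) by (intro arg_cong[of _ _ size] filter_mset_cong refl) force
    finally have 1: "size {#a \<in># E ?a. norm a < 1#} = size {#a \<in># E \<zeta>. norm a < 1#}" .
    have "size {#a \<in># E ?b. norm a < 1#} = size {#a \<in># E ?b. norm a < 1 + \<eta>#}"
      using b \<eta>(1) by (intro arg_cong[of _ _ size] filter_mset_cong refl) force
    also have "\<dots> = size {#a \<in># E \<zeta>. norm a < 1 + \<eta>#}"
      using b elim(1) \<eta>(1) by (intro count) force+
    also have "\<dots> = size {#a \<in># E \<zeta>. norm a \<le> 1#}"
      using z \<eta>(1) by (intro arg_cong[of _ _ size] filter_mset_cong refl) force
    finally show ?case using 1 by blast
  qed
qed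

text \<open>On the annulus \<open>f l - \<zeta> = (l - \<xi>) * q l\<close> with a zero-free
  \<open>q\<close>, so the winding numbers on the two boundary circles differ by 1. For a shifted
  value the unit circle is deformed to one of them through the half of the annulus that holds no
  roots.\<close>

lemma winding_jump:
  assumes \<xi>: "norm \<xi> = 1" "f \<xi> = \<zeta>" and unique: "\<And>l. norm l = 1 \<Longrightarrow> f l = \<zeta> \<Longrightarrow> l = \<xi>"
  shows "\<forall>\<^sub>F t in at_right 0. circle_winding (\<lambda>l. f l - (\<zeta> - of_real t * v)) 1 =
    circle_winding (\<lambda>l. f l - (\<zeta> + of_real t * v)) 1 + 1"
proof -
  let ?K = "{l::complex. 1 - \<eta> \<le> norm l \<and> norm l \<le> 1 + \<eta>}"
  have Kr: "?K \<subseteq> ring" using \<eta> by (auto simp: ring_def)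
  have fK: "continuous_on ?K f"
    using holomorphic_on_imp_continuous_on[OF f_holomorphic] Kr by (rule continuous_on_subset)
  have f0: "p l w = 0" if "l \<in> ?K" "f l = w" for l w using p_f_eq_0[of l] Kr that by auto
  have sph: "sphere 0 \<rho> \<subseteq> ?K" if "\<rho> \<in> {1 - \<eta>, 1, 1 + \<eta>}" for \<rho> using that \<eta> by auto
  have nearby: "\<forall>\<^sub>F w in nhds \<zeta>. circle_winding (\<lambda>l. f l - w) \<rho> = circle_winding (\<lambda>l. f l - \<zeta>) \<rho>"
    if \<rho>: "\<rho> \<in> {1 - \<eta>, 1 + \<eta>}" for \<rho>
  proof -
    have \<rho>0: "0 \<le> \<rho>" using \<rho> \<eta> r by auto
    have f\<rho>: "continuous_on (sphere 0 \<rho>) f" using fK sph[of \<rho>] \<rho> by (auto intro: continuous_on_subset)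
    have "closed (f ` sphere 0 \<rho>)"
      by (intro compact_imp_closed compact_continuous_image f\<rho>) simp
    moreover have "\<zeta> \<notin> f ` sphere 0 \<rho>"
      using f0 p_circle_ne_0[OF \<rho>] sph[of \<rho>] \<rho> by fastforce
    ultimately obtain e where e: "e > 0" "\<And>x. x \<in> f ` sphere 0 \<rho> \<Longrightarrow> e \<le> dist \<zeta> x"
      using separate_point_closed by metis
    have "\<forall>\<^sub>F w in nhds \<zeta>. dist w \<zeta> < e" using e(1) by (auto simp: eventually_nhds_metric)
    then show ?thesis
    proof eventually_elim
      case (elim w)
      have "circle_winding (\<lambda>l. f l - \<zeta>) \<rho> = circle_winding (\<lambda>l. f l - w) \<rho>"
      proof (rule circle_winding_nearby)
        show "norm (f l - w - (f l - \<zeta>)) < norm (f l - \<zeta>)" if "norm l = \<rho>" for l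
          using e(2)[of "f l"] elim that by (simp add: dist_norm norm_minus_commute)
      qed (use f\<rho> \<rho>0 in \<open>auto intro!: continuous_intros\<close>)
      then show ?case by simp
    qed
  qed
  define q where "q l = (if l = \<xi> then deriv f \<xi> else (f l - \<zeta>) / (l - \<xi>))" for l
  have \<xi>K: "\<xi> \<in> ?K" using \<xi>(1) \<eta> by auto
  have f\<xi>: "(f has_field_derivative deriv f \<xi>) (at \<xi>)"
    using holomorphic_derivI[OF f_holomorphic open_ring, of \<xi>] Kr \<xi>K by blast
  have q_ne: "q l \<noteq> 0" if "l \<in> ?K" for l
  proof (cases "l = \<xi>")
    case True
    then show ?thesis using roots[of \<xi>] \<xi>K f0[OF \<xi>K \<xi>(2)] by (simp add: q_def)
  next
    case False
    have "f l \<noteq> \<zeta>" using roots[of l] f0[OF that] that unique[of l] False by auto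
    then show ?thesis using False by (simp add: q_def)
  qed
  have q_cont: "continuous_on ?K q"
  proof (rule continuous_on_subset[OF _ Kr], rule continuous_at_imp_continuous_on, rule ballI)
    fix l assume l: "l \<in> ring"
    show "isCont q l"
    proof (cases "l = \<xi>")
      case True
      have "((\<lambda>l. (f l - f \<xi>) / (l - \<xi>)) \<longlongrightarrow> deriv f \<xi>) (at \<xi>)"
        using f\<xi> by (simp add: has_field_derivative_iff)
      then have "(q \<longlongrightarrow> deriv f \<xi>) (at \<xi>)"
        by (rule Lim_transform_eventually) (auto simp: q_def \<xi>(2) eventually_at_filter)
      then show ?thesis using True by (simp add: isCont_def q_def)
    next
      case False
      have "isCont f l" using holomorphic_on_imp_continuous_on[OF f_holomorphic] open_ring l continuous_on_eq_continuous_at by blast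
      then have "isCont (\<lambda>l. (f l - \<zeta>) / (l - \<xi>)) l" using False by (intro continuous_intros) auto
      moreover have "\<forall>\<^sub>F l in nhds l. q l = (f l - \<zeta>) / (l - \<xi>)"
        using t1_space_nhds[OF False] by eventually_elim (simp add: q_def)
      ultimately show ?thesis by (simp add: isCont_cong)
    qed
  qed
  have fq: "f l - \<zeta> = (l - \<xi>) * q l" for l using \<xi>(2) by (simp add: q_def)
  have wf: "circle_winding (\<lambda>l. f l - \<zeta>) \<rho> = (if 1 < \<rho> then 1 else 0) + circle_winding q \<rho>"
    if \<rho>: "\<rho> \<in> {1 - \<eta>, 1 + \<eta>}" for \<rho>
  proof -
    have \<rho>0: "0 < \<rho>" "\<rho> \<noteq> 1" using \<rho> \<eta> r by auto
    have "circle_winding (\<lambda>l. f l - \<zeta>) \<rho> = circle_winding (\<lambda>l. l - \<xi>) \<rho> + circle_winding q \<rho>"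
      unfolding fq
    proof (rule circle_winding_mult)
      show "continuous_on (sphere 0 \<rho>) q" using q_cont sph[of \<rho>] \<rho> by (auto intro: continuous_on_subset)
      show "q z \<noteq> 0" if "norm z = \<rho>" for z using that \<rho> \<eta>(1) by (intro q_ne) auto
      show "z - \<xi> \<noteq> 0" if "norm z = \<rho>" for z using that \<xi>(1) \<rho>0 by auto
    qed (use \<rho>0 in \<open>auto intro!: continuous_intros\<close>)
    then show ?thesis using circle_winding_linear[of \<xi> \<rho>] \<xi>(1) \<rho>0 by simp
  qed
  have "circle_winding q (1 - \<eta>) = circle_winding q (1 + \<eta>)"
    by (rule circle_winding_radius) (use q_cont q_ne \<eta> r in auto)
  then have jump: "circle_winding (\<lambda>l. f l - \<zeta>) (1 + \<eta>) = circle_winding (\<lambda>l. f l - \<zeta>) (1 - \<eta>) + 1"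
    using wf[of "1 - \<eta>"] wf[of "1 + \<eta>"] \<eta> by simp
  have "\<forall>\<^sub>F w in nhds \<zeta>. circle_winding (\<lambda>l. f l - w) (1 - \<eta>) = circle_winding (\<lambda>l. f l - \<zeta>) (1 - \<eta>) \<and>
      circle_winding (\<lambda>l. f l - w) (1 + \<eta>) = circle_winding (\<lambda>l. f l - \<zeta>) (1 + \<eta>)"
    by (intro eventually_conj nearby) auto
  from eventually_line[OF this] roots_move show ?thesis
  proof eventually_elim
    case (elim t)
    let ?a = "\<zeta> + of_real t * v" and ?b = "\<zeta> - of_real t * v"
    have "circle_winding (\<lambda>l. f l - ?a) (1 - \<eta>) = circle_winding (\<lambda>l. f l - ?a) 1"
    proof (rule circle_winding_radius)
      show "continuous_on {z. 1 - \<eta> \<le> norm z \<and> norm z \<le> 1} (\<lambda>l. f l - ?a)"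
        using \<eta> by (intro continuous_on_diff continuous_on_const continuous_on_subset[OF fK]) auto
      show "f z - ?a \<noteq> 0" if "1 - \<eta> \<le> norm z" "norm z \<le> 1" for z
        using elim(2) f0[of z ?a] that \<eta> by force
    qed (use \<eta> r in auto)
    moreover have "circle_winding (\<lambda>l. f l - ?b) 1 = circle_winding (\<lambda>l. f l - ?b) (1 + \<eta>)"
    proof (rule circle_winding_radius)
      show "continuous_on {z. 1 \<le> norm z \<and> norm z \<le> 1 + \<eta>} (\<lambda>l. f l - ?b)"
        using \<eta> by (intro continuous_on_diff continuous_on_const continuous_on_subset[OF fK]) auto
      show "f z - ?b \<noteq> 0" if "1 \<le> norm z" "norm z \<le> 1 + \<eta>" for z
        using elim(2) f0[of z ?b] that \<eta> by force
    qed (use \<eta> in auto)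
    ultimately show ?case using elim(1) jump by simp
  qed
qed

end

section \<open>Isolated bands\<close>

lemma prod_mset_norm: "norm (\<Prod>\<^sub># E) = (\<Prod>a\<in>#E. norm a)" for E :: "complex multiset"
  by (induction E) (simp_all add: norm_mult)

lemma prod_mset_less_1:
  fixes E :: "real multiset"
  assumes "\<And>a. a \<in># E \<Longrightarrow> 0 \<le> a \<and> a < 1"
  shows "0 \<le> \<Prod>\<^sub># E \<and> (E \<noteq> {#} \<longrightarrow> \<Prod>\<^sub># E < 1)"
  using assms
proof (induction E)
  case (add a E)
  then have "0 \<le> \<Prod>\<^sub># E" "\<Prod>\<^sub># E \<le> 1" "0 \<le> a" "a < 1" by (cases "E = {#}"; force)+
  then show ?case using mult_left_le[of "\<Prod>\<^sub># E" a] by simp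
qed simp

lemma prod_mset_gt_1:
  fixes E :: "real multiset"
  assumes "\<And>a. a \<in># E \<Longrightarrow> 1 < a" "E \<noteq> {#}"
  shows "1 < \<Prod>\<^sub># E"
  using assms
proof (induction E)
  case (add a E)
  then have "1 \<le> \<Prod>\<^sub># E" and a: "1 < a" by (cases "E = {#}"; force)+
  then have "a * 1 \<le> a * \<Prod>\<^sub># E" by (intro mult_left_mono) auto
  with a have "1 < a * \<Prod>\<^sub># E" by linarith
  then show ?case by simp
qed simp

definition inner_count where
  "inner_count eps mu w = size {#l \<in># eigenvalues (monodromy eps mu w). cmod l < 1#}"

lemma charpoly_root_iff_band:
  assumes "photonic_crystal eps mu" "spectral_bands eps mu N \<omega>"
  shows "k \<in> {-pi..pi} \<Longrightarrow> poly (charpoly (monodromy eps mu w)) (cis k) = 0 \<longleftrightarrow> (\<exists>m\<in>N. \<omega> m k = w)"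
proof -
  assume k: "k \<in> {-pi..pi}"
  have "poly (charpoly (monodromy eps mu w)) (cis k) = 0 \<longleftrightarrow> w \<in> eigenfrequencies eps mu k"
    using eigenfrequencies_iff_eigenvector[OF assms(1)] eigenvector_iff_charpoly by blast
  also have "\<dots> \<longleftrightarrow> w \<in> (\<lambda>n. \<omega> n k) ` N"
    using assms(2) k by (simp add: spectral_bands_def)
  finally show ?thesis by auto
qed

lemma unit_circle_cis:
  assumes "norm \<xi> = 1"
  obtains k where "k \<in> {-pi..pi}" "\<xi> = cis k"
proof
  have "\<xi> \<noteq> 0" using assms by auto
  then show "\<xi> = cis (Arg \<xi>)" using assms cis_Arg[of \<xi>] by (simp add: sgn_div_norm)
  show "Arg \<xi> \<in> {-pi..pi}" using Arg_bounded[of \<xi>] by auto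
qed

text \<open>In a gap no eigenvalue is unimodular, so the inner and outer counts add up to 4. The
  moduli multiply to 1, which excludes that all four lie on the same side of the circle.\<close>

lemma gap_index:
  assumes crystal: "photonic_crystal eps mu" and bands: "spectral_bands eps mu N \<omega>" and w: "w \<notin> all_curves N \<omega>"
  shows "Ind eps mu w = real (inner_count eps mu w) - 2"
    and "1 \<le> inner_count eps mu w" "inner_count eps mu w \<le> 3"
    and "poly (charpoly (monodromy eps mu w)) l = 0 \<Longrightarrow> norm l \<noteq> 1"
proof -
  let ?E = "eigenvalues (monodromy eps mu w)"
  show ne: "norm l \<noteq> 1" if l: "poly (charpoly (monodromy eps mu w)) l = 0" for l
  proof
    assume "norm l = 1"
    then obtain k where k: "k \<in> {-pi..pi}" "l = cis k" by (rule unit_circle_cis)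
    then have "\<exists>m\<in>N. \<omega> m k = w" using charpoly_root_iff_band[OF crystal bands k(1)] l by simp
    then show False using w k(1) by (auto simp: all_curves_def dispersion_curve_def)
  qed
  have part: "?E = {#l \<in># ?E. norm l < 1#} + {#l \<in># ?E. norm l > 1#}"
  proof -
    have "{#l \<in># ?E. \<not> norm l < 1#} = {#l \<in># ?E. norm l > 1#}"
      using ne by (intro filter_mset_cong refl) (force simp: in_eigenvalues_iff)
    then show ?thesis using multiset_partition[of ?E "\<lambda>l. norm l < 1"] by simp
  qed
  have size4: "size ?E = 4" by (simp add: size_eigenvalues)
  have sum4: "inner_count eps mu w + size {#l \<in># ?E. norm l > 1#} = 4"
    unfolding inner_count_def size_union[symmetric] part[symmetric] by (rule size4)
  then show "Ind eps mu w = real (inner_count eps mu w) - 2"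
    unfolding Ind_def inner_count_def by (simp add: field_simps)
  have det1: "(\<Prod>a\<in>#?E. norm a) = 1"
    using det_monodromy[OF crystal, of w] by (simp add: prod_mset_norm[symmetric] det_eq_prod_eigenvalues)
  show "inner_count eps mu w \<le> 3"
  proof (rule ccontr)
    assume "\<not> ?thesis"
    then have "size {#l \<in># ?E. norm l > 1#} = 0" using sum4 by linarith
    then have "{#l \<in># ?E. norm l > 1#} = {#}" by (simp only: size_eq_0_iff_empty)
    then have "\<And>l. l \<in># ?E \<Longrightarrow> norm l < 1" using part by (metis add.right_neutral mem_Collect_eq set_mset_filter)
    then have "(\<Prod>a\<in>#?E. norm a) < 1"
      using prod_mset_less_1[of "image_mset norm ?E"] size4 by fastforce
    then show False using det1 by simp
  qed
  show "1 \<le> inner_count eps mu w"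
  proof (rule ccontr)
    assume "\<not> ?thesis"
    then have "size {#l \<in># ?E. norm l < 1#} = 0" unfolding inner_count_def by linarith
    then have "{#l \<in># ?E. norm l < 1#} = {#}" by (simp only: size_eq_0_iff_empty)
    then have "\<And>l. l \<in># ?E \<Longrightarrow> norm l > 1" using part by (metis add.left_neutral mem_Collect_eq set_mset_filter)
    then have "1 < (\<Prod>a\<in>#?E. norm a)"
      using prod_mset_gt_1[of "image_mset norm ?E"] size4 by fastforce
    then show False using det1 by simp
  qed
qed

text \<open>\<open>gap\<close> is the source of \<open>nontrivial\<close>: at a frequency off all
  curves no eigenvalue is unimodular, so \<open>p \<xi>\<close> does not vanish there.\<close>

locale isolated_band =
  fixes eps mu :: "real \<Rightarrow> complex^2^2" and N :: "int set" and \<omega> :: "int \<Rightarrow> real \<Rightarrow> complex"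
    and n :: int and f :: "complex \<Rightarrow> complex" and r :: real
  assumes crystal: "photonic_crystal eps mu"
    and bands: "spectral_bands eps mu N \<omega>"
    and n: "n \<in> N"
    and isolated: "\<And>m. m \<in> N \<Longrightarrow> m \<noteq> n \<Longrightarrow> dispersion_curve \<omega> n \<inter> dispersion_curve \<omega> m = {}"
    and r_bounds: "0 < r" "r \<le> 1"
    and f_holomorphic_annulus: "f holomorphic_on {l. 1 - r < norm l \<and> norm l < 1 + r}"
    and extends: "\<And>k. k \<in> {-pi..pi} \<Longrightarrow> f (cis k) = \<omega> n k"
    and gap: "all_curves N \<omega> \<noteq> UNIV"
begin

lemma band_root:
  "norm \<xi> = 1 \<Longrightarrow> poly (charpoly (monodromy eps mu (f \<xi>))) \<xi> = 0"
  by (metis charpoly_root_iff_band[OF crystal bands] extends n unit_circle_cis)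

lemma poly_charpoly_monodromy:
  "poly (charpoly (monodromy eps mu w)) l = (\<Sum>k\<le>4. coeff (charpoly (monodromy eps mu w)) k * l ^ k)"
  by (simp add: poly_altdef degree_charpoly)

sublocale char_family 4 "\<lambda>k w. coeff (charpoly (monodromy eps mu w)) k" f r
proof
  show "(\<lambda>w. coeff (charpoly (monodromy eps mu w)) k) holomorphic_on UNIV" for k
    by (intro coeff_charpoly_holomorphic monodromy_entry_holomorphic[OF crystal])
  show "\<exists>w. (\<Sum>k\<le>4. coeff (charpoly (monodromy eps mu w)) k * \<xi> ^ k) \<noteq> 0" if "norm \<xi> = 1" for \<xi>
    using gap gap_index(4)[OF crystal bands] that by (metis UNIV_eq_I poly_charpoly_monodromy)
  show "(\<Sum>k\<le>4. coeff (charpoly (monodromy eps mu (f \<xi>))) k * \<xi> ^ k) = 0" if "norm \<xi> = 1" for \<xi>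
    using band_root[OF that] by (simp add: poly_charpoly_monodromy)
qed (use r_bounds f_holomorphic_annulus in auto)

lemma p_eq: "p l w = poly (charpoly (monodromy eps mu w)) l"
  by (simp add: p_def poly_charpoly_monodromy)

lemma dispersion_curve_eq: "dispersion_curve \<omega> n = f ` sphere 0 1"
proof -
  have "sphere 0 1 = cis ` {-pi..pi}"
  proof (intro equalityI subsetI)
    fix \<xi> :: complex assume "\<xi> \<in> sphere 0 1"
    then have "norm \<xi> = 1" by simp
    then show "\<xi> \<in> cis ` {-pi..pi}" by (rule unit_circle_cis) blast
  qed auto
  then show ?thesis
    unfolding dispersion_curve_def by (auto simp: image_image extends)
qed

text \<open>A root disc argument: for \<open>k\<close> near \<open>k0\<close> no band can leave a small disc around \<open>\<zeta>\<close> on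
  which \<open>p (cis k0)\<close> vanishes at most at \<open>\<zeta>\<close>, so a band that comes close to \<open>\<zeta>\<close> passes
  through \<open>\<zeta>\<close>. This needs no local finiteness of the family of bands.\<close>

lemma curve_isolated:
  assumes \<zeta>: "\<zeta> \<in> dispersion_curve \<omega> n"
  obtains \<epsilon> where "\<epsilon> > 0" "\<And>m. m \<in> N \<Longrightarrow> m \<noteq> n \<Longrightarrow> ball \<zeta> \<epsilon> \<inter> dispersion_curve \<omega> m = {}"
proof -
  \<comment> \<open>Compactness of \<open>{-pi..pi}\<close> gives one neighbourhood of \<zeta> for
    all \<open>k\<close>. The predicate repeats the membership of \<open>k\<close> because
    \<open>nhds k0\<close> also reaches outside the interval.\<close>
  have "\<forall>\<^sub>F w in nhds \<zeta>. \<forall>k\<in>{-pi..pi}. (\<lambda>(w, k). k \<in> {-pi..pi} \<longrightarrow> (\<forall>m\<in>N. m \<noteq> n \<longrightarrow> \<omega> m k \<noteq> w)) (w, k)"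
  proof (rule eventually_compact_uniform)
    fix k0 assume k0: "k0 \<in> {-pi..pi}"
    have p_holo: "p l holomorphic_on UNIV" for l
      using pd_has_field_derivative[of 0 l] unfolding pd_0 holomorphic_on_def field_differentiable_def by blast
    obtain \<beta> where \<beta>: "p (cis k0) \<beta> \<noteq> 0" using nontrivial[of "cis k0"] unfolding p_def by auto
    have "\<exists>\<rho>>0. \<forall>w\<in>ball \<zeta> \<rho> - {\<zeta>}. p (cis k0) w \<noteq> 0"
    proof (cases "p (cis k0) \<zeta> = 0")
      case True
      show ?thesis
        by (rule isolated_zeros[OF p_holo open_UNIV connected_UNIV UNIV_I True UNIV_I \<beta>]) blast
    next
      case False
      have "isCont (p (cis k0)) \<zeta>" using isCont_p[where g = "\<lambda>_. cis k0" and h = "\<lambda>w. w"] by simp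
      then have "\<forall>\<^sub>F w in nhds \<zeta>. p (cis k0) w \<noteq> 0"
        using isCont_tendsto_nhds tendsto_imp_eventually_ne False by blast
      then show ?thesis unfolding eventually_nhds_metric by (metis DiffD1 dist_commute mem_ball)
    qed
    then obtain \<rho>' where \<rho>': "\<rho>' > 0" "\<And>w. w \<in> ball \<zeta> \<rho>' - {\<zeta>} \<Longrightarrow> p (cis k0) w \<noteq> 0" by blast
    \<comment> \<open>Half the radius, so that the closed disc is still free of other zeros.\<close>
    define \<rho> where "\<rho> = \<rho>' / 2"
    have \<rho>: "\<rho> > 0" "\<rho> < \<rho>'" using \<rho>'(1) by (simp_all add: \<rho>_def)
    have only: "w = \<zeta>" if "p (cis k0) w = 0" "dist \<zeta> w \<le> \<rho>" for w
      using \<rho>'(2)[of w] that \<rho>(2) by auto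
    have "\<forall>\<^sub>F k in nhds k0. \<forall>w\<in>sphere \<zeta> \<rho>. (\<lambda>(k, w). p (cis k) w \<noteq> 0) (k, w)"
    proof (rule eventually_compact_uniform)
      fix w0 assume "w0 \<in> sphere \<zeta> \<rho>"
      then have ne: "p (cis k0) w0 \<noteq> 0" using only[of w0] \<rho>(1) by auto
      have "isCont (\<lambda>x. cis (fst x)) (k0, w0)" unfolding cis_conv_exp by (intro continuous_intros)
      then have "isCont (\<lambda>x. p (cis (fst x)) (snd x)) (k0, w0)"
        by (rule isCont_p) (intro continuous_intros)
      from isCont_tendsto_nhds[OF this]
      have "((\<lambda>x. p (cis (fst x)) (snd x)) \<longlongrightarrow> p (cis k0) w0) (nhds (k0, w0))" by simp
      then have "\<forall>\<^sub>F x in nhds (k0, w0). p (cis (fst x)) (snd x) \<noteq> 0" using ne by (rule tendsto_imp_eventually_ne)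
      then show "eventually (\<lambda>(k, w). p (cis k) w \<noteq> 0) (nhds k0 \<times>\<^sub>F nhds w0)"
        unfolding nhds_prod by (rule eventually_mono) auto
    qed simp
    then obtain \<delta> where \<delta>: "\<delta> > 0" "\<And>k w. dist k k0 < \<delta> \<Longrightarrow> w \<in> sphere \<zeta> \<rho> \<Longrightarrow> p (cis k) w \<noteq> 0"
      unfolding eventually_nhds_metric by auto
    have avoid: "\<omega> m k \<noteq> w" if "dist w \<zeta> < \<rho>" "dist k k0 < \<delta>" "k \<in> {-pi..pi}" "m \<in> N" "m \<noteq> n" for w k m
    proof
      assume "\<omega> m k = w"
      let ?I = "closed_segment k k0"
      have I: "?I \<subseteq> {-pi..pi}" using that(3) k0 by (intro closed_segment_subset) auto
      have zero: "p (cis k') (\<omega> m k') = 0" if "k' \<in> {-pi..pi}" for k'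
        using charpoly_root_iff_band[OF crystal bands that] \<open>m \<in> N\<close> by (auto simp: p_eq)
      have "continuous_on ?I (\<omega> m)"
        using bands \<open>m \<in> N\<close> I unfolding spectral_bands_def by (blast intro: continuous_on_subset)
      then have conn: "connected (\<omega> m ` ?I)" by (intro connected_continuous_image) auto
      have "\<omega> m ` ?I \<inter> frontier (ball \<zeta> \<rho>) = {}"
      proof -
        have "dist k' k0 < \<delta>" if "k' \<in> ?I" for k'
          using that \<open>dist k k0 < \<delta>\<close> dist_in_closed_segment[OF that] by (simp add: dist_commute)
        then show ?thesis using \<delta>(2) zero I \<rho>(1) by force
      qed
      moreover have "\<omega> m ` ?I \<inter> ball \<zeta> \<rho> \<noteq> {}"
        using that(1) \<open>\<omega> m k = w\<close> by (auto simp: dist_commute intro!: imageI)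
      ultimately have "\<omega> m ` ?I \<subseteq> ball \<zeta> \<rho>" using connected_Int_frontier[OF conn] by blast
      then have "\<omega> m k0 \<in> ball \<zeta> \<rho>" by auto
      then have "\<omega> m k0 = \<zeta>" using only[OF zero[OF k0]] by simp
      then have "\<zeta> \<in> dispersion_curve \<omega> m" using k0 by (auto simp: dispersion_curve_def)
      then show False using isolated[OF that(4,5)] \<zeta> by blast
    qed
    have near: "\<forall>\<^sub>F w in nhds \<zeta>. dist w \<zeta> < \<rho>" "\<forall>\<^sub>F k in nhds k0. dist k k0 < \<delta>"
      using \<rho>(1) \<delta>(1) by (auto simp: eventually_nhds_metric)
    show "eventually (\<lambda>(w, k). k \<in> {-pi..pi} \<longrightarrow> (\<forall>m\<in>N. m \<noteq> n \<longrightarrow> \<omega> m k \<noteq> w)) (nhds \<zeta> \<times>\<^sub>F nhds k0)"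
      unfolding eventually_prod_filter by (intro exI conjI, rule near(1), rule near(2)) (use avoid in auto)
  qed simp
  then obtain \<epsilon> where "\<epsilon> > 0" "\<And>w k m. dist w \<zeta> < \<epsilon> \<Longrightarrow> k \<in> {-pi..pi} \<Longrightarrow> m \<in> N \<Longrightarrow> m \<noteq> n \<Longrightarrow> \<omega> m k \<noteq> w"
    unfolding eventually_nhds_metric by auto
  then show ?thesis
    by (intro that[of \<epsilon>]) (force simp: dispersion_curve_def dist_commute)+
qed

lemma inner_count_winding:
  assumes "w \<notin> all_curves N \<omega>"
  shows "circle_winding (\<lambda>l. p l w) 1 = of_nat (inner_count eps mu w)"
proof -
  have "\<And>l. l \<in># eigenvalues (monodromy eps mu w) \<Longrightarrow> norm l \<noteq> 1"
    using gap_index(4)[OF crystal bands assms] by (simp add: in_eigenvalues_iff)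
  then show ?thesis
    using circle_winding_roots[of 1 "eigenvalues (monodromy eps mu w)"]
    by (simp add: p_eq poly_charpoly_eq_prod inner_count_def)
qed

text \<open>Off the curves the unit circle carries no root, so the count is a winding number, which
  is locally constant in the frequency.\<close>

lemma inner_count_const:
  assumes "connected A" "A \<inter> all_curves N \<omega> = {}" "a \<in> A" "b \<in> A"
  shows "inner_count eps mu a = inner_count eps mu b"
  using assms(1,3,4)
proof (rule connected_local_const)
  show "\<forall>a\<in>A. \<forall>\<^sub>F b in at a within A. inner_count eps mu a = inner_count eps mu b"
  proof
    fix a assume a: "a \<in> A"
    then have a': "a \<notin> all_curves N \<omega>" using assms(2) by blast
    have "\<forall>\<^sub>F w in nhds a. circle_winding (\<lambda>l. p l w) 1 = circle_winding (\<lambda>l. p l a) 1"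
      using gap_index(4)[OF crystal bands a'] by (intro winding_p_nearby) (auto simp: p_eq)
    then have "\<forall>\<^sub>F w in at a within A. circle_winding (\<lambda>l. p l w) 1 = circle_winding (\<lambda>l. p l a) 1"
      by (rule filter_leD[OF at_within_le_nhds])
    moreover have "\<forall>\<^sub>F w in at a within A. w \<in> A" by (simp add: eventually_at_filter)
    ultimately show "\<forall>\<^sub>F b in at a within A. inner_count eps mu a = inner_count eps mu b"
    proof eventually_elim
      case (elim w)
      then have "w \<notin> all_curves N \<omega>" using assms(2) by blast
      then have "(of_nat (inner_count eps mu w) :: complex) = of_nat (inner_count eps mu a)"
        using elim(1) inner_count_winding[OF a'] inner_count_winding[of w] by simp
      then show ?case by (simp only: of_nat_eq_iff)
    qed
  qed
qed

definition loop :: "real \<Rightarrow> complex" where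
  "loop = f \<circ> circlepath 0 1"

lemma f_analytic_sphere: "f analytic_on sphere 0 1"
  using f_holomorphic open_ring sphere_ring analytic_on_holomorphic by blast

lemma valid_path_loop: "valid_path loop"
  unfolding loop_def
  by (rule valid_path_compose_analytic[OF valid_path_circlepath f_analytic_sphere]) simp

lemma pathfinish_loop: "pathfinish loop = pathstart loop"
  by (simp add: loop_def pathfinish_compose pathstart_compose)

lemma path_image_loop: "path_image loop = dispersion_curve \<omega> n"
  by (simp add: loop_def path_image_compose dispersion_curve_eq)

lemma circle_winding_loop: "circle_winding (\<lambda>l. f l - w) 1 = winding_number loop w"
  unfolding circle_winding_def loop_def by (subst winding_number_offset) (simp add: o_def)

lemma band_winding_eq:
  assumes "w \<notin> dispersion_curve \<omega> n"
  shows "band_winding f w = winding_number loop w"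
proof -
  have "winding_number loop w = 1 / (2 * pi * \<i>) * contour_integral loop (\<lambda>z. 1 / (z - w))"
    using assms by (intro winding_number_valid_path valid_path_loop) (simp add: path_image_loop)
  also have "contour_integral loop (\<lambda>z. 1 / (z - w)) = contour_integral (circlepath 0 1) (\<lambda>z. deriv f z * (1 / (f z - w)))"
    unfolding loop_def
    by (rule contour_integral_comp_analyticW[OF f_analytic_sphere]) simp_all
  finally show ?thesis by (simp add: band_winding_def)
qed

text \<open>The count is 2 on one side and between 1 and 3 on the other, because the determinant is 1; so a
  single simple root crosses the circle.\<close>

lemma regular_crossing:
  assumes \<xi>: "norm \<xi> = 1" "f \<xi> = \<zeta>"
    and dir: "\<And>l. norm l = 1 \<Longrightarrow> f l = \<zeta> \<Longrightarrow> deriv f l \<noteq> 0 \<and> v = sgn (deriv f l * l) \<and>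
      eventually (\<lambda>(l, w). p l w = 0 \<longrightarrow> f l = w) (nhds (l, f l))"
    and off: "\<forall>\<^sub>F t in at_right 0. \<zeta> + of_real t * v \<notin> all_curves N \<omega> \<and> \<zeta> - of_real t * v \<notin> all_curves N \<omega>"
    and ind: "\<forall>\<^sub>F t in at_right 0. Ind eps mu (\<zeta> + of_real t * v) = 0 \<or> Ind eps mu (\<zeta> - of_real t * v) = 0"
  shows "\<forall>\<^sub>F t in at_right 0.
    inner_count eps mu (\<zeta> - of_real t * v) = inner_count eps mu (\<zeta> + of_real t * v) + 1 \<and>
    winding_number loop (\<zeta> - of_real t * v) = winding_number loop (\<zeta> + of_real t * v) + 1"
proof -
  let ?E = "\<lambda>w. eigenvalues (monodromy eps mu w)"
  have E: "p l w = (\<Prod>a\<in>#?E w. l - a)" for l w by (simp add: p_eq poly_charpoly_eq_prod)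
  \<comment> \<open>A unit root at \<zeta> belongs to some band through \<zeta>; isolation leaves
    only band \<open>n\<close>, so the root lies on the graph of \<open>f\<close>.\<close>
  have circ: "f l = \<zeta>" if l: "p l \<zeta> = 0" "norm l = 1" for l
  proof -
    obtain k where k: "k \<in> {-pi..pi}" "l = cis k" using l(2) by (rule unit_circle_cis)
    then obtain m where m: "m \<in> N" "\<omega> m k = \<zeta>"
      using charpoly_root_iff_band[OF crystal bands k(1), of \<zeta>] l(1) by (auto simp: p_eq)
    have "\<zeta> \<in> dispersion_curve \<omega> n" using \<xi> by (auto simp: dispersion_curve_eq)
    moreover have "\<zeta> \<in> dispersion_curve \<omega> m" using m(2) k(1) by (auto simp: dispersion_curve_def)
    ultimately have "m = n" using isolated[OF m(1)] by blast
    then show ?thesis using extends[OF k(1)] k(2) m(2) by simp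
  qed
  \<comment> \<open>The finitely many eigenvalues off the circle keep a positive distance from it,
    and \<eta> is taken below that distance.\<close>
  define A where "A = {a. a \<in># ?E \<zeta> \<and> norm a \<noteq> 1}"
  have "finite A" by (simp add: A_def)
  have "\<forall>\<^sub>F \<eta> in at_right 0. \<forall>a\<in>A. \<eta> < \<bar>norm a - 1\<bar>"
    using \<open>finite A\<close>
    by (intro eventually_ball_finite ballI order_tendstoD(2)[OF tendsto_ident_at]) (auto simp: A_def)
  moreover have "\<forall>\<^sub>F \<eta> in at_right 0. \<eta> < r"
    by (rule order_tendstoD(2)[OF tendsto_ident_at r_bounds(1)])
  moreover have "\<forall>\<^sub>F \<eta> in at_right (0::real). 0 < \<eta>" by (rule eventually_at_right_less)
  ultimately have "\<forall>\<^sub>F \<eta> in at_right 0. 0 < \<eta> \<and> \<eta> < r \<and> (\<forall>a\<in>A. \<eta> < \<bar>norm a - 1\<bar>)"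
    by eventually_elim blast
  then obtain \<eta> where \<eta>: "0 < \<eta>" "\<eta> < r" "\<And>a. a \<in> A \<Longrightarrow> \<eta> < \<bar>norm a - 1\<bar>"
    using eventually_happens'[OF trivial_limit_at_right_real] by blast
  interpret crossing 4 "\<lambda>k w. coeff (charpoly (monodromy eps mu w)) k" f r \<zeta> v \<eta>
  proof
    fix l assume l: "1 - \<eta> \<le> norm l" "norm l \<le> 1 + \<eta>" "p l \<zeta> = 0"
    have "norm l = 1"
    proof (rule ccontr)
      assume "norm l \<noteq> 1"
      then have "l \<in> A" using l(3) by (simp add: A_def p_eq in_eigenvalues_iff)
      then show False using \<eta>(3)[of l] l(1,2) by linarith
    qed
    then show "norm l = 1 \<and> f l = \<zeta> \<and> deriv f l \<noteq> 0 \<and> v = sgn (deriv f l * l) \<and>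
        eventually (\<lambda>(l, w). p l w = 0 \<longrightarrow> f l = w) (nhds (l, f l))"
      using dir circ l(3) by blast
  qed (use \<eta> in auto)
  let ?U = "{#a \<in># ?E \<zeta>. norm a = 1#}"
  have split: "size {#a \<in># ?E \<zeta>. norm a \<le> 1#} = size {#a \<in># ?E \<zeta>. norm a < 1#} + size ?U"
  proof -
    have "{#a \<in># ?E \<zeta>. norm a \<le> 1#} = {#a \<in># ?E \<zeta>. norm a < 1#} + ?U"
      by (rule multiset_eqI) auto
    then show ?thesis by simp
  qed
  have \<xi>U: "l \<in># ?U" if "norm l = 1" "f l = \<zeta>" for l
    using band_root[of l] that by (simp add: in_eigenvalues_iff)
  have count: "\<forall>\<^sub>F t in at_right 0. inner_count eps mu (\<zeta> - of_real t * v) = inner_count eps mu (\<zeta> + of_real t * v) + size ?U"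
    using root_count_jump[of ?E] E split unfolding inner_count_def by (auto elim: eventually_mono)
  have U1: "size ?U = 1"
  proof -
    have "\<forall>\<^sub>F t::real in at_right 0. size ?U \<le> 1"
      using count off ind
    proof eventually_elim
      case (elim t)
      then show ?case
        using gap_index(1-3)[OF crystal bands, of "\<zeta> + of_real t * v"] gap_index(1-3)[OF crystal bands, of "\<zeta> - of_real t * v"]
        by auto
    qed
    then have "size ?U \<le> 1" using eventually_happens'[OF trivial_limit_at_right_real] by blast
    moreover have "?U \<noteq> {#}" using \<xi>U[OF \<xi>] by (metis empty_not_add_mset insert_DiffM)
    ultimately show ?thesis by (metis One_nat_def le_SucE le_zero_eq size_eq_0_iff_empty)
  qed
  have unique: "l = \<xi>" if "norm l = 1" "f l = \<zeta>" for l
  proof -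
    obtain u where "?U = {#u#}" using U1 size_1_singleton_mset by blast
    then show ?thesis using \<xi>U[OF \<xi>] \<xi>U[OF that] by (simp only: set_mset_single singleton_iff set_mset_add_mset_insert) simp
  qed
  have "\<forall>\<^sub>F t in at_right 0. winding_number loop (\<zeta> - of_real t * v) = winding_number loop (\<zeta> + of_real t * v) + 1"
    using winding_jump[OF \<xi>] unique unfolding circle_winding_loop by blast
  with count show ?thesis
    unfolding U1 by eventually_elim simp
qed

end

section \<open>Choice of a generic boundary point and conclusion on the whole component\<close>

context isolated_band
begin

text \<open>Critical points of \<open>f\<close> and exceptional points of \<open>local_roots\<close>
  spoil only finitely many values, whereas the arc through \<open>\<zeta>0\<close> offers infinitely
  many points with \<open>P\<close> and \<open>M\<close> on their two sides. That \<zeta> lies on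
  the frontier is recorded because the orientation predicates speak of such points only.\<close>

lemma generic_boundary_point:
  assumes B: "bounded_component (dispersion_curve \<omega> n) B"
    and D: "D \<in> components (- all_curves N \<omega>)"
    and \<zeta>0: "\<zeta>0 \<in> dispersion_curve \<omega> n"
    and normal: "outward_unit_normal (dispersion_curve \<omega> n) \<zeta>0 \<nu>"
    and outer_side: "\<forall>\<^sub>F t in at_right 0. \<zeta>0 + of_real t * \<nu> \<in> D"
    and inner_side: "\<forall>\<^sub>F t in at_right 0. \<zeta>0 - of_real t * \<nu> \<in> B"
  obtains \<zeta> \<nu>' where "\<zeta> \<in> frontier B" "\<zeta> \<in> dispersion_curve \<omega> n"
    "outward_unit_normal (dispersion_curve \<omega> n) \<zeta> \<nu>'"
    "\<forall>\<^sub>F t in at_right 0. \<zeta> + of_real t * \<nu>' \<in> D \<and> \<zeta> - of_real t * \<nu>' \<in> B"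
    "\<And>l. norm l = 1 \<Longrightarrow> f l = \<zeta> \<Longrightarrow> deriv f l \<noteq> 0 \<and>
      eventually (\<lambda>(l, w). p l w = 0 \<longrightarrow> f l = w) (nhds (l, f l))"
proof -
  let ?C = "dispersion_curve \<omega> n"
  obtain \<epsilon> where \<epsilon>: "\<epsilon> > 0" "\<And>m. m \<in> N \<Longrightarrow> m \<noteq> n \<Longrightarrow> ball \<zeta>0 \<epsilon> \<inter> dispersion_curve \<omega> m = {}"
    using curve_isolated[OF \<zeta>0] by blast
  have "unit_normal ?C \<zeta>0 \<nu>" using normal by (simp add: outward_unit_normal_def)
  then obtain \<delta> Z P M where "\<delta> > 0" and Z: "infinite Z" "Z \<subseteq> ?C" and conn: "connected P" "connected M"
    and PM: "P \<subseteq> ball \<zeta>0 \<epsilon> - ?C" "M \<subseteq> ball \<zeta>0 \<epsilon> - ?C"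
    and \<zeta>0PM: "\<And>t. t \<in> {0<..<\<delta>} \<Longrightarrow> \<zeta>0 + of_real t * \<nu> \<in> P \<and> \<zeta>0 - of_real t * \<nu> \<in> M"
    and ZPM: "\<And>z. z \<in> Z \<Longrightarrow> \<exists>\<nu>'. unit_normal ?C z \<nu>' \<and>
        (\<forall>t\<in>{0<..<\<delta>}. z + of_real t * \<nu>' \<in> P \<and> z - of_real t * \<nu>' \<in> M)"
    by (rule unit_normal_sides[OF _ \<epsilon>(1)]) blast
  have small: "\<forall>\<^sub>F t in at_right 0. t \<in> {0<..<\<delta>}"
    using \<open>\<delta> > 0\<close> by (rule eventually_at_right_real)
  have "\<forall>\<^sub>F t in at_right 0. \<zeta>0 + of_real t * \<nu> \<in> outside ?C"
    using normal by (simp add: outward_unit_normal_def)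
  with small outer_side inner_side
  have "\<forall>\<^sub>F t in at_right 0. \<zeta>0 + of_real t * \<nu> \<in> P \<inter> D \<inter> outside ?C \<and> \<zeta>0 - of_real t * \<nu> \<in> M \<inter> B"
    by eventually_elim (use \<zeta>0PM in auto)
  then obtain t0 :: real where t0: "\<zeta>0 + of_real t0 * \<nu> \<in> P \<inter> D \<inter> outside ?C" "\<zeta>0 - of_real t0 * \<nu> \<in> M \<inter> B"
    using eventually_happens'[OF trivial_limit_at_right_real] by blast
  \<comment> \<open>Inside the ball the other bands are absent by isolation, and \<open>P\<close>
    avoids the band itself; being connected, it then lies in a single component.\<close>
  have "P \<subseteq> - all_curves N \<omega>" using PM(1) \<epsilon>(2) unfolding all_curves_def by blast
  then have PD: "P \<subseteq> D" using components_maximal[OF D conn(1)] t0(1) by blast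
  have Bc: "B \<in> components (- ?C)" using B by (simp add: bounded_component_def)
  have MB: "M \<subseteq> B" using components_maximal[OF Bc conn(2)] PM(2) t0(2) by blast
  have Pout: "P \<subseteq> outside ?C"
  proof
    fix x assume "x \<in> P"
    then have "connected_component (- ?C) (\<zeta>0 + of_real t0 * \<nu>) x"
      using conn(1) PM(1) t0(1) unfolding connected_component_def by (intro exI[of _ P]) blast
    then show "x \<in> outside ?C" using t0(1) outside_same_component by blast
  qed
  obtain E where E: "finite E" "\<And>\<xi>. norm \<xi> = 1 \<Longrightarrow> \<xi> \<notin> E \<Longrightarrow>
      eventually (\<lambda>(l, w). p l w = 0 \<longrightarrow> f l = w) (nhds (\<xi>, f \<xi>))"
    using local_roots by blast
  define crit where "crit = {\<xi> \<in> sphere 0 1. deriv f \<xi> = 0}"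
  have df: "deriv f holomorphic_on ring" by (rule holomorphic_deriv[OF f_holomorphic open_ring])
  have "finite crit"
  proof (cases "deriv f constant_on ring")
    case False
    then show ?thesis unfolding crit_def
      by (intro holomorphic_compact_finite_zeros[OF df open_ring connected_ring _ sphere_ring]) simp_all
  next
    case True
    then obtain c where c: "\<And>l. l \<in> ring \<Longrightarrow> deriv f l = c" unfolding constant_on_def by blast
    \<comment> \<open>A constant \<open>f\<close> would shrink the curve to a point, but the arc
      contains the infinite set \<open>Z\<close>.\<close>
    have "c \<noteq> 0"
    proof
      assume "c = 0"
      then have "(f has_field_derivative 0) (at l)" if "l \<in> ring" for l
        using holomorphic_derivI[OF f_holomorphic open_ring that] c[OF that] by simp
      then obtain b where "\<And>l. l \<in> ring \<Longrightarrow> f l = b"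
        using has_field_derivative_0_imp_constant_on[OF _ connected_ring open_ring, of f] unfolding constant_on_def by blast
      then have "?C \<subseteq> {b}" using sphere_ring unfolding dispersion_curve_eq by blast
      with Z(2) have "Z \<subseteq> {b}" by (rule subset_trans)
      then have "finite Z" by (rule finite_subset) simp
      then show False using Z(1) by contradiction
    qed
    then have "crit = {}" using c sphere_ring unfolding crit_def by blast
    then show ?thesis by simp
  qed
  then have "finite (f ` (E \<union> crit))" using E(1) by simp
  then obtain \<zeta> where \<zeta>: "\<zeta> \<in> Z" "\<zeta> \<notin> f ` (E \<union> crit)"
    using Z(1) finite_subset[of Z "f ` (E \<union> crit)"] by blast
  obtain \<nu>' where \<nu>': "unit_normal ?C \<zeta> \<nu>'"
    "\<And>t. t \<in> {0<..<\<delta>} \<Longrightarrow> \<zeta> + of_real t * \<nu>' \<in> P \<and> \<zeta> - of_real t * \<nu>' \<in> M"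
    using ZPM[OF \<zeta>(1)] by blast
  have sides: "\<forall>\<^sub>F t in at_right 0. \<zeta> + of_real t * \<nu>' \<in> P \<and> \<zeta> - of_real t * \<nu>' \<in> M"
    using small by eventually_elim (rule \<nu>'(2))
  show ?thesis
  proof (rule that[of \<zeta> \<nu>'])
    show \<zeta>C: "\<zeta> \<in> ?C" using \<zeta>(1) Z(2) by blast
    show "outward_unit_normal ?C \<zeta> \<nu>'"
      unfolding outward_unit_normal_def using \<nu>'(1) sides Pout by (auto elim: eventually_mono)
    show "\<forall>\<^sub>F t in at_right 0. \<zeta> + of_real t * \<nu>' \<in> D \<and> \<zeta> - of_real t * \<nu>' \<in> B"
      using sides by eventually_elim (use PD MB in blast)
    have "((\<lambda>t. \<zeta> - of_real t * \<nu>') \<longlongrightarrow> \<zeta>) (at_right 0)" by (auto intro!: tendsto_eq_intros)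
    moreover have "\<forall>\<^sub>F t in at_right 0. \<zeta> - of_real t * \<nu>' \<in> B" using sides by eventually_elim (use MB in blast)
    ultimately have "\<zeta> \<in> closure B"
      using Lim_in_closed_set[OF closed_closure _ trivial_limit_at_right_real] closure_subset
      by (smt (verit, ccfv_threshold) eventually_mono subsetD)
    moreover have "\<zeta> \<notin> B" using \<zeta>C in_components_subset[OF Bc] by blast
    ultimately show "\<zeta> \<in> frontier B" unfolding frontier_def using interior_subset by blast
    show "deriv f l \<noteq> 0 \<and> eventually (\<lambda>(l, w). p l w = 0 \<longrightarrow> f l = w) (nhds (l, f l))"
      if l: "norm l = 1" "f l = \<zeta>" for l
    proof -
      have "l \<notin> E" "l \<notin> crit" using \<zeta>(2) l(2) by blast+
      then show ?thesis using E(2)[OF l(1)] l(1) by (simp add: crit_def)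
    qed
  qed
qed

text \<open>The sign \<open>s\<close> turns the outward normal into the crossing direction. On the
  outer side the winding number is 0, by membership in the unbounded component, and the count is 2,
  by membership in \<open>D\<close>. The jump then fixes both numbers at one point of
  \<open>B\<close>, and local constancy spreads them over \<open>B\<close>.\<close>

lemma index_and_winding:
  assumes B: "bounded_component (dispersion_curve \<omega> n) B" and B_disjoint: "B \<inter> all_curves N \<omega> = {}"
    and D: "principal_gapped_component eps mu N \<omega> D"
    and \<zeta>: "\<zeta> \<in> dispersion_curve \<omega> n"
    and outside: "\<forall>\<^sub>F t in at_right 0. \<zeta> + of_real t * \<nu> \<in> outside (dispersion_curve \<omega> n)"
    and sides: "\<forall>\<^sub>F t in at_right 0. \<zeta> + of_real t * \<nu> \<in> D \<and> \<zeta> - of_real t * \<nu> \<in> B"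
    and s: "s = 1 \<or> s = - 1"
    and dir: "\<And>l. norm l = 1 \<Longrightarrow> f l = \<zeta> \<Longrightarrow> deriv f l \<noteq> 0 \<and> of_real s * \<nu> = sgn (deriv f l * l) \<and>
      eventually (\<lambda>(l, w). p l w = 0 \<longrightarrow> f l = w) (nhds (l, f l))"
  shows "has_index eps mu B s \<and> (\<forall>w\<in>B. band_winding f w = of_real s)"
proof -
  let ?C = "dispersion_curve \<omega> n"
  have D0: "D \<subseteq> - all_curves N \<omega>" "\<And>w. w \<in> D \<Longrightarrow> Ind eps mu w = 0"
    using D in_components_subset by (auto simp: principal_gapped_component_def has_index_def)
  have Bc: "B \<in> components (- ?C)" using B by (simp add: bounded_component_def)
  obtain \<xi> where \<xi>: "norm \<xi> = 1" "f \<xi> = \<zeta>" using \<zeta> by (auto simp: dispersion_curve_eq)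
  have "\<forall>\<^sub>F t in at_right 0.
      inner_count eps mu (\<zeta> - of_real t * (of_real s * \<nu>)) = inner_count eps mu (\<zeta> + of_real t * (of_real s * \<nu>)) + 1 \<and>
      winding_number loop (\<zeta> - of_real t * (of_real s * \<nu>)) = winding_number loop (\<zeta> + of_real t * (of_real s * \<nu>)) + 1"
  proof (rule regular_crossing[OF \<xi> dir])
    show "\<forall>\<^sub>F t in at_right 0. \<zeta> + of_real t * (of_real s * \<nu>) \<notin> all_curves N \<omega> \<and> \<zeta> - of_real t * (of_real s * \<nu>) \<notin> all_curves N \<omega>"
      using sides by eventually_elim (use s D0(1) B_disjoint in auto)
    show "\<forall>\<^sub>F t in at_right 0. Ind eps mu (\<zeta> + of_real t * (of_real s * \<nu>)) = 0 \<or> Ind eps mu (\<zeta> - of_real t * (of_real s * \<nu>)) = 0"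
      using sides by eventually_elim (use s D0(2) in auto)
  qed
  with sides outside have "\<forall>\<^sub>F t::real in at_right 0. \<exists>w\<in>B. real (inner_count eps mu w) = 2 + s \<and> winding_number loop w = of_real s"
  proof eventually_elim
    case (elim t)
    let ?a = "\<zeta> + of_real t * \<nu>" and ?b = "\<zeta> - of_real t * \<nu>"
    have W: "winding_number loop ?a = 0"
      using elim(2) path_image_loop by (intro winding_number_zero_in_outside valid_path_imp_path valid_path_loop pathfinish_loop) simp
    have I: "real (inner_count eps mu ?a) = 2"
      using gap_index(1)[OF crystal bands, of ?a] D0 elim(1) by force
    from s have "real (inner_count eps mu ?b) = 2 + s \<and> winding_number loop ?b = of_real s"
    proof
      assume "s = 1"
      then show ?thesis using elim(3) W I by simp
    next
      assume s: "s = - 1"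
      have "inner_count eps mu ?a = inner_count eps mu ?b + 1" "winding_number loop ?a = winding_number loop ?b + 1"
        using elim(3) by (simp_all add: s)
      then show ?thesis using W I by (simp add: s eq_neg_iff_add_eq_0)
    qed
    then show ?case using elim(1) by blast
  qed
  then obtain w0 where w0: "w0 \<in> B" "real (inner_count eps mu w0) = 2 + s" "winding_number loop w0 = of_real s"
    using eventually_happens'[OF trivial_limit_at_right_real] by blast
  have "Ind eps mu w = s" "band_winding f w = of_real s" if w: "w \<in> B" for w
  proof -
    have BC: "B \<subseteq> - ?C" by (rule in_components_subset[OF Bc])
    have conn: "connected B" by (rule in_components_connected[OF Bc])
    have "inner_count eps mu w = inner_count eps mu w0" by (rule inner_count_const[OF conn B_disjoint w w0(1)])
    then show "Ind eps mu w = s"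
      using gap_index(1)[OF crystal bands, of w] w B_disjoint w0(2) by auto
    have "winding_number loop w = winding_number loop w0"
      using BC path_image_loop
      by (intro winding_number_eq[OF valid_path_imp_path[OF valid_path_loop] pathfinish_loop w w0(1) conn]) blast
    then show "band_winding f w = of_real s"
      using band_winding_eq[of w] BC w w0(3) by auto
  qed
  then show ?thesis by (simp add: has_index_def)
qed

end

theorem theorem13:
  fixes eps mu :: "real \<Rightarrow> complex^2^2"
    and N :: "int set" and \<omega> :: "int \<Rightarrow> real \<Rightarrow> complex"
    and n :: int and f :: "complex \<Rightarrow> complex"
    and B D :: "complex set" and \<xi>0 \<nu> :: complex
  assumes crystal: "photonic_crystal eps mu"
    and bands: "spectral_bands eps mu N \<omega>"
    and regular: "regular_curves N \<omega>"
    and n: "n \<in> N"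
    and closed_n: "closed_band \<omega> n"
    and isolated_n: "\<forall>m\<in>N. m \<noteq> n \<longrightarrow> dispersion_curve \<omega> n \<inter> dispersion_curve \<omega> m = {}"
    and analytic_n: "f analytic_on sphere 0 1"
    and extends_n: "\<forall>k\<in>{-pi..pi}. f (cis k) = \<omega> n k"
    and B: "bounded_component (dispersion_curve \<omega> n) B"
    and B_disjoint: "\<forall>m\<in>N. m \<noteq> n \<longrightarrow> B \<inter> dispersion_curve \<omega> m = {}"
    and D: "principal_gapped_component eps mu N \<omega> D"
    and \<xi>0: "\<xi>0 \<in> sphere 0 1" "f \<xi>0 \<in> frontier B"
    and normal: "outward_unit_normal (dispersion_curve \<omega> n) (f \<xi>0) \<nu>"
    and outer_side: "\<forall>\<^sub>F t in at_right 0. f \<xi>0 + of_real t * \<nu> \<in> D"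
    and inner_side: "\<forall>\<^sub>F t in at_right 0. f \<xi>0 - of_real t * \<nu> \<in> B"
    and analytic_\<xi>0: "f analytic_on {\<xi>0}"
  shows "(positively_oriented f B \<longrightarrow>
            has_index eps mu B 1 \<and> (\<forall>\<omega>B\<in>B. band_winding f \<omega>B = 1)) \<and>
         (negatively_oriented f B \<longrightarrow>
            has_index eps mu B (-1) \<and> (\<forall>\<omega>B\<in>B. band_winding f \<omega>B = -1))"
proof -
  have Bc: "B \<in> components (- dispersion_curve \<omega> n)" using B by (simp add: bounded_component_def)
  have Bdis: "B \<inter> all_curves N \<omega> = {}"
  proof -
    have "B \<inter> dispersion_curve \<omega> m = {}" if "m \<in> N" for m
      using in_components_subset[OF Bc] B_disjoint that by (cases "m = n") auto
    then show ?thesis unfolding all_curves_def by blast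
  qed
  obtain T where T: "open T" "sphere 0 1 \<subseteq> T" "f holomorphic_on T"
    using analytic_n analytic_on_holomorphic by blast
  obtain e where e: "e > 0" "(\<Union>x\<in>sphere 0 1. ball x e) \<subseteq> T"
    using compact_subset_open_imp_ball_epsilon_subset[OF compact_sphere T(1,2)] .
  define r where "r = min e 1"
  have r: "0 < r" "r \<le> 1" "r \<le> e" using e(1) by (auto simp: r_def)
  \<comment> \<open>Each point of the annulus is compared with its radial projection
    \<open>sgn l\<close>, at distance \<open>\<bar>norm l - 1\<bar>\<close>; the cap
    \<open>r \<le> 1\<close> keeps 0 out.\<close>
  have ringT: "{l. 1 - r < norm l \<and> norm l < 1 + r} \<subseteq> T"
  proof
    fix l :: complex assume "l \<in> {l. 1 - r < norm l \<and> norm l < 1 + r}"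
    then have l: "\<bar>norm l - 1\<bar> < r" "l \<noteq> 0" using r(2) by auto
    have "l - sgn l = of_real (norm l - 1) * sgn l"
      using l(2) by (simp add: sgn_div_norm scaleR_conv_of_real field_simps)
    then have "dist (sgn l) l = \<bar>norm l - 1\<bar>"
      using l(2) by (simp add: dist_norm norm_minus_commute[of "sgn l"] norm_mult norm_sgn del: of_real_diff)
    then have "l \<in> ball (sgn l) e" using l(1) r(3) by simp
    moreover have "sgn l \<in> sphere 0 1" using l(2) by (simp add: norm_sgn)
    ultimately show "l \<in> T" using e(2) by blast
  qed
  interpret isolated_band eps mu N \<omega> n f r
  proof
    \<comment> \<open>The nonempty set \<open>B\<close> lies off all curves.\<close>
    show "all_curves N \<omega> \<noteq> UNIV" using Bdis in_components_nonempty[OF Bc] by auto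
    show "f holomorphic_on {l. 1 - r < norm l \<and> norm l < 1 + r}"
      using T(3) ringT by (rule holomorphic_on_subset)
  qed (use crystal bands n isolated_n extends_n r in auto)
  have "f \<xi>0 \<in> dispersion_curve \<omega> n" using \<xi>0(1) by (simp add: dispersion_curve_eq)
  moreover have "D \<in> components (- all_curves N \<omega>)" using D by (simp add: principal_gapped_component_def)
  ultimately obtain \<zeta> \<nu>' where \<zeta>: "\<zeta> \<in> frontier B" "\<zeta> \<in> dispersion_curve \<omega> n"
    and \<nu>': "outward_unit_normal (dispersion_curve \<omega> n) \<zeta> \<nu>'"
    and sides: "\<forall>\<^sub>F t in at_right 0. \<zeta> + of_real t * \<nu>' \<in> D \<and> \<zeta> - of_real t * \<nu>' \<in> B"
    and pre: "\<And>l. norm l = 1 \<Longrightarrow> f l = \<zeta> \<Longrightarrow> deriv f l \<noteq> 0 \<and>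
      eventually (\<lambda>(l, w). p l w = 0 \<longrightarrow> f l = w) (nhds (l, f l))"
    using generic_boundary_point[OF B _ _ normal outer_side inner_side] by blast
  have out: "\<forall>\<^sub>F t in at_right 0. \<zeta> + of_real t * \<nu>' \<in> outside (dispersion_curve \<omega> n)"
    using \<nu>' by (simp add: outward_unit_normal_def)
  note conclude = index_and_winding[OF B Bdis D \<zeta>(2) out sides]
  show ?thesis
  proof (intro conjI impI)
    assume pos: "positively_oriented f B"
    have "of_real 1 * \<nu>' = sgn (deriv f l * l)" if l: "norm l = 1" "f l = \<zeta>" for l
    proof -
      have "l \<noteq> 0" using l(1) by auto
      then have "curve_tangent f l \<noteq> 0" using pre[OF l] by (simp add: curve_tangent_def)
      then have "\<nu>' = sgn (- \<i> * curve_tangent f l)"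
        using pos \<zeta>(1) \<nu>' l unfolding positively_oriented_def dispersion_curve_eq by simp
      also have "- \<i> * curve_tangent f l = deriv f l * l"
        by (simp add: curve_tangent_def mult.left_commute[of "deriv f l" \<i>])
      finally show ?thesis by simp
    qed
    then have "has_index eps mu B 1 \<and> (\<forall>w\<in>B. band_winding f w = of_real 1)"
      using pre by (intro conclude) auto
    then show "has_index eps mu B 1" "\<forall>\<omega>B\<in>B. band_winding f \<omega>B = 1" by simp_all
  next
    assume neg: "negatively_oriented f B"
    \<comment> \<open>With this orientation the crossing direction points into \<open>B\<close>, so
      a root leaves the disc on entering \<open>B\<close> and the count drops from 2 to 1.\<close>
    have "of_real (- 1) * \<nu>' = sgn (deriv f l * l)" if l: "norm l = 1" "f l = \<zeta>" for l
    proof -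
      have "l \<noteq> 0" using l(1) by auto
      then have "curve_tangent f l \<noteq> 0" using pre[OF l] by (simp add: curve_tangent_def)
      then have "\<nu>' = sgn (\<i> * curve_tangent f l)"
        using neg \<zeta>(1) \<nu>' l unfolding negatively_oriented_def dispersion_curve_eq by simp
      also have "\<i> * curve_tangent f l = - (deriv f l * l)"
        by (simp add: curve_tangent_def mult.left_commute[of "deriv f l" \<i>])
      finally show ?thesis by (simp add: sgn_minus)
    qed
    then have "has_index eps mu B (- 1) \<and> (\<forall>w\<in>B. band_winding f w = of_real (- 1))"
      using pre by (intro conclude) auto
    then show "has_index eps mu B (- 1)" "\<forall>\<omega>B\<in>B. band_winding f \<omega>B = - 1" by simp_all
  qed
qed

end
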